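(* Let $d \ge 2$ be an integer. There exists a Borel probability measure $\mu$ on $\mathbb{S}_d$ which is $\mathcal{A}_d$-Henkin and whose support is totally null.
   Context: $\mathbb{B}_d$ denotes the open unit ball of $\mathbb{C}^d$ and $\mathbb{S}_d = \partial \mathbb{B}_d$ the unit sphere. $A(\mathbb{B}_d)$ is the algebra of analytic functions on $\mathbb{B}_d$ which extend continuously to $\overline{\mathbb{B}_d}$ (functions are identified with their extensions). The Drury-Arveson space $H^2_d$ is the reproducing kernel Hilbert space on $\mathbb{B}_d$ with kernel $K(z,w) = \frac{1}{1-\langle z,w\rangle}$. Its multiplier algebra is $\mathcal{M}_d = \{\varphi : \mathbb{B}_d \to \mathbb{C} : \varphi f \in H^2_d \text{ for all } f \in H^2_d\}$, with norm $\|\varphi\|_{\mathcal{M}_d} = \|M_\varphi\|$, where $M_\varphi$ is the (bounded) operator of multiplication by $\varphi$ on $H^2_d$. Via $\varphi \mapsto M_\varphi$, $\mathcal{M}_d$ is identified with a weak-$*$ closed unital subalgebra of $B(H^2_d)$, the algebra of bounded operators on $H^2_d$; it is thereby a dual space and is endowed with the resulting weak-$*$ topology. $\mathcal{A}_d$ is the norm closure of the polynomials in $\mathcal{M}_d$; one has $\mathcal{A}_d \subset A(\mathbb{B}_d)$, so functions in $\mathcal{A}_d$ extend continuously to $\mathbb{S}_d$. A regular Borel measure $\mu$ on $\mathbb{S}_d$ is $\mathcal{A}_d$-Henkin if the functional $\mathcal{A}_d \to \mathbb{C}$, $f \mapsto \int_{\mathbb{S}_d} f \, d\mu$, extends to a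 weak-$*$ continuous functional on $\mathcal{M}_d$. A Borel probability measure $\tau$ on $\mathbb{S}_d$ is a representing measure for the origin if $\int_{\mathbb{S}_d} f \, d\tau = f(0)$ for all $f \in A(\mathbb{B}_d)$. A compact set $K \subset \mathbb{S}_d$ is totally null if $\tau(K) = 0$ for every representing measure $\tau$ for the origin. *)

theory Defs
  imports "HOL-Probability.Probability" "HOL-Library.Function_Algebras"
begin

section \<open>Hilbert spaces of functions and reproducing kernels\<close>

definition hnorm :: "(('a \<Rightarrow> complex) \<Rightarrow> ('a \<Rightarrow> complex) \<Rightarrow> complex) \<Rightarrow> ('a \<Rightarrow> complex) \<Rightarrow> real"
  where "hnorm ip f = sqrt (Re (ip f f))"

text \<open>The inner product is linear in the first argument. It is normalised to be \<open>0\<close> outside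
  the space, so that a space determines \<open>ip\<close> as a HOL function.\<close>

locale fun_hilbert_space =
  fixes H :: "('a \<Rightarrow> complex) set"
    and ip :: "('a \<Rightarrow> complex) \<Rightarrow> ('a \<Rightarrow> complex) \<Rightarrow> complex"
  assumes zero_mem: "0 \<in> H"
    and add_mem: "f \<in> H \<Longrightarrow> g \<in> H \<Longrightarrow> f + g \<in> H"
    and scale_mem: "f \<in> H \<Longrightarrow> (\<lambda>x. c * f x) \<in> H"
    and ip_add: "f \<in> H \<Longrightarrow> g \<in> H \<Longrightarrow> h \<in> H \<Longrightarrow> ip (f + g) h = ip f h + ip g h"
    and ip_scale: "f \<in> H \<Longrightarrow> g \<in> H \<Longrightarrow> ip (\<lambda>x. c * f x) g = c * ip f g"
    and ip_cnj: "f \<in> H \<Longrightarrow> g \<in> H \<Longrightarrow> ip g f = cnj (ip f g)"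
    and ip_pos: "f \<in> H \<Longrightarrow> f \<noteq> 0 \<Longrightarrow> 0 < Re (ip f f)"
    and ip_outside: "f \<notin> H \<or> g \<notin> H \<Longrightarrow> ip f g = 0"
    and complete: "(\<And>n::nat. F n \<in> H) \<Longrightarrow>
        (\<And>e. 0 < e \<Longrightarrow> \<exists>N. \<forall>m\<ge>N. \<forall>n\<ge>N. hnorm ip (F m - F n) < e) \<Longrightarrow>
        \<exists>f\<in>H. (\<lambda>n. hnorm ip (F n - f)) \<longlonglongrightarrow> 0"

text \<open>Functions on \<open>X\<close> are represented as total functions that vanish off \<open>X\<close>.\<close>

definition kernel_fun :: "'a set \<Rightarrow> ('a \<Rightarrow> 'a \<Rightarrow> complex) \<Rightarrow> 'a \<Rightarrow> 'a \<Rightarrow> complex"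
  where "kernel_fun X K w = (\<lambda>z. if z \<in> X then K z w else 0)"

locale rkhs = fun_hilbert_space H ip
  for H :: "('a \<Rightarrow> complex) set" and ip
  + fixes X :: "'a set" and K :: "'a \<Rightarrow> 'a \<Rightarrow> complex"
  assumes off: "f \<in> H \<Longrightarrow> x \<notin> X \<Longrightarrow> f x = 0"
    and kernel_mem: "w \<in> X \<Longrightarrow> kernel_fun X K w \<in> H"
    and reproducing: "f \<in> H \<Longrightarrow> w \<in> X \<Longrightarrow> f w = ip f (kernel_fun X K w)"

section \<open>Bounded operators, the weak-star topology and multipliers\<close>

text \<open>Operators on \<open>H\<close> are represented as functions that are \<open>undefined\<close> outside \<open>H\<close>.\<close>

definition op_norm :: "('a \<Rightarrow> complex) set \<Rightarrow> (('a \<Rightarrow> complex) \<Rightarrow> ('a \<Rightarrow> complex) \<Rightarrow> complex) \<Rightarrow>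
    (('a \<Rightarrow> complex) \<Rightarrow> ('a \<Rightarrow> complex)) \<Rightarrow> ereal"
  where "op_norm H ip T = (SUP f\<in>{f \<in> H. hnorm ip f \<le> 1}. ereal (hnorm ip (T f)))"

definition bounded_ops :: "('a \<Rightarrow> complex) set \<Rightarrow> (('a \<Rightarrow> complex) \<Rightarrow> ('a \<Rightarrow> complex) \<Rightarrow> complex) \<Rightarrow>
    (('a \<Rightarrow> complex) \<Rightarrow> ('a \<Rightarrow> complex)) set"
  where "bounded_ops H ip = {T \<in> H \<rightarrow>\<^sub>E H.
    (\<forall>f\<in>H. \<forall>g\<in>H. T (f + g) = T f + T g) \<and>
    (\<forall>c. \<forall>f\<in>H. T (\<lambda>x. c * f x) = (\<lambda>x. c * T f x)) \<and>
    op_norm H ip T < \<infinity>}"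

definition square_summable :: "('a \<Rightarrow> complex) set \<Rightarrow>
    (('a \<Rightarrow> complex) \<Rightarrow> ('a \<Rightarrow> complex) \<Rightarrow> complex) \<Rightarrow> (nat \<Rightarrow> 'a \<Rightarrow> complex) \<Rightarrow> bool"
  where "square_summable H ip F \<longleftrightarrow>
    (\<forall>n. F n \<in> H) \<and> summable (\<lambda>n. (hnorm ip (F n))\<^sup>2)"

text \<open>The weak-star topology of \<open>B(H)\<close> as the dual of the trace class: the trace class operators
  are the sums \<open>A = \<Sum>n. F n \<otimes> (G n)\<^sup>*\<close> with square summable \<open>F\<close> and \<open>G\<close>, and the
  functional given by \<open>A\<close> is \<open>T \<mapsto> tr (T A) = \<Sum>n. \<langle>T (F n), G n\<rangle>\<close>.\<close>

definition weak_star_topology :: "('a \<Rightarrow> complex) set \<Rightarrow>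
    (('a \<Rightarrow> complex) \<Rightarrow> ('a \<Rightarrow> complex) \<Rightarrow> complex) \<Rightarrow>
    (('a \<Rightarrow> complex) \<Rightarrow> ('a \<Rightarrow> complex)) topology"
  where "weak_star_topology H ip = topology_generated_by
    {{T \<in> bounded_ops H ip. (\<Sum>n. ip (T (F n)) (G n)) \<in> U} | F G U.
      square_summable H ip F \<and> square_summable H ip G \<and> open U}"

definition multipliers :: "'a set \<Rightarrow> ('a \<Rightarrow> complex) set \<Rightarrow> ('a \<Rightarrow> complex) set"
  where "multipliers X H = {\<phi>. (\<forall>x. x \<notin> X \<longrightarrow> \<phi> x = 0) \<and> (\<forall>f\<in>H. \<phi> * f \<in> H)}"

definition mult_op :: "('a \<Rightarrow> complex) set \<Rightarrow> ('a \<Rightarrow> complex) \<Rightarrow> ('a \<Rightarrow> complex) \<Rightarrow> ('a \<Rightarrow> complex)"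
  where "mult_op H \<phi> = (\<lambda>f\<in>H. \<phi> * f)"

definition multiplier_topology :: "'a set \<Rightarrow> ('a \<Rightarrow> complex) set \<Rightarrow>
    (('a \<Rightarrow> complex) \<Rightarrow> ('a \<Rightarrow> complex) \<Rightarrow> complex) \<Rightarrow> ('a \<Rightarrow> complex) topology"
  where "multiplier_topology X H ip =
    pullback_topology (multipliers X H) (mult_op H) (weak_star_topology H ip)"

section \<open>The Drury--Arveson space\<close>

definition da_kernel :: "complex ^ 'd::finite \<Rightarrow> complex ^ 'd \<Rightarrow> complex"
  where "da_kernel z w = 1 / (1 - (\<Sum>i\<in>UNIV. z $ i * cnj (w $ i)))"

definition drury_arveson :: "(complex ^ 'd::finite \<Rightarrow> complex) set \<times>
    ((complex ^ 'd \<Rightarrow> complex) \<Rightarrow> (complex ^ 'd \<Rightarrow> complex) \<Rightarrow> complex)"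
  where "drury_arveson = (THE (H, ip). rkhs H ip (ball 0 1) da_kernel)"

definition DA_space :: "(complex ^ 'd::finite \<Rightarrow> complex) set"
  where "DA_space = fst drury_arveson"

definition DA_ip :: "(complex ^ 'd::finite \<Rightarrow> complex) \<Rightarrow> (complex ^ 'd \<Rightarrow> complex) \<Rightarrow> complex"
  where "DA_ip = snd drury_arveson"

definition DA_multipliers :: "(complex ^ 'd::finite \<Rightarrow> complex) set"
  where "DA_multipliers = multipliers (ball 0 1) DA_space"

definition DA_mult_norm :: "(complex ^ 'd::finite \<Rightarrow> complex) \<Rightarrow> ereal"
  where "DA_mult_norm \<phi> = op_norm DA_space DA_ip (mult_op DA_space \<phi>)"

text \<open>Polynomials as functions on the ball, hence cut off outside of it.\<close>

definition ball_polynomials :: "(complex ^ 'd::finite \<Rightarrow> complex) set"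
  where "ball_polynomials = {p. \<exists>(A :: ('d \<Rightarrow> nat) set) c. finite A \<and>
    p = (\<lambda>z. if z \<in> ball 0 1 then \<Sum>\<alpha>\<in>A. c \<alpha> * (\<Prod>i\<in>UNIV. (z $ i) ^ \<alpha> i) else 0)}"

text \<open>The norm closure of the polynomials in the multiplier algebra; every polynomial is in fact
  a multiplier.\<close>

definition DA_algebra :: "(complex ^ 'd::finite \<Rightarrow> complex) set"
  where "DA_algebra = {\<phi> \<in> DA_multipliers.
    \<forall>e>0. \<exists>p\<in>ball_polynomials \<inter> DA_multipliers. DA_mult_norm (\<phi> - p) < ereal e}"

section \<open>Henkin measures and totally null sets\<close>

definition borel_prob_on_sphere :: "(complex ^ 'd::finite) measure \<Rightarrow> bool"
  where "borel_prob_on_sphere \<mu> \<longleftrightarrow>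
    prob_space \<mu> \<and> sets \<mu> = sets (restrict_space borel (sphere 0 1))"

text \<open>Elements of \<open>DA_algebra\<close> vanish off the open ball as HOL functions; their values on the
  sphere are those of the continuous extension, i.e. limits from inside the ball.\<close>

definition boundary_extension :: "(complex ^ 'd::finite \<Rightarrow> complex) \<Rightarrow> complex ^ 'd \<Rightarrow> complex"
  where "boundary_extension \<phi> \<zeta> = Lim (at \<zeta> within ball 0 1) \<phi>"

text \<open>Meant for finite positive Borel measures on the sphere, which are automatically regular.\<close>

definition A_henkin :: "(complex ^ 'd::finite) measure \<Rightarrow> bool"
  where "A_henkin \<mu> \<longleftrightarrow> (\<exists>\<Lambda> :: (complex ^ 'd \<Rightarrow> complex) \<Rightarrow> complex.
    (\<forall>\<phi>\<in>DA_multipliers. \<forall>\<psi>\<in>DA_multipliers. \<Lambda> (\<phi> + \<psi>) = \<Lambda> \<phi> + \<Lambda> \<psi>) \<and>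
    (\<forall>c. \<forall>\<phi>\<in>DA_multipliers. \<Lambda> (\<lambda>z. c * \<phi> z) = c * \<Lambda> \<phi>) \<and>
    continuous_map (multiplier_topology (ball 0 1) DA_space DA_ip) euclidean \<Lambda> \<and>
    (\<forall>\<phi>\<in>DA_algebra. \<Lambda> \<phi> = (\<integral>\<zeta>. boundary_extension \<phi> \<zeta> \<partial>\<mu>)))"

definition complex_differentiable_at :: "(complex ^ 'd::finite \<Rightarrow> complex) \<Rightarrow> complex ^ 'd \<Rightarrow> bool"
  where "complex_differentiable_at f z \<longleftrightarrow>
    (\<exists>D. (f has_derivative D) (at z) \<and> (\<forall>c v. D (c *s v) = c * D v))"

text \<open>The ball algebra, as continuous functions on the closed ball (values elsewhere are
  irrelevant).\<close>

definition ball_algebra :: "(complex ^ 'd::finite \<Rightarrow> complex) set"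
  where "ball_algebra = {f. continuous_on (cball 0 1) f \<and>
    (\<forall>z\<in>ball 0 1. complex_differentiable_at f z)}"

definition representing_measure :: "(complex ^ 'd::finite) measure \<Rightarrow> bool"
  where "representing_measure \<tau> \<longleftrightarrow> borel_prob_on_sphere \<tau> \<and>
    (\<forall>f\<in>ball_algebra. (\<integral>\<zeta>. f \<zeta> \<partial>\<tau>) = f 0)"

definition totally_null :: "(complex ^ 'd::finite) set \<Rightarrow> bool"
  where "totally_null K \<longleftrightarrow> compact K \<and> K \<subseteq> sphere 0 1 \<and>
    (\<forall>\<tau>. representing_measure \<tau> \<longrightarrow> emeasure \<tau> K = 0)"

definition measure_support :: "'a::topological_space measure \<Rightarrow> 'a set"
  where "measure_support \<mu> = {x \<in> space \<mu>. \<forall>U. open U \<and> x \<in> U \<longrightarrow> 0 < emeasure \<mu> (U \<inter> space \<mu>)}"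

section \<open>The Drury--Arveson space is well defined\<close>

text \<open>Existence and uniqueness of the reproducing kernel Hilbert space with kernel \<open>da_kernel\<close>,
  so that the definite description in \<open>drury_arveson\<close> denotes it.\<close>

context fun_hilbert_space
begin

lemma uminus_mem: "f \<in> H \<Longrightarrow> - f \<in> H"
  using scale_mem[of f "-1"] by (simp add: fun_Compl_def)

lemma diff_mem: "f \<in> H \<Longrightarrow> g \<in> H \<Longrightarrow> f - g \<in> H"
  using add_mem[OF _ uminus_mem, of f g] by simp

lemma ip_add_right: "f \<in> H \<Longrightarrow> g \<in> H \<Longrightarrow> h \<in> H \<Longrightarrow> ip h (f + g) = ip h f + ip h g"
  by (metis add_mem complex_cnj_add ip_add ip_cnj)

lemma ip_scale_right: "f \<in> H \<Longrightarrow> g \<in> H \<Longrightarrow> ip f (\<lambda>x. c * g x) = cnj c * ip f g"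
  by (metis complex_cnj_mult ip_cnj ip_scale scale_mem)

lemma ip_minus: "f \<in> H \<Longrightarrow> g \<in> H \<Longrightarrow> ip (- f) g = - ip f g"
  using ip_scale[of f g "-1"] by (simp add: fun_Compl_def)

lemma ip_diff: "f \<in> H \<Longrightarrow> g \<in> H \<Longrightarrow> h \<in> H \<Longrightarrow> ip (f - g) h = ip f h - ip g h"
  using ip_add[OF _ uminus_mem, of f g h] by (simp add: ip_minus)

lemma ip_diff_right: "f \<in> H \<Longrightarrow> g \<in> H \<Longrightarrow> h \<in> H \<Longrightarrow> ip h (f - g) = ip h f - ip h g"
  by (metis diff_mem complex_cnj_diff ip_diff ip_cnj)

lemma ip_zero [simp]: "ip 0 f = 0"
proof (cases "f \<in> H")
  case True
  then show ?thesis using ip_diff[OF zero_mem zero_mem, of f] by simp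
qed (simp add: ip_outside)

lemma ip_nonneg: "f \<in> H \<Longrightarrow> 0 \<le> Re (ip f f)"
  using ip_pos[of f] by (cases "f = 0") auto

lemma ip_self_real: "f \<in> H \<Longrightarrow> ip f f = of_real (Re (ip f f))"
  by (metis Reals_cnj_iff ip_cnj of_real_Re)

lemma hnorm_sq: "f \<in> H \<Longrightarrow> (hnorm ip f)\<^sup>2 = Re (ip f f)"
  by (simp add: hnorm_def ip_nonneg)

lemma hnorm_nonneg: "f \<in> H \<Longrightarrow> 0 \<le> hnorm ip f"
  by (simp add: hnorm_def ip_nonneg)

lemma hnorm_eq_0: "f \<in> H \<Longrightarrow> hnorm ip f = 0 \<Longrightarrow> f = 0"
  using ip_pos[of f] by (force simp: hnorm_def)

lemma hnorm_scale: "f \<in> H \<Longrightarrow> hnorm ip (\<lambda>x. c * f x) = cmod c * hnorm ip f"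
proof -
  assume f: "f \<in> H"
  have "ip (\<lambda>x. c * f x) (\<lambda>x. c * f x) = (c * cnj c) * ip f f"
    using f by (simp add: ip_scale ip_scale_right scale_mem)
  also have "\<dots> = of_real ((cmod c)\<^sup>2) * ip f f"
    by (simp add: complex_mult_cnj cmod_def)
  finally show ?thesis
    by (simp add: hnorm_def real_sqrt_mult)
qed

lemma hnorm_sq_diff:
  assumes "f \<in> H" "g \<in> H"
  shows "(hnorm ip (f - g))\<^sup>2 = (hnorm ip f)\<^sup>2 + (hnorm ip g)\<^sup>2 - 2 * Re (ip f g)"
proof -
  have "ip g f = cnj (ip f g)" using assms by (rule ip_cnj)
  then show ?thesis
    using assms by (simp add: hnorm_sq diff_mem ip_diff ip_diff_right)
qed

lemma Cauchy_Schwarz: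
  assumes f: "f \<in> H" and g: "g \<in> H"
  shows "cmod (ip f g) \<le> hnorm ip f * hnorm ip g"
proof (cases "g = 0")
  case True
  then show ?thesis using ip_cnj[OF zero_mem f] f by (simp add: hnorm_def)
next
  case False
  define b where "b = Re (ip g g)"
  have b: "0 < b" "ip g g = of_real b" using ip_pos[OF g False] ip_self_real[OF g] by (auto simp: b_def)
  define c where "c = ip f g / of_real b"
  have "0 \<le> (hnorm ip (f - (\<lambda>x. c * g x)))\<^sup>2" by simp
  also have "\<dots> = (hnorm ip f)\<^sup>2 + (cmod c)\<^sup>2 * (hnorm ip g)\<^sup>2 - 2 * Re (cnj c * ip f g)"
    using f g by (simp add: hnorm_sq_diff scale_mem hnorm_scale ip_scale_right power_mult_distrib)
  also have "cnj c * ip f g = of_real ((cmod (ip f g))\<^sup>2 / b)"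
    by (simp add: c_def complex_norm_square mult.commute del: of_real_power)
  also have "(hnorm ip g)\<^sup>2 = b" using g by (simp add: hnorm_sq b_def)
  finally have "0 \<le> (hnorm ip f)\<^sup>2 - (cmod (ip f g))\<^sup>2 / b"
    using b(1) by (simp add: c_def norm_divide power_divide power2_eq_square)
  then have "(cmod (ip f g))\<^sup>2 \<le> (hnorm ip f)\<^sup>2 * b"
    using b(1) by (simp add: field_simps)
  then have "(cmod (ip f g))\<^sup>2 \<le> (hnorm ip f * hnorm ip g)\<^sup>2"
    using \<open>(hnorm ip g)\<^sup>2 = b\<close> by (simp add: power_mult_distrib)
  then show ?thesis
    by (rule power2_le_imp_le) (simp add: f g hnorm_nonneg)
qed

lemma hnorm_triangle:
  assumes f: "f \<in> H" and g: "g \<in> H"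
  shows "hnorm ip (f - g) \<le> hnorm ip f + hnorm ip g"
proof (rule power2_le_imp_le)
  have "- Re (ip f g) \<le> hnorm ip f * hnorm ip g"
    using Cauchy_Schwarz[OF f g] abs_Re_le_cmod[of "ip f g"] by linarith
  then show "(hnorm ip (f - g))\<^sup>2 \<le> (hnorm ip f + hnorm ip g)\<^sup>2"
    using f g by (simp add: hnorm_sq_diff power2_sum)
qed (simp add: f g hnorm_nonneg)

lemma hnorm_minus_commute: "f \<in> H \<Longrightarrow> g \<in> H \<Longrightarrow> hnorm ip (f - g) = hnorm ip (g - f)"
  using hnorm_scale[OF diff_mem, of g f "-1"] by (simp add: fun_diff_def)

lemma ip_tendsto:
  assumes "\<And>n. F n \<in> H" "f \<in> H" "(\<lambda>n. hnorm ip (F n - f)) \<longlonglongrightarrow> 0"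
    and "\<And>n. G n \<in> H" "g \<in> H" "(\<lambda>n. hnorm ip (G n - g)) \<longlonglongrightarrow> 0"
  shows "(\<lambda>n. ip (F n) (G n)) \<longlonglongrightarrow> ip f g"
proof -
  have eq: "ip (F n) (G n) - ip f g = ip (F n - f) (G n - g) + ip (F n - f) g + ip f (G n - g)" for n
    using assms by (simp add: ip_diff ip_diff_right diff_mem)
  have "(\<lambda>n. ip (F n) (G n) - ip f g) \<longlonglongrightarrow> 0"
  proof (rule Lim_null_comparison)
    show "(\<lambda>n. hnorm ip (F n - f) * hnorm ip (G n - g) + hnorm ip (F n - f) * hnorm ip g
        + hnorm ip f * hnorm ip (G n - g)) \<longlonglongrightarrow> 0"
      by (rule tendsto_eq_intros assms refl | simp)+
    show "\<forall>\<^sub>F n in sequentially. cmod (ip (F n) (G n) - ip f g)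
      \<le> hnorm ip (F n - f) * hnorm ip (G n - g) + hnorm ip (F n - f) * hnorm ip g
        + hnorm ip f * hnorm ip (G n - g)"
    proof (intro always_eventually allI)
      fix n
      have "cmod (ip (F n - f) (G n - g)) \<le> hnorm ip (F n - f) * hnorm ip (G n - g)"
        "cmod (ip (F n - f) g) \<le> hnorm ip (F n - f) * hnorm ip g"
        "cmod (ip f (G n - g)) \<le> hnorm ip f * hnorm ip (G n - g)"
        using assms by (auto intro!: Cauchy_Schwarz diff_mem)
      then show "cmod (ip (F n) (G n) - ip f g)
      \<le> hnorm ip (F n - f) * hnorm ip (G n - g) + hnorm ip (F n - f) * hnorm ip g
        + hnorm ip f * hnorm ip (G n - g)"
        unfolding eq by (smt (verit) norm_triangle_ineq)
    qed
  qed
  then show ?thesis by (simp add: LIM_zero_iff)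
qed

end

text \<open>Square summable families.\<close>

definition l2 :: "('i \<Rightarrow> complex) set"
  where "l2 = {a. (\<lambda>i. (cmod (a i))\<^sup>2) summable_on UNIV}"

definition l2_ip :: "('i \<Rightarrow> complex) \<Rightarrow> ('i \<Rightarrow> complex) \<Rightarrow> complex"
  where "l2_ip a b = (if a \<in> l2 \<and> b \<in> l2 then \<Sum>\<^sub>\<infinity>i. a i * cnj (b i) else 0)"

lemma l2_prod:
  assumes "a \<in> l2" "b \<in> l2" shows "(\<lambda>i. a i * cnj (b i)) summable_on UNIV"
proof (rule abs_summable_summable, rule abs_summable_product)
  show "(\<lambda>i. norm (a i * a i)) summable_on UNIV" "(\<lambda>i. norm (cnj (b i) * cnj (b i))) summable_on UNIV"
    using assms by (simp_all add: l2_def norm_mult power2_eq_square)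
qed

lemma l2_zero: "0 \<in> l2"
  by (simp add: l2_def)

lemma l2_scale: "a \<in> l2 \<Longrightarrow> (\<lambda>i. c * a i) \<in> l2"
  by (simp add: l2_def norm_mult power_mult_distrib summable_on_cmult_right)

lemma l2_add: assumes "a \<in> l2" "b \<in> l2" shows "a + b \<in> l2"
proof -
  have "(\<lambda>i. 2 * (cmod (a i))\<^sup>2 + 2 * (cmod (b i))\<^sup>2) summable_on UNIV"
    using assms by (intro summable_on_add summable_on_cmult_right) (auto simp: l2_def)
  then have "(\<lambda>i. (cmod ((a + b) i))\<^sup>2) summable_on UNIV"
  proof (rule summable_on_comparison_test)
    fix i
    have "(cmod (a i + b i))\<^sup>2 \<le> (cmod (a i) + cmod (b i))\<^sup>2"
      by (intro power_mono norm_triangle_ineq) auto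
    also have "\<dots> \<le> 2 * (cmod (a i))\<^sup>2 + 2 * (cmod (b i))\<^sup>2"
      using sum_squares_bound[of "cmod (a i)" "cmod (b i)"] by (simp add: power2_sum)
    finally show "(cmod ((a + b) i))\<^sup>2 \<le> 2 * (cmod (a i))\<^sup>2 + 2 * (cmod (b i))\<^sup>2" by simp
  qed auto
  then show ?thesis by (simp add: l2_def)
qed

lemma l2_diff: "a \<in> l2 \<Longrightarrow> b \<in> l2 \<Longrightarrow> a - b \<in> l2"
  using l2_add[OF _ l2_scale[of b "-1"], of a] by (simp add: plus_fun_def fun_diff_def)

lemma l2_hnorm: "a \<in> l2 \<Longrightarrow> (hnorm l2_ip a)\<^sup>2 = (\<Sum>\<^sub>\<infinity>i. (cmod (a i))\<^sup>2)"
  "a \<in> l2 \<Longrightarrow> Re (l2_ip a a) = (\<Sum>\<^sub>\<infinity>i. (cmod (a i))\<^sup>2)"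
proof -
  assume a: "a \<in> l2"
  have "l2_ip a a = (\<Sum>\<^sub>\<infinity>i. complex_of_real ((cmod (a i))\<^sup>2))"
    using a by (auto simp: l2_ip_def complex_norm_square simp del: of_real_power intro!: infsum_cong)
  also have "\<dots> = of_real (\<Sum>\<^sub>\<infinity>i. (cmod (a i))\<^sup>2)"
    using a by (intro infsumI has_sum_of_real has_sum_infsum) (simp add: l2_def)
  finally show *: "Re (l2_ip a a) = (\<Sum>\<^sub>\<infinity>i. (cmod (a i))\<^sup>2)" by simp
  show "(hnorm l2_ip a)\<^sup>2 = (\<Sum>\<^sub>\<infinity>i. (cmod (a i))\<^sup>2)"
    unfolding hnorm_def * by (simp add: infsum_nonneg)
qed

lemma l2_sum_le: "a \<in> l2 \<Longrightarrow> finite S \<Longrightarrow> (\<Sum>i\<in>S. (cmod (a i))\<^sup>2) \<le> (hnorm l2_ip a)\<^sup>2"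
  unfolding l2_hnorm by (rule finite_sum_le_infsum) (auto simp: l2_def)

interpretation l2: fun_hilbert_space l2 l2_ip
proof
  fix f g h :: "'i \<Rightarrow> complex" and c
  show "l2_ip (f + g) h = l2_ip f h + l2_ip g h" if "f \<in> l2" "g \<in> l2" "h \<in> l2"
    using that by (simp add: l2_ip_def l2_add l2_prod ring_distribs infsum_add)
  show "l2_ip (\<lambda>x. c * f x) g = c * l2_ip f g" if "f \<in> l2" "g \<in> l2"
    using that by (simp add: l2_ip_def l2_scale l2_prod infsum_cmult_right mult.assoc)
  show "l2_ip g f = cnj (l2_ip f g)" if "f \<in> l2" "g \<in> l2"
    using that by (simp add: l2_ip_def mult.commute flip: infsum_cnj)
  show "0 < Re (l2_ip f f)" if f: "f \<in> l2" "f \<noteq> 0"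
  proof -
    from f obtain i where "f i \<noteq> 0" by (auto simp: fun_eq_iff)
    then have "0 < (\<Sum>i\<in>{i}. (cmod (f i))\<^sup>2)" by simp
    also have "\<dots> \<le> Re (l2_ip f f)" using l2_sum_le[OF f(1), of "{i}"] by (simp add: l2_hnorm[OF f(1)])
    finally show ?thesis .
  qed
next
  fix F :: "nat \<Rightarrow> 'i \<Rightarrow> complex"
  assume F: "\<And>n. F n \<in> l2"
    and C: "\<And>e. 0 < e \<Longrightarrow> \<exists>N. \<forall>m\<ge>N. \<forall>n\<ge>N. hnorm l2_ip (F m - F n) < e"
  have nn: "0 \<le> hnorm l2_ip (F m - F n)" for m n
    unfolding hnorm_def l2_hnorm(2)[OF l2_diff[OF F F]] by (simp add: infsum_nonneg)
  have pt: "cmod (F m i - F n i) \<le> hnorm l2_ip (F m - F n)" for m n i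
    using l2_sum_le[OF l2_diff[OF F F], of "{i}" m n] nn by (auto intro: power2_le_imp_le)
  have "convergent (\<lambda>n. F n i)" for i
    unfolding Cauchy_convergent_iff[symmetric] Cauchy_def dist_norm
    using C pt[of _ i] by (meson le_less_trans)
  then obtain f where f: "\<And>i. (\<lambda>n. F n i) \<longlonglongrightarrow> f i"
    unfolding convergent_def by metis
  have tail: "\<exists>N. \<forall>n\<ge>N. F n - f \<in> l2 \<and> hnorm l2_ip (F n - f) \<le> e" if e: "0 < e" for e
  proof -
    obtain N where N: "\<And>m n. m \<ge> N \<Longrightarrow> n \<ge> N \<Longrightarrow> hnorm l2_ip (F m - F n) < e"
      using C[OF e] by blast
    have b: "(\<Sum>i\<in>S. (cmod (F n i - f i))\<^sup>2) \<le> e\<^sup>2" if S: "finite S" and n: "n \<ge> N" for S n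
    proof (rule tendsto_le[OF trivial_limit_sequentially tendsto_const])
      show "(\<lambda>m. \<Sum>i\<in>S. (cmod (F n i - F m i))\<^sup>2) \<longlonglongrightarrow> (\<Sum>i\<in>S. (cmod (F n i - f i))\<^sup>2)"
        by (intro tendsto_intros f)
      show "\<forall>\<^sub>F m in sequentially. (\<Sum>i\<in>S. (cmod (F n i - F m i))\<^sup>2) \<le> e\<^sup>2"
        using eventually_ge_at_top[of N]
      proof eventually_elim
        case (elim m)
        have "(\<Sum>i\<in>S. (cmod (F n i - F m i))\<^sup>2) \<le> (hnorm l2_ip (F n - F m))\<^sup>2"
          using l2_sum_le[OF l2_diff[OF F F] S, of n m] by simp
        also have "\<dots> \<le> e\<^sup>2"
          using N[OF n elim] nn[of n m] by (intro power_mono) auto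
        finally show ?case .
      qed
    qed
    have m: "F n - f \<in> l2" if "n \<ge> N" for n
      unfolding l2_def using b[OF _ that]
      by (auto intro!: nonneg_bounded_partial_sums_imp_summable_on[where C="e\<^sup>2"] eventually_finite_subsets_at_top_weakI)
    have "hnorm l2_ip (F n - f) \<le> e" if n: "n \<ge> N" for n
    proof (rule power2_le_imp_le)
      show "(hnorm l2_ip (F n - f))\<^sup>2 \<le> e\<^sup>2"
        unfolding l2_hnorm(1)[OF m[OF n]] using m[OF n] b[OF _ n]
        by (intro infsum_le_finite_sums) (auto simp: l2_def)
    qed (use e in simp)
    then show ?thesis using m by blast
  qed
  obtain n where "F n - f \<in> l2" using tail[of 1] by auto
  then have fm: "f \<in> l2" using l2_diff[OF F[of n], of "F n - f"] by simp
  have "(\<lambda>n. hnorm l2_ip (F n - f)) \<longlonglongrightarrow> 0"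
  proof (rule LIMSEQ_I)
    fix r :: real assume "0 < r"
    then obtain N where N: "\<forall>n\<ge>N. hnorm l2_ip (F n - f) \<le> r / 2" using tail[of "r/2"] by auto
    have "0 \<le> hnorm l2_ip (F n - f)" for n
      unfolding hnorm_def l2_hnorm(2)[OF l2_diff[OF F fm]] by (simp add: infsum_nonneg)
    then show "\<exists>N. \<forall>n\<ge>N. norm (hnorm l2_ip (F n - f) - 0) < r"
      using N \<open>0 < r\<close> by (intro exI[of _ N]) force
  qed
  then show "\<exists>f\<in>l2. (\<lambda>n. hnorm l2_ip (F n - f)) \<longlonglongrightarrow> 0" using fm by blast
qed (auto simp: l2_zero l2_add l2_scale l2_ip_def)


lemma l2_hilbert: "fun_hilbert_space l2 l2_ip"
  by unfold_locales

lemma rkhs_of_features: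
  fixes L :: "('i \<Rightarrow> complex) set" and X :: "'a set"
  assumes "fun_hilbert_space L ipL" and \<psi>: "\<And>x. x \<in> X \<Longrightarrow> \<psi> x \<in> L"
    and K: "\<And>z w. z \<in> X \<Longrightarrow> w \<in> X \<Longrightarrow> K z w = ipL (\<psi> w) (\<psi> z)"
  shows "\<exists>H ip. rkhs H ip X K"
proof -
  interpret L: fun_hilbert_space L ipL by fact
  define J where "J a = (\<lambda>x. if x \<in> X then ipL a (\<psi> x) else 0)" for a
  define P where "P = {a \<in> L. \<forall>b\<in>L. J b = 0 \<longrightarrow> ipL a b = 0}"
  define R where "R = the_inv_into P J"
  define ip where "ip f g = (if f \<in> J ` P \<and> g \<in> J ` P then ipL (R f) (R g) else 0)" for f g
  have PL: "a \<in> L" if "a \<in> P" for a using that by (simp add: P_def)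
  have J_add: "J (a + b) = J a + J b" if "a \<in> L" "b \<in> L" for a b
    using that \<psi> by (auto simp: J_def fun_eq_iff L.ip_add)
  have J_diff: "J (a - b) = J a - J b" if "a \<in> L" "b \<in> L" for a b
    using that \<psi> by (auto simp: J_def fun_eq_iff L.ip_diff)
  have J_scale: "J (\<lambda>x. c * a x) = (\<lambda>x. c * J a x)" if "a \<in> L" for a c
    using that \<psi> by (auto simp: J_def fun_eq_iff L.ip_scale)
  have P0: "0 \<in> P" by (simp add: P_def L.zero_mem)
  have P_add: "a + b \<in> P" if "a \<in> P" "b \<in> P" for a b
    using that by (simp add: P_def L.add_mem L.ip_add)
  have P_diff: "a - b \<in> P" if "a \<in> P" "b \<in> P" for a b
    using that by (simp add: P_def L.diff_mem L.ip_diff)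
  have P_scale: "(\<lambda>x. c * a x) \<in> P" if "a \<in> P" for a c
    using that by (simp add: P_def L.scale_mem L.ip_scale)
  have inj: "inj_on J P"
  proof (rule inj_onI)
    fix a b assume ab: "a \<in> P" "b \<in> P" "J a = J b"
    then have "J (a - b) = 0" by (simp add: J_diff PL)
    then have "ipL (a - b) (a - b) = 0" using P_diff[OF ab(1,2)] by (simp add: P_def)
    then show "a = b" using L.ip_pos[OF PL[OF P_diff[OF ab(1,2)]]] by (cases "a - b = 0") simp_all
  qed
  have ipJ: "ip (J a) (J b) = ipL a b" if "a \<in> P" "b \<in> P" for a b
    using that by (simp add: ip_def R_def the_inv_into_f_f[OF inj])
  have \<psi>P: "\<psi> x \<in> P" if "x \<in> X" for x
    unfolding P_def
  proof (intro CollectI conjI ballI impI)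
    show "\<psi> x \<in> L" using \<psi> that .
    fix b assume b: "b \<in> L" "J b = 0"
    then have "J b x = 0" by simp
    then have "ipL b (\<psi> x) = 0" using that by (simp add: J_def)
    then show "ipL (\<psi> x) b = 0" using L.ip_cnj[OF b(1) \<psi>[OF that]] by simp
  qed
  have J0: "J 0 = 0" by (auto simp: J_def)
  have ker: "kernel_fun X K w = J (\<psi> w)" if "w \<in> X" for w
    using that K by (auto simp: kernel_fun_def J_def)
  have "rkhs (J ` P) ip X K"
  proof
    show "0 \<in> J ` P" using P0 J0 by force
  next
    fix f g assume "f \<in> J ` P" "g \<in> J ` P"
    then obtain a b where "a \<in> P" "b \<in> P" "f = J a" "g = J b" by blast
    then have "a + b \<in> P" "f + g = J (a + b)" by (simp_all only: P_add J_add PL)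
    then show "f + g \<in> J ` P" by blast
  next
    fix f c assume "f \<in> J ` P"
    then obtain a where "a \<in> P" "f = J a" by blast
    then have "(\<lambda>x. c * a x) \<in> P" "(\<lambda>x. c * f x) = J (\<lambda>x. c * a x)"
      by (simp_all only: P_scale J_scale PL)
    then show "(\<lambda>x. c * f x) \<in> J ` P" by blast
  next
    fix f g h assume "f \<in> J ` P" "g \<in> J ` P" "h \<in> J ` P"
    then obtain a b c where abc: "a \<in> P" "b \<in> P" "c \<in> P" "f = J a" "g = J b" "h = J c" by blast
    have fg: "f + g = J (a + b)" using abc by (simp only: J_add PL)
    have "ip (f + g) h = ipL (a + b) c"
      unfolding fg \<open>h = J c\<close> using P_add[OF abc(1,2)] abc(3) by (rule ipJ)
    also have "\<dots> = ipL a c + ipL b c" using abc(1-3) by (intro L.ip_add PL)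
    finally show "ip (f + g) h = ip f h + ip g h" using abc by (simp only: ipJ)
  next
    fix f g c assume "f \<in> J ` P" "g \<in> J ` P"
    then obtain a b where abc: "a \<in> P" "b \<in> P" "f = J a" "g = J b" by blast
    have cf: "(\<lambda>x. c * f x) = J (\<lambda>x. c * a x)" using abc by (simp only: J_scale PL)
    have "ip (\<lambda>x. c * f x) g = ipL (\<lambda>x. c * a x) b"
      unfolding cf \<open>g = J b\<close> using P_scale[OF abc(1)] abc(2) by (rule ipJ)
    also have "\<dots> = c * ipL a b" using abc(1-2) by (intro L.ip_scale PL)
    finally show "ip (\<lambda>x. c * f x) g = c * ip f g" using abc by (simp only: ipJ)
  next
    fix f g assume "f \<in> J ` P" "g \<in> J ` P"
    then obtain a b where ab: "a \<in> P" "b \<in> P" "f = J a" "g = J b" by blast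
    then show "ip g f = cnj (ip f g)"
      using L.ip_cnj[OF PL PL, OF ab(1,2)] by (simp add: ipJ)
  next
    fix f :: "'a \<Rightarrow> complex" assume "f \<in> J ` P" "f \<noteq> 0"
    then obtain a where a: "a \<in> P" "f = J a" by blast
    have "a \<noteq> 0" using a J0 \<open>f \<noteq> 0\<close> by metis
    then show "0 < Re (ip f f)" unfolding a(2) ipJ[OF a(1) a(1)] using L.ip_pos PL a(1) by blast
  next
    fix f g assume "f \<notin> J ` P \<or> g \<notin> J ` P"
    then show "ip f g = 0" by (auto simp: ip_def)
  next
    fix F :: "nat \<Rightarrow> 'a \<Rightarrow> complex"
    assume F: "\<And>n. F n \<in> J ` P"
      and C: "\<And>e. 0 < e \<Longrightarrow> \<exists>N. \<forall>m\<ge>N. \<forall>n\<ge>N. hnorm ip (F m - F n) < e"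
    from F have "\<forall>n. \<exists>a. a \<in> P \<and> F n = J a" by blast
    then obtain A where A: "\<And>n. A n \<in> P" "\<And>n. F n = J (A n)" by metis
    have eq: "hnorm ip (J a - J b) = hnorm ipL (a - b)" if "a \<in> P" "b \<in> P" for a b
    proof -
      have "J a - J b = J (a - b)" using that by (simp only: J_diff PL)
      then show ?thesis using P_diff[OF that] by (simp only: hnorm_def ipJ)
    qed
    have "\<exists>a\<in>L. (\<lambda>n. hnorm ipL (A n - a)) \<longlonglongrightarrow> 0"
    proof (rule L.complete)
      show "A n \<in> L" for n using A(1) by (rule PL)
      show "\<exists>N. \<forall>m\<ge>N. \<forall>n\<ge>N. hnorm ipL (A m - A n) < e" if "0 < e" for e
        using C[OF that] unfolding A(2) eq[OF A(1) A(1)] .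
    qed
    then obtain a where a: "a \<in> L" "(\<lambda>n. hnorm ipL (A n - a)) \<longlonglongrightarrow> 0" by blast
    have "a \<in> P"
      unfolding P_def
    proof (intro CollectI conjI ballI impI a(1))
      fix b assume b: "b \<in> L" "J b = 0"
      have "(\<lambda>n. ipL (A n) b) \<longlonglongrightarrow> ipL a b"
        by (rule L.ip_tendsto[OF PL[OF A(1)] a b(1) b(1)]) (simp add: hnorm_def)
      moreover have "ipL (A n) b = 0" for n using A(1)[of n] b by (simp add: P_def)
      ultimately show "ipL a b = 0" by (simp add: LIMSEQ_const_iff)
    qed
    moreover have "(\<lambda>n. hnorm ip (F n - J a)) \<longlonglongrightarrow> 0"
      using a(2) unfolding A(2) eq[OF A(1) \<open>a \<in> P\<close>] .
    ultimately show "\<exists>f\<in>J ` P. (\<lambda>n. hnorm ip (F n - f)) \<longlonglongrightarrow> 0" by blast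
  next
    fix f x assume "f \<in> J ` P" "x \<notin> X"
    then show "f x = 0" by (auto simp: J_def)
  next
    fix w assume "w \<in> X"
    then show "kernel_fun X K w \<in> J ` P" using ker \<psi>P by simp
  next
    fix f w assume "f \<in> J ` P" "w \<in> X"
    then obtain a where a: "a \<in> P" "f = J a" by blast
    then have "ip f (kernel_fun X K w) = ipL a (\<psi> w)" using \<open>w \<in> X\<close> by (simp add: ker ipJ \<psi>P)
    also have "\<dots> = f w" using a \<open>w \<in> X\<close> by (simp add: J_def)
    finally show "f w = ip f (kernel_fun X K w)" ..
  qed
  then show ?thesis by blast
qed

text \<open>Uniqueness: the span of the kernel functions is dense in every rkhs.\<close>

inductive_set kernel_span :: "'a set \<Rightarrow> ('a \<Rightarrow> 'a \<Rightarrow> complex) \<Rightarrow> ('a \<Rightarrow> complex) set" for X K where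
  "(\<lambda>x. 0) \<in> kernel_span X K"
| "v \<in> kernel_span X K \<Longrightarrow> w \<in> X \<Longrightarrow> (\<lambda>x. c * kernel_fun X K w x + v x) \<in> kernel_span X K"

lemma kernel_span_zero: "0 \<in> kernel_span X K"
  using kernel_span.intros(1) by (simp add: zero_fun_def)

lemma kernel_span_step: "v \<in> kernel_span X K \<Longrightarrow> w \<in> X \<Longrightarrow>
    (\<lambda>x. c * kernel_fun X K w x) + v \<in> kernel_span X K"
  using kernel_span.intros(2) by (simp add: plus_fun_def)

lemma kernel_span_induct [consumes 1, case_names zero step]:
  assumes "u \<in> kernel_span X K" "P 0"
    and "\<And>v w c. v \<in> kernel_span X K \<Longrightarrow> P v \<Longrightarrow> w \<in> X \<Longrightarrow>
      P ((\<lambda>x. c * kernel_fun X K w x) + v)"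
  shows "P u"
  using assms(1)
proof (induction rule: kernel_span.induct)
  case 1
  then show ?case using assms(2) by (simp add: zero_fun_def)
next
  case (2 v w c)
  then show ?case using assms(3)[of v w c] by (simp add: plus_fun_def)
qed

context rkhs
begin

lemma span_mem: "v \<in> kernel_span X K \<Longrightarrow> v \<in> H"
proof (induction rule: kernel_span_induct)
  case zero
  show ?case by (rule zero_mem)
next
  case (step v w c)
  then show ?case by (intro add_mem scale_mem kernel_mem)
qed

lemma span_add: "u \<in> kernel_span X K \<Longrightarrow> v \<in> kernel_span X K \<Longrightarrow> u + v \<in> kernel_span X K"
proof (induction rule: kernel_span_induct)
  case zero
  then show ?case by (simp only: add_0)
next
  case (step u w c)
  have "(\<lambda>x. c * kernel_fun X K w x) + (u + v) \<in> kernel_span X K"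
    using step by (intro kernel_span_step)
  then show ?case by (simp only: add.assoc)
qed

lemma span_scale: "u \<in> kernel_span X K \<Longrightarrow> (\<lambda>x. c * u x) \<in> kernel_span X K"
proof (induction rule: kernel_span_induct)
  case (step v w d)
  have "(\<lambda>x. (c * d) * kernel_fun X K w x) + (\<lambda>x. c * v x) \<in> kernel_span X K"
    using step by (intro kernel_span_step)
  then show ?case by (simp add: plus_fun_def algebra_simps)
next
  case zero
  show ?case using kernel_span_zero by (simp add: zero_fun_def)
qed

lemma span_dense:
  assumes f: "f \<in> H"
  obtains v where "\<And>n. v n \<in> kernel_span X K" "(\<lambda>n. hnorm ip (v n - f)) \<longlonglongrightarrow> 0"
proof -
  define V where "V = kernel_span X K"
  define d where "d = (INF v\<in>V. (hnorm ip (f - v))\<^sup>2)"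
  have V0: "0 \<in> V" by (simp add: V_def kernel_span_zero)
  have VH: "v \<in> H" if "v \<in> V" for v using that span_mem by (simp add: V_def)
  have bdd: "bdd_below ((\<lambda>v. (hnorm ip (f - v))\<^sup>2) ` V)" by (rule bdd_belowI[of _ 0]) auto
  have d_le: "d \<le> (hnorm ip (f - v))\<^sup>2" if "v \<in> V" for v
    unfolding d_def using bdd that by (rule cINF_lower)
  have "\<exists>v\<in>V. (hnorm ip (f - v))\<^sup>2 < d + 1 / real (Suc n)" for n
  proof -
    have "(INF v\<in>V. (hnorm ip (f - v))\<^sup>2) < d + 1 / real (Suc n)" by (simp flip: d_def)
    then show ?thesis using cINF_less_iff[OF _ bdd] V0 by blast
  qed
  then obtain v where v: "\<And>n. v n \<in> V" "\<And>n. (hnorm ip (f - v n))\<^sup>2 < d + 1 / real (Suc n)"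
    by metis
  have par: "(hnorm ip (v m - v n))\<^sup>2 \<le> 2 / real (Suc m) + 2 / real (Suc n)" for m n
  proof -
    let ?a = "f - v m" and ?b = "f - v n"
    let ?h = "\<lambda>x. (1/2) * (v m + v n) x"
    have h: "?h \<in> V" using span_scale[OF span_add, of "v m" "v n" "1/2"] v(1) by (simp add: V_def)
    have mem: "?a \<in> H" "?b \<in> H" "f - ?h \<in> H" "v m \<in> H" "v n \<in> H"
      using f v VH h by (auto intro!: diff_mem)
    have "hnorm ip (\<lambda>x. 2 * (f - ?h) x) = 2 * hnorm ip (f - ?h)"
      using hnorm_scale[OF mem(3), of 2] by simp
    moreover have "(\<lambda>x. 2 * (f - ?h) x) = ?a - (- ?b)" by (auto simp: fun_eq_iff field_simps)
    ultimately have "4 * (hnorm ip (f - ?h))\<^sup>2 = (hnorm ip (?a - (- ?b)))\<^sup>2"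
      by (simp add: power_mult_distrib)
    moreover have "hnorm ip (- ?b) = hnorm ip ?b"
      using hnorm_scale[OF mem(2), of "-1"] by (simp add: fun_Compl_def)
    moreover have "ip ?a (- ?b) = - ip ?a ?b"
      using ip_scale_right[OF mem(1,2), of "-1"] by (simp add: fun_Compl_def)
    ultimately have 1: "4 * (hnorm ip (f - ?h))\<^sup>2
        = (hnorm ip ?a)\<^sup>2 + (hnorm ip ?b)\<^sup>2 + 2 * Re (ip ?a ?b)"
      using hnorm_sq_diff[OF mem(1) uminus_mem[OF mem(2)]] by simp
    have "v m - v n = ?b - ?a" by simp
    then have "(hnorm ip (v m - v n))\<^sup>2 = (hnorm ip ?a)\<^sup>2 + (hnorm ip ?b)\<^sup>2 - 2 * Re (ip ?a ?b)"
      using hnorm_sq_diff[OF mem(1,2)] hnorm_minus_commute[OF mem(1,2)] by simp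
    with 1 have "(hnorm ip (v m - v n))\<^sup>2
        = 2 * (hnorm ip ?a)\<^sup>2 + 2 * (hnorm ip ?b)\<^sup>2 - 4 * (hnorm ip (f - ?h))\<^sup>2" by simp
    also have "\<dots> \<le> 2 / real (Suc m) + 2 / real (Suc n)"
      using v(2)[of m] v(2)[of n] d_le[OF h] by simp
    finally show ?thesis .
  qed
  have "\<exists>N. \<forall>m\<ge>N. \<forall>n\<ge>N. hnorm ip (v m - v n) < e" if e: "0 < e" for e
  proof -
    obtain N where N: "4 / e\<^sup>2 < real N" using reals_Archimedean2 by blast
    have "hnorm ip (v m - v n) < e" if "m \<ge> N" "n \<ge> N" for m n
    proof (rule power2_less_imp_less)
      have N4: "4 / real (Suc N) < e\<^sup>2"
        using N e by (simp add: field_simps add_pos_pos less_trans[OF _ less_add_same_cancel2[THEN iffD2]])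
      have "2 / real (Suc m) \<le> 2 / real (Suc N)" "2 / real (Suc n) \<le> 2 / real (Suc N)"
        using that by (auto intro!: divide_left_mono)
      then show "(hnorm ip (v m - v n))\<^sup>2 < e\<^sup>2" using par[of m n] N4 by linarith
    qed (use e in simp)
    then show ?thesis by blast
  qed
  then obtain g where g: "g \<in> H" "(\<lambda>n. hnorm ip (v n - g)) \<longlonglongrightarrow> 0"
    using complete[of v, OF VH[OF v(1)]] by blast
  define h where "h = f - g"
  have hH: "h \<in> H" using f g by (simp add: h_def diff_mem)
  have lim: "(\<lambda>n. hnorm ip ((f - v n) - h)) \<longlonglongrightarrow> 0"
  proof -
    have "(f - v n) - h = g - v n" for n by (simp add: h_def)
    then show ?thesis
      using g(2) unfolding hnorm_minus_commute[OF g(1) VH[OF v(1)], symmetric] by (simp only:)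
  qed
  have "(\<lambda>n. Re (ip (f - v n) (f - v n))) \<longlonglongrightarrow> Re (ip h h)"
    by (intro tendsto_Re ip_tendsto lim) (use f v VH hH in \<open>auto intro!: diff_mem\<close>)
  then have lim2: "(\<lambda>n. (hnorm ip (f - v n))\<^sup>2) \<longlonglongrightarrow> (hnorm ip h)\<^sup>2"
    using f v VH hH by (simp add: hnorm_sq diff_mem)
  have hd: "(hnorm ip h)\<^sup>2 \<le> d"
  proof (rule LIMSEQ_le[OF lim2])
    show "(\<lambda>n. d + 1 / real (Suc n)) \<longlonglongrightarrow> d"
      using LIMSEQ_inverse_real_of_nat_add[of d] by (simp add: inverse_eq_divide)
    show "\<exists>N. \<forall>n\<ge>N. (hnorm ip (f - v n))\<^sup>2 \<le> d + 1 / real (Suc n)"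
      using v(2) by (meson less_imp_le)
  qed
  have "h x = 0" for x
  proof (cases "x \<in> X")
    case True
    define k where "k = kernel_fun X K x"
    define c where "c t = t * ip h k" for t :: complex
    have kH: "k \<in> H" and hk: "ip h k = h x"
      using True hH by (simp_all add: k_def kernel_mem reproducing[symmetric])
    define B where "B = (hnorm ip k)\<^sup>2"
    have "d \<le> (hnorm ip h)\<^sup>2 + (t * cmod (h x))\<^sup>2 * B - 2 * t * (cmod (h x))\<^sup>2" for t :: real
    proof -
      let ?s = "\<lambda>y. (of_real t * h x) * k y"
      have sV: "?s \<in> V"
        using span_scale[OF kernel_span_step[OF kernel_span_zero True, where c = 1 and K = K], of "of_real t * h x"]
        by (simp add: V_def k_def)
      have sH: "?s \<in> H" using VH[OF sV] .
      have "d \<le> (hnorm ip (f - (v n + ?s)))\<^sup>2" for n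
        using d_le span_add v(1)[of n] sV by (simp add: V_def)
      moreover have "f - (v n + ?s) = (f - v n) - ?s" for n by (simp add: algebra_simps)
      ultimately have dn: "d \<le> Re (ip ((f - v n) - ?s) ((f - v n) - ?s))" for n
        using f v VH sH by (simp add: hnorm_sq diff_mem)
      have "(\<lambda>n. Re (ip ((f - v n) - ?s) ((f - v n) - ?s))) \<longlonglongrightarrow> Re (ip (h - ?s) (h - ?s))"
      proof -
        have "((f - v n) - ?s) - (h - ?s) = (f - v n) - h" for n by (simp add: algebra_simps)
        then have l: "(\<lambda>n. hnorm ip (((f - v n) - ?s) - (h - ?s))) \<longlonglongrightarrow> 0"
          using lim by (simp only:)
        show ?thesis
          by (intro tendsto_Re ip_tendsto l) (use f v VH hH sH in \<open>auto intro!: diff_mem\<close>)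
      qed
      then have "d \<le> Re (ip (h - ?s) (h - ?s))"
        using dn by (intro LIMSEQ_le_const) auto
      also have "\<dots> = (hnorm ip (h - ?s))\<^sup>2" using hH sH by (simp add: hnorm_sq diff_mem)
      also have "\<dots> = (hnorm ip h)\<^sup>2 + (t * cmod (h x))\<^sup>2 * B - 2 * Re (cnj (of_real t * h x) * h x)"
        using hH kH sH by (simp add: hnorm_sq_diff hnorm_scale ip_scale_right hk B_def power_mult_distrib norm_mult)
      also have "Re (cnj (of_real t * h x) * h x) = t * (cmod (h x))\<^sup>2"
        by (simp add: cmod_power2) (simp add: algebra_simps power2_eq_square)
      finally show ?thesis by simp
    qed
    then have "0 \<le> (t * cmod (h x))\<^sup>2 * B - 2 * t * (cmod (h x))\<^sup>2" for t :: real
      using hd by (smt (verit))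
    from this[of "1 / (1 + B)"] have *: "0 \<le> (cmod (h x))\<^sup>2 * (B / (1 + B)\<^sup>2 - 2 / (1 + B))"
      by (simp add: power_divide algebra_simps power_mult_distrib)
    have "0 \<le> B" by (simp add: B_def)
    then have "B / (1 + B)\<^sup>2 - 2 / (1 + B) < 0"
      by (simp add: field_simps power2_eq_square add_pos_nonneg add_nonneg_pos)
    with * have "(cmod (h x))\<^sup>2 = 0"
      by (metis mult_pos_neg not_less order_le_less zero_le_power2)
    then show ?thesis by simp
  qed (use hH off in simp)
  then have "f = g" by (auto simp: h_def fun_eq_iff)
  show ?thesis
    by (rule that[of v]) (use g v in \<open>simp_all add: V_def \<open>f = g\<close>\<close>)
qed

lemma tendsto_pointwise:
  assumes "\<And>n. F n \<in> H" "f \<in> H" "(\<lambda>n. hnorm ip (F n - f)) \<longlonglongrightarrow> 0"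
  shows "(\<lambda>n. F n x) \<longlonglongrightarrow> f x"
proof (cases "x \<in> X")
  case True
  have "(\<lambda>n. ip (F n) (kernel_fun X K x)) \<longlonglongrightarrow> ip f (kernel_fun X K x)"
    by (rule ip_tendsto) (use assms kernel_mem True in \<open>auto simp: hnorm_def\<close>)
  then show ?thesis using assms True by (simp flip: reproducing)
next
  case False
  then show ?thesis using off[OF assms(1)] off[OF assms(2)] by simp
qed

end

lemma rkhs_unique_aux:
  assumes "rkhs H1 ip1 X K" "rkhs H2 ip2 X K"
  shows "H1 \<subseteq> H2" and "f \<in> H1 \<Longrightarrow> g \<in> H1 \<Longrightarrow> ip1 f g = ip2 f g"
proof -
  interpret A: rkhs H1 ip1 X K by fact
  interpret B: rkhs H2 ip2 X K by fact
  have eq: "ip1 u v = ip2 u v" if "u \<in> kernel_span X K" "v \<in> kernel_span X K" for u v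
    using that
  proof (induction arbitrary: v rule: kernel_span_induct)
    case (step u w c)
    have "ip1 (kernel_fun X K w) v = cnj (v w)" "ip2 (kernel_fun X K w) v = cnj (v w)"
      using A.ip_cnj[of v "kernel_fun X K w"] B.ip_cnj[of v "kernel_fun X K w"] step
        A.reproducing B.reproducing A.kernel_mem B.kernel_mem A.span_mem B.span_mem by simp_all
    moreover have "ip1 ((\<lambda>x. c * kernel_fun X K w x) + u) v = c * ip1 (kernel_fun X K w) v + ip1 u v"
      using step A.kernel_mem A.span_mem
      by (subst A.ip_add) (simp_all add: A.ip_scale A.scale_mem)
    moreover have "ip2 ((\<lambda>x. c * kernel_fun X K w x) + u) v = c * ip2 (kernel_fun X K w) v + ip2 u v"
      using step B.kernel_mem B.span_mem
      by (subst B.ip_add) (simp_all add: B.ip_scale B.scale_mem)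
    ultimately show ?case using step by (simp only:)
  qed simp
  have span_diff: "u - v \<in> kernel_span X K" if "u \<in> kernel_span X K" "v \<in> kernel_span X K" for u v
  proof -
    have "u - v = u + (\<lambda>x. (-1) * v x)" by (auto simp: fun_eq_iff)
    then show ?thesis using A.span_add A.span_scale that by metis
  qed
  have lim: "\<exists>v. (\<forall>n. v n \<in> kernel_span X K) \<and> (\<lambda>n. hnorm ip1 (v n - f)) \<longlonglongrightarrow> 0 \<and>
      f \<in> H2 \<and> (\<lambda>n. hnorm ip2 (v n - f)) \<longlonglongrightarrow> 0" if f: "f \<in> H1" for f
  proof -
    obtain v where v: "\<And>n. v n \<in> kernel_span X K" "(\<lambda>n. hnorm ip1 (v n - f)) \<longlonglongrightarrow> 0"
      using A.span_dense[OF f] by blast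
    have "\<exists>N. \<forall>m\<ge>N. \<forall>n\<ge>N. hnorm ip2 (v m - v n) < e" if e: "0 < e" for e
    proof -
      obtain N where N: "\<And>n. n \<ge> N \<Longrightarrow> hnorm ip1 (v n - f) < e / 2"
        using order_tendstoD(2)[OF v(2), of "e/2"] e by (auto simp: eventually_sequentially)
      have "hnorm ip2 (v m - v n) < e" if "m \<ge> N" "n \<ge> N" for m n
      proof -
        have "hnorm ip2 (v m - v n) = hnorm ip1 (v m - v n)"
          using eq[OF span_diff span_diff] v(1) by (simp add: hnorm_def)
        also have "\<dots> = hnorm ip1 ((v m - f) - (v n - f))" by simp
        also have "\<dots> \<le> hnorm ip1 (v m - f) + hnorm ip1 (v n - f)"
          by (intro A.hnorm_triangle A.diff_mem A.span_mem v f)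
        finally show ?thesis using N[OF that(1)] N[OF that(2)] by linarith
      qed
      then show ?thesis by blast
    qed
    then obtain g where g: "g \<in> H2" "(\<lambda>n. hnorm ip2 (v n - g)) \<longlonglongrightarrow> 0"
      using B.complete[of v, OF B.span_mem[OF v(1)]] by blast
    have "f x = g x" for x
      using A.tendsto_pointwise[OF A.span_mem[OF v(1)] f v(2)]
        B.tendsto_pointwise[OF B.span_mem[OF v(1)] g] by (rule LIMSEQ_unique)
    then have "f = g" by auto
    then show ?thesis using v g by blast
  qed
  then show "H1 \<subseteq> H2" by blast
  show "ip1 f g = ip2 f g" if fg: "f \<in> H1" "g \<in> H1"
  proof -
    obtain u v where u: "\<And>n. u n \<in> kernel_span X K" "(\<lambda>n. hnorm ip1 (u n - f)) \<longlonglongrightarrow> 0"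
        "f \<in> H2" "(\<lambda>n. hnorm ip2 (u n - f)) \<longlonglongrightarrow> 0"
      and v: "\<And>n. v n \<in> kernel_span X K" "(\<lambda>n. hnorm ip1 (v n - g)) \<longlonglongrightarrow> 0"
        "g \<in> H2" "(\<lambda>n. hnorm ip2 (v n - g)) \<longlonglongrightarrow> 0"
      using lim[OF fg(1)] lim[OF fg(2)] by blast
    have "(\<lambda>n. ip1 (u n) (v n)) \<longlonglongrightarrow> ip1 f g"
      by (intro A.ip_tendsto A.span_mem u v fg)
    moreover have "(\<lambda>n. ip2 (u n) (v n)) \<longlonglongrightarrow> ip2 f g"
      by (intro B.ip_tendsto B.span_mem u v)
    ultimately show ?thesis unfolding eq[OF u(1) v(1)] by (rule LIMSEQ_unique)
  qed
qed

lemma rkhs_unique: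
  assumes "rkhs H1 ip1 X K" "rkhs H2 ip2 X K"
  shows "H1 = H2" "ip1 = ip2"
proof -
  interpret A: rkhs H1 ip1 X K by fact
  interpret B: rkhs H2 ip2 X K by fact
  show H: "H1 = H2" using rkhs_unique_aux(1) assms by blast
  have "ip1 f g = ip2 f g" for f g
  proof (cases "f \<in> H1 \<and> g \<in> H1")
    case True
    then show ?thesis using rkhs_unique_aux(2)[OF assms] by blast
  next
    case False
    then show ?thesis using A.ip_outside[of f g] B.ip_outside[of f g] H by simp
  qed
  then show "ip1 = ip2" by blast
qed

text \<open>Words in the coordinates: \<open>K z w = \<Sum>l. z\<^sup>l * cnj (w\<^sup>l)\<close>, summed over all lists of indices.\<close>

lemma sum_words:
  fixes x :: "'d::finite \<Rightarrow> 'b::comm_ring_1"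
  shows "(\<Sum>l | length l \<le> N. prod_list (map x l)) = (\<Sum>n\<le>N. (\<Sum>i\<in>UNIV. x i) ^ n)"
proof -
  have fin: "finite {l::'d list. length l = n}" for n
    using finite_lists_length_eq[of "UNIV :: 'd set" n] by simp
  have len: "(\<Sum>l | length l = n. prod_list (map x l)) = (\<Sum>i\<in>UNIV. x i) ^ n" for n
  proof (induction n)
    case (Suc n)
    have "{l::'d list. length l = Suc n} = (\<lambda>(i, l). i # l) ` (UNIV \<times> {l. length l = n})"
      by (auto simp: length_Suc_conv image_iff)
    moreover have "inj_on (\<lambda>(i, l). i # l) (UNIV \<times> {l::'d list. length l = n})"
      by (auto intro: inj_onI)
    ultimately have "(\<Sum>l | length l = Suc n. prod_list (map x l))
        = (\<Sum>(i, l)\<in>UNIV \<times> {l. length l = n}. x i * prod_list (map x l))"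
      by (simp add: sum.reindex case_prod_unfold)
    also have "\<dots> = (\<Sum>i\<in>UNIV. x i) * (\<Sum>l | length l = n. prod_list (map x l))"
      by (simp add: sum_product sum.cartesian_product)
    finally show ?case using Suc by simp
  qed simp
  have "{l::'d list. length l \<le> N} = (\<Union>n\<in>{..N}. {l. length l = n})" by auto
  then have "(\<Sum>l | length l \<le> N. prod_list (map x l))
      = (\<Sum>n\<le>N. \<Sum>l | length l = n. prod_list (map x l))"
    using fin by (simp only:) (subst sum.UNION_disjoint, auto)
  then show ?thesis by (simp add: len)
qed

lemma has_sum_words:
  fixes x :: "'d::finite \<Rightarrow> complex"
  assumes x: "(\<Sum>i\<in>UNIV. cmod (x i)) < 1"
  shows "((\<lambda>l. prod_list (map x l)) has_sum (1 / (1 - (\<Sum>i\<in>UNIV. x i)))) UNIV"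
    and "(\<lambda>l. cmod (prod_list (map x l))) summable_on UNIV"
proof -
  define s where "s = (\<Sum>i\<in>UNIV. cmod (x i))"
  have s: "0 \<le> s" "s < 1" using x by (auto simp: s_def sum_nonneg)
  have fin: "finite {l::'d list. length l \<le> N}" for N
    using finite_lists_length_le[of "UNIV :: 'd set" N] by simp
  have cm: "cmod (prod_list (map x l)) = prod_list (map (\<lambda>i. cmod (x i)) l)" for l
    by (induction l) (auto simp: norm_mult)
  show abs: "(\<lambda>l. cmod (prod_list (map x l))) summable_on UNIV"
  proof (rule nonneg_bounded_partial_sums_imp_summable_on[where C = "1 / (1 - s)"])
    show "\<forall>\<^sub>F S in finite_subsets_at_top UNIV. (\<Sum>l\<in>S. cmod (prod_list (map x l))) \<le> 1 / (1 - s)"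
    proof (rule eventually_finite_subsets_at_top_weakI)
      fix S :: "'d list set" assume S: "finite S"
      define N where "N = Max (insert 0 (length ` S))"
      have "S \<subseteq> {l. length l \<le> N}" using S by (auto simp: N_def)
      then have "(\<Sum>l\<in>S. cmod (prod_list (map x l))) \<le> (\<Sum>l | length l \<le> N. cmod (prod_list (map x l)))"
        by (intro sum_mono2 fin) auto
      also have "\<dots> = (\<Sum>n\<le>N. s ^ n)" unfolding cm sum_words s_def ..
      also have "\<dots> \<le> (\<Sum>n. s ^ n)" by (intro sum_le_suminf summable_geometric) (use s in auto)
      also have "\<dots> = 1 / (1 - s)" using s by (simp add: suminf_geometric)
      finally show "(\<Sum>l\<in>S. cmod (prod_list (map x l))) \<le> 1 / (1 - s)" .
    qed
  qed auto
  then have "(\<lambda>l. prod_list (map x l)) summable_on UNIV" by (rule abs_summable_summable)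
  then obtain T where T: "((\<lambda>l. prod_list (map x l)) has_sum T) UNIV" by (auto simp: summable_on_def)
  have "filterlim (\<lambda>N. {l::'d list. length l \<le> N}) (finite_subsets_at_top UNIV) sequentially"
    unfolding filterlim_finite_subsets_at_top
  proof (intro allI impI)
    fix S :: "'d list set" assume S: "finite S \<and> S \<subseteq> UNIV"
    define M where "M = Max (insert 0 (length ` S))"
    have M: "S \<subseteq> {l. length l \<le> M}" using S by (auto simp: M_def)
    show "\<forall>\<^sub>F N in sequentially. finite {l::'d list. length l \<le> N} \<and> S \<subseteq> {l. length l \<le> N} \<and>
        {l::'d list. length l \<le> N} \<subseteq> UNIV"
      using eventually_ge_at_top[of M] by eventually_elim (use M fin in force)
  qed
  then have 1: "(\<lambda>N. \<Sum>l | length l \<le> N. prod_list (map x l)) \<longlonglongrightarrow> T"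
    using T unfolding has_sum_def by (rule filterlim_compose[rotated])
  have "cmod (\<Sum>i\<in>UNIV. x i) \<le> s" unfolding s_def by (rule norm_sum)
  then have "(\<lambda>n. (\<Sum>i\<in>UNIV. x i) ^ n) sums (1 / (1 - (\<Sum>i\<in>UNIV. x i)))"
    using s by (intro geometric_sums) auto
  then have 2: "(\<lambda>N. \<Sum>l | length l \<le> N. prod_list (map x l)) \<longlonglongrightarrow> 1 / (1 - (\<Sum>i\<in>UNIV. x i))"
    unfolding sum_words sums_def_le .
  show "((\<lambda>l. prod_list (map x l)) has_sum (1 / (1 - (\<Sum>i\<in>UNIV. x i)))) UNIV"
    using T LIMSEQ_unique[OF 1 2] by simp
qed

lemma da_rkhs_ex: "\<exists>H ip. rkhs H ip (ball (0 :: complex ^ 'd::finite) 1) da_kernel"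
proof -
  let ?\<psi> = "\<lambda>z :: complex ^ 'd. \<lambda>l. cnj (prod_list (map (\<lambda>i. z $ i) l))"
  have m: "?\<psi> z \<in> l2" if "z \<in> ball 0 1" for z
  proof -
    from that
    have "(norm z)\<^sup>2 < 1" by (simp add: abs_square_less_1)
    then have z: "(\<Sum>i\<in>UNIV. (cmod (z $ i))\<^sup>2) < 1"
      by (simp add: norm_vec_def L2_set_def sum_nonneg)
    have "(\<Sum>i\<in>UNIV. cmod (z $ i * z $ i)) < 1" using z by (simp add: norm_mult power2_eq_square)
    from has_sum_words(2)[OF this]
    have "(\<lambda>l. cmod (prod_list (map (\<lambda>i. z $ i * z $ i) l))) summable_on UNIV" .
    moreover have "prod_list (map (\<lambda>i. z $ i * z $ i) l) = (prod_list (map (\<lambda>i. z $ i) l))\<^sup>2" for l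
      by (induction l) (auto simp: power2_eq_square)
    ultimately show ?thesis by (simp add: l2_def norm_power)
  qed
  have "da_kernel z w = l2_ip (?\<psi> w) (?\<psi> z)"
    if zw: "z \<in> ball 0 1" "w \<in> ball 0 1" for z w :: "complex ^ 'd"
  proof -
    have "(\<Sum>i\<in>UNIV. cmod (z $ i * cnj (w $ i))) \<le> norm z * norm w"
      using L2_set_mult_ineq[of "\<lambda>i. cmod (z $ i)" "\<lambda>i. cmod (w $ i)" UNIV]
      by (simp add: norm_mult norm_vec_def)
    also have "\<dots> < 1" using zw mult_strict_mono[of "norm z" 1 "norm w" 1] by simp
    finally have s: "(\<Sum>i\<in>UNIV. cmod (z $ i * cnj (w $ i))) < 1" .
    have p: "prod_list (map (\<lambda>i. z $ i * cnj (w $ i)) l) = ?\<psi> w l * cnj (?\<psi> z l)" for l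
      by (induction l) auto
    show ?thesis
      using infsumI[OF has_sum_words(1)[OF s, unfolded p]] m[OF zw(1)] m[OF zw(2)]
      by (simp add: l2_ip_def da_kernel_def)
  qed
  with m show ?thesis by (intro rkhs_of_features[OF l2_hilbert, where \<psi> = ?\<psi>]) simp_all
qed

lemma drury_arveson_rkhs:
  "rkhs (DA_space :: (complex ^ 'd::finite \<Rightarrow> complex) set) DA_ip (ball 0 1) da_kernel"
proof -
  obtain H ip where H: "rkhs H ip (ball (0 :: complex ^ 'd) 1) da_kernel" using da_rkhs_ex by blast
  have "drury_arveson = (H, ip)"
    unfolding drury_arveson_def
    by (rule the_equality) (use H in \<open>auto dest: rkhs_unique[OF _ H]\<close>)
  then have "DA_space = H" "DA_ip = ip" unfolding DA_space_def DA_ip_def by (metis fst_conv, metis snd_conv)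
  with H show ?thesis by simp
qed

end

theory Submission
  imports Defs "HOL-Complex_Analysis.Conformal_Mappings"
begin

text \<open>Two facts are combined. First, a probability measure \<open>\<mu>\<close> on the sphere of finite energy
  \<open>\<integral>\<integral> 1 / \<bar>1 - \<langle>z, w\<rangle>\<bar> d\<mu> d\<mu>\<close> is Henkin, because its potential \<open>g(z) = \<integral> K(z, w) d\<mu>(w)\<close> then lies in
  the Drury--Arveson space and \<open>\<integral> f d\<mu> = \<langle>f, g\<rangle> = \<langle>M\<^sub>f 1, g\<rangle>\<close>. Secondly, the holomorphic map
  \<open>h(z) = 2 z\<^sub>i z\<^sub>j\<close> sends the closed ball to the closed disc, so the preimage under \<open>h\<close> of a compact
  Lebesgue null set \<open>E\<close> in the circle is totally null.

  On the torus \<open>\<bar>z\<^sub>i\<bar> = \<bar>z\<^sub>j\<bar> = 1 / sqrt 2\<close> the energy of a measure that is uniform along the fibres of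
  \<open>h\<close> is finite once its image on the circle has dimension above \<open>1/2\<close>. We take the image of
  Lebesgue measure under the map that reads base \<open>64\<close> digits in base \<open>512\<close>: its dimension is
  \<open>2/3\<close>, and \<open>Re w^(512^k) \<ge> 1/2\<close> on its support for every \<open>k\<close>. The latter makes the positive harmonic
  polynomial with boundary values \<open>\<bar>\<Sum>k<N. w^(512^k)\<bar>\<^sup>2 / N\<close>, which has mean \<open>1\<close>, large on the
  support.\<close>

section \<open>Riesz representation\<close>

context fun_hilbert_space
begin

lemma hnorm_sq_add:
  assumes "f \<in> H" "g \<in> H"
  shows "(hnorm ip (f + g))\<^sup>2 = (hnorm ip f)\<^sup>2 + (hnorm ip g)\<^sup>2 + 2 * Re (ip f g)"
proof -
  have "ip g f = cnj (ip f g)" using assms by (rule ip_cnj)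
  then show ?thesis
    using assms by (simp add: hnorm_sq add_mem ip_add ip_add_right)
qed

lemma parallelogram:
  assumes "f \<in> H" "g \<in> H"
  shows "(hnorm ip (f + g))\<^sup>2 + (hnorm ip (f - g))\<^sup>2 = 2 * (hnorm ip f)\<^sup>2 + 2 * (hnorm ip g)\<^sup>2"
  using assms by (simp add: hnorm_sq_add hnorm_sq_diff)

text \<open>The representing vector minimises the functional \<open>\<parallel>f\<parallel>\<^sup>2 - 2 Re (L f)\<close>.\<close>

lemma riesz_representation:
  assumes add: "\<And>f g. f \<in> H \<Longrightarrow> g \<in> H \<Longrightarrow> L (f + g) = L f + L g"
    and scale: "\<And>c f. f \<in> H \<Longrightarrow> L (\<lambda>x. c * f x) = c * L f"
    and bound: "\<And>f. f \<in> H \<Longrightarrow> cmod (L f) \<le> C * hnorm ip f"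
  obtains g where "g \<in> H" "\<And>f. f \<in> H \<Longrightarrow> L f = ip f g"
proof -
  define J where "J f = (hnorm ip f)\<^sup>2 - 2 * Re (L f)" for f
  define d where "d = (INF f\<in>H. J f)"
  have L_diff: "L (f - g) = L f - L g" if "f \<in> H" "g \<in> H" for f g
    using add[OF diff_mem[OF that] that(2)] by simp
  have ReL: "\<bar>Re (L f)\<bar> \<le> C * hnorm ip f" if "f \<in> H" for f
    using bound[OF that] abs_Re_le_cmod[of "L f"] by linarith
  \<comment> \<open>With n the norm of f, \<open>J f\<close> is at least n^2 - 2 C n = (n - C)^2 -
    C^2.\<close>
  have "- C\<^sup>2 \<le> J f" if "f \<in> H" for f
    using ReL[OF that] zero_le_power2[of "hnorm ip f - C"] by (simp add: J_def power2_diff algebra_simps)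
  then have bdd: "bdd_below (J ` H)" by (auto intro!: bdd_belowI2)
  have d_le: "d \<le> J f" if "f \<in> H" for f
    unfolding d_def using bdd that by (rule cINF_lower)
  have "\<exists>v\<in>H. J v < d + 1 / real (Suc n)" for n
  proof -
    have "(INF f\<in>H. J f) < d + 1 / real (Suc n)" by (simp flip: d_def)
    then show ?thesis using cINF_less_iff[OF _ bdd] zero_mem by blast
  qed
  then obtain v where v: "\<And>n. v n \<in> H" "\<And>n. J (v n) < d + 1 / real (Suc n)"
    by metis
  \<comment> \<open>Since \<open>L\<close> is additive, the linear terms cancel in the parallelogram
    law, which turns into an identity for \<open>J\<close> at two points and their midpoint. As
    \<open>J\<close> is at least \<open>d\<close> at the midpoint, minimising sequences are
    Cauchy.\<close>
  have par: "(hnorm ip (v m - v n))\<^sup>2 \<le> 2 / real (Suc m) + 2 / real (Suc n)" for m n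
  proof -
    define w where "w = v m + v n"
    let ?h = "\<lambda>x. (1/2) * w x"
    have mem: "w \<in> H" "?h \<in> H"
      unfolding w_def by (intro add_mem scale_mem v)+
    have "4 * (hnorm ip ?h)\<^sup>2 = (hnorm ip w)\<^sup>2" "L w = 2 * L ?h"
      unfolding hnorm_scale[OF mem(1)] scale[OF mem(1)] by (simp_all add: power_mult_distrib power_divide)
    then have "4 * J ?h = (hnorm ip (v m + v n))\<^sup>2 - 4 * Re (L (v m) + L (v n))"
      unfolding J_def add[OF v(1) v(1), symmetric] w_def[symmetric] by simp
    then have "(hnorm ip (v m - v n))\<^sup>2 = 2 * J (v m) + 2 * J (v n) - 4 * J ?h"
      using parallelogram[OF v(1) v(1), of m n] by (simp add: J_def)
    also have "\<dots> \<le> 2 / real (Suc m) + 2 / real (Suc n)"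
      using v(2)[of m] v(2)[of n] d_le[OF mem(2)] by simp
    finally show ?thesis .
  qed
  have "\<exists>N. \<forall>m\<ge>N. \<forall>n\<ge>N. hnorm ip (v m - v n) < e" if e: "0 < e" for e
  proof -
    obtain N where N: "4 / e\<^sup>2 < real N" using reals_Archimedean2 by blast
    have "hnorm ip (v m - v n) < e" if "m \<ge> N" "n \<ge> N" for m n
    proof (rule power2_less_imp_less)
      have N4: "4 / real (Suc N) < e\<^sup>2"
        using N e by (simp add: field_simps add_pos_pos less_trans[OF _ less_add_same_cancel2[THEN iffD2]])
      have "2 / real (Suc m) \<le> 2 / real (Suc N)" "2 / real (Suc n) \<le> 2 / real (Suc N)"
        using that by (auto intro!: divide_left_mono)
      then show "(hnorm ip (v m - v n))\<^sup>2 < e\<^sup>2" using par[of m n] N4 by linarith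
    qed (use e in simp)
    then show ?thesis by blast
  qed
  then obtain g where g: "g \<in> H" "(\<lambda>n. hnorm ip (v n - g)) \<longlonglongrightarrow> 0"
    using complete[of v, OF v(1)] by blast
  have J_g: "J g \<le> J h" if h: "h \<in> H" for h
  proof -
    have "(\<lambda>n. L (v n - g)) \<longlonglongrightarrow> 0"
    proof (rule Lim_null_comparison)
      show "\<forall>\<^sub>F n in sequentially. norm (L (v n - g)) \<le> C * hnorm ip (v n - g)"
        using bound v g by (simp add: diff_mem)
      show "(\<lambda>n. C * hnorm ip (v n - g)) \<longlonglongrightarrow> 0"
        using tendsto_mult_right_zero[OF g(2)] .
    qed
    then have "(\<lambda>n. L (v n)) \<longlonglongrightarrow> L g" using v g by (simp add: L_diff LIM_zero_iff)
    moreover have "(\<lambda>n. ip (v n) (v n)) \<longlonglongrightarrow> ip g g"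
      by (intro ip_tendsto v g)
    ultimately have "(\<lambda>n. Re (ip (v n) (v n)) - 2 * Re (L (v n))) \<longlonglongrightarrow> Re (ip g g) - 2 * Re (L g)"
      by (intro tendsto_intros)
    then have "(\<lambda>n. J (v n)) \<longlonglongrightarrow> J g" using v g by (simp add: J_def hnorm_sq)
    moreover have "(\<lambda>n. d + 1 / real (Suc n)) \<longlonglongrightarrow> d"
      using LIMSEQ_inverse_real_of_nat_add[of d] by (simp add: inverse_eq_divide)
    ultimately have "J g \<le> d"
      by (rule LIMSEQ_le) (use v(2) in \<open>meson less_imp_le\<close>)
    then show ?thesis using d_le[OF h] by simp
  qed
  have "L f = ip f g" if f: "f \<in> H" for f
  proof -
    define D where "D = ip f g - L f"
    \<comment> \<open>First variation at the minimiser: moving g by -s cnj(D) f changes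
      \<open>J\<close> by s^2 |D|^2 |f|^2 - 2 s |D|^2. For s = 1 / (1 + B) this is negative unless D
      = 0; the 1 in the denominator covers B = 0.\<close>
    have *: "0 \<le> s * (s * ((cmod D)\<^sup>2 * (hnorm ip f)\<^sup>2) - 2 * (cmod D)\<^sup>2)" for s :: real
    proof -
      let ?f = "\<lambda>x. (- of_real s * cnj D) * f x"
      have fH: "?f \<in> H" using f by (rule scale_mem)
      have "0 \<le> J (?f + g) - J g" using J_g[OF add_mem[OF fH g(1)]] by simp
      also have "\<dots> = (hnorm ip ?f)\<^sup>2 + 2 * Re (ip ?f g - L ?f)"
        using fH g(1) by (simp add: J_def hnorm_sq_add add)
      also have "ip ?f g - L ?f = - of_real s * (cnj D * D)"
        using f g(1) by (subst ip_scale, simp, simp, subst scale, simp) (simp add: D_def algebra_simps)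
      also have "cnj D * D = of_real ((cmod D)\<^sup>2)"
        by (simp add: complex_norm_square mult.commute del: of_real_power)
      also have "hnorm ip ?f = \<bar>s\<bar> * cmod D * hnorm ip f"
        by (subst hnorm_scale[OF f]) (simp add: norm_mult)
      finally show ?thesis by (simp add: power_mult_distrib algebra_simps power2_eq_square)
    qed
    define B where "B = (hnorm ip f)\<^sup>2"
    have B: "0 \<le> B" by (simp add: B_def)
    have "0 \<le> (1 / (1 + B)) * ((cmod D)\<^sup>2 * B) - 2 * (cmod D)\<^sup>2"
      using *[of "1 / (1 + B)"] B zero_le_mult_iff[of "1 / (1 + B)"] by (simp add: B_def[symmetric])
    then have "0 \<le> (cmod D)\<^sup>2 * (B / (1 + B) - 2)"
      by (simp add: algebra_simps)
    moreover have "B / (1 + B) - 2 < 0" using B by (simp add: field_simps)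
    ultimately have "(cmod D)\<^sup>2 = 0"
      by (metis mult_pos_neg not_less order_le_less zero_le_power2)
    then show ?thesis by (simp add: D_def)
  qed
  with g(1) show ?thesis by (rule that)
qed

end

section \<open>Multipliers of the Drury--Arveson space\<close>

interpretation DA: rkhs "DA_space :: (complex ^ 'd::finite \<Rightarrow> complex) set" DA_ip "ball 0 1" da_kernel
  by (rule drury_arveson_rkhs)

section \<open>Estimates for the kernel and for point evaluations\<close>

abbreviation herm :: "complex ^ 'd::finite \<Rightarrow> complex ^ 'd \<Rightarrow> complex"
  where "herm z w \<equiv> \<Sum>i\<in>UNIV. z $ i * cnj (w $ i)"

lemma norm_herm_le: "cmod (herm z w) \<le> norm z * norm w"
proof -
  have "cmod (herm z w) \<le> (\<Sum>i\<in>UNIV. cmod (z $ i * cnj (w $ i)))" by (rule norm_sum)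
  also have "\<dots> \<le> norm z * norm w"
    using L2_set_mult_ineq[of "\<lambda>i. cmod (z $ i)" "\<lambda>i. cmod (w $ i)" UNIV]
    by (simp add: norm_mult norm_vec_def)
  finally show ?thesis .
qed

lemma herm_scaleR: "herm (r *\<^sub>R z) (s *\<^sub>R w) = of_real (r * s) * herm z w"
  unfolding vector_scaleR_component by (simp add: sum_distrib_left scaleR_conv_of_real mult_ac)

lemma herm_neq_1: "norm z * norm w < 1 \<Longrightarrow> herm z w \<noteq> 1"
  using norm_herm_le[of z w] by auto

text \<open>Write 1 - u = (1 - t u) - (1 - t) u and use (1 - t) |u| \<le> 1 - t |u| \<le> |1 - t u|.
  Hence the kernels with argument scaled by t are dominated by twice the unscaled one, uniformly in
  t.\<close>

lemma norm_one_minus_le: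
  assumes "cmod u \<le> 1" "0 \<le> t" "t \<le> 1"
  shows "cmod (1 - u) \<le> 2 * cmod (1 - of_real t * u)"
proof -
  have "cmod (1 - u) = cmod ((1 - of_real t * u) - of_real (1 - t) * u)"
    by (simp add: algebra_simps)
  also have "\<dots> \<le> cmod (1 - of_real t * u) + cmod (of_real (1 - t) * u)" by (rule norm_triangle_ineq4)
  also have "cmod (of_real (1 - t) * u) \<le> 1 - t * cmod u"
    using assms unfolding norm_mult norm_of_real by (simp add: algebra_simps)
  also have "1 - t * cmod u \<le> cmod (1 - of_real t * u)"
    using norm_triangle_ineq2[of 1 "of_real t * u"] assms by (simp add: norm_mult)
  finally show ?thesis by simp
qed

lemma da_kernel_self: "Re (da_kernel z z) = 1 / (1 - (norm z)\<^sup>2)"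
proof -
  have "herm z z = of_real ((norm z)\<^sup>2)"
    by (simp add: norm_vec_def L2_set_def sum_nonneg complex_norm_square del: of_real_power)
  then have "da_kernel z z = of_real (1 / (1 - (norm z)\<^sup>2))"
    unfolding da_kernel_def by (simp only: of_real_1 of_real_diff of_real_divide)
  then show ?thesis by (simp only: Re_complex_of_real)
qed

lemma ball_mult_norm: "z \<in> ball 0 1 \<Longrightarrow> w \<in> ball 0 1 \<Longrightarrow> norm z * norm w < 1"
  using mult_strict_mono[of "norm z" 1 "norm w" 1] by simp

abbreviation da_kfun :: "complex ^ 'd::finite \<Rightarrow> complex ^ 'd \<Rightarrow> complex"
  where "da_kfun \<equiv> kernel_fun (ball 0 1) da_kernel"

lemma DA_ip_kernel:
  "z \<in> ball 0 1 \<Longrightarrow> w \<in> ball 0 1 \<Longrightarrow> DA_ip (da_kfun w) (da_kfun z) = da_kernel z w"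
  using DA.reproducing[OF DA.kernel_mem, of w z] by (simp add: kernel_fun_def)

lemma hnorm_da_kfun:
  assumes "w \<in> ball 0 1"
  shows "(hnorm DA_ip (da_kfun w))\<^sup>2 = 1 / (1 - (norm w)\<^sup>2)"
  using assms by (simp only: DA.hnorm_sq DA.kernel_mem DA_ip_kernel da_kernel_self)

text \<open>Cauchy-Schwarz against the kernel function, whose norm increases with the norm of z. The
  uniform constant on a smaller ball is what bounds integration over a dilated sphere.\<close>

lemma DA_norm_le:
  assumes "f \<in> DA_space" "norm z \<le> r" "r < 1"
  shows "cmod (f z) \<le> sqrt (1 / (1 - r\<^sup>2)) * hnorm DA_ip f"
proof -
  have z: "z \<in> ball 0 1" and r: "0 \<le> r" using assms norm_ge_zero[of z] by (simp, linarith)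
  have r2: "(norm z)\<^sup>2 \<le> r\<^sup>2" "r\<^sup>2 < 1" using assms r by (auto intro: power_mono simp: power_less_one_iff)
  have "hnorm DA_ip (da_kfun z) = sqrt (1 / (1 - (norm z)\<^sup>2))"
    using hnorm_da_kfun[OF z] DA.hnorm_nonneg[OF DA.kernel_mem[OF z]] by (metis real_sqrt_unique)
  also have "\<dots> \<le> sqrt (1 / (1 - r\<^sup>2))" using r2 by (simp add: frac_le)
  finally have "hnorm DA_ip f * hnorm DA_ip (da_kfun z) \<le> hnorm DA_ip f * sqrt (1 / (1 - r\<^sup>2))"
    using DA.hnorm_nonneg[OF assms(1)] by (rule mult_left_mono)
  then show ?thesis
    using DA.Cauchy_Schwarz[OF assms(1) DA.kernel_mem[OF z]] DA.reproducing[OF assms(1) z]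
    by (simp add: mult.commute)
qed

text \<open>The kernel functions depend norm-continuously on their point, because the squared
  distance between two of them is a combination of kernel values; pairing with f preserves
  this.\<close>

lemma DA_continuous_on:
  assumes f: "f \<in> (DA_space :: (complex ^ 'd::finite \<Rightarrow> complex) set)"
  shows "continuous_on (ball 0 1) f"
  unfolding continuous_on_sequentially
proof (intro ballI allI impI, elim conjE)
  fix x :: "nat \<Rightarrow> complex ^ 'd" and a
  assume a: "a \<in> ball 0 1" and x: "\<forall>n. x n \<in> ball 0 1" and lim: "x \<longlonglongrightarrow> a"
  have k: "da_kfun z \<in> DA_space" if "z \<in> ball 0 1" for z :: "complex ^ 'd" using that by (rule DA.kernel_mem)
  have "herm a a \<noteq> 1" using ball_mult_norm[OF a a] by (rule herm_neq_1)
  then have K: "(\<lambda>n. da_kernel (u n) (v n)) \<longlonglongrightarrow> da_kernel a a" if "u \<longlonglongrightarrow> a" "v \<longlonglongrightarrow> a" for u v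
    unfolding da_kernel_def using that by (auto intro!: tendsto_intros)
  have "(\<lambda>n. Re (da_kernel (x n) (x n)) + Re (da_kernel a a) - 2 * Re (da_kernel a (x n)))
      \<longlonglongrightarrow> Re (da_kernel a a) + Re (da_kernel a a) - 2 * Re (da_kernel a a)"
    by (intro tendsto_intros K lim)
  moreover have "(hnorm DA_ip (da_kfun (x n) - da_kfun a))\<^sup>2
      = Re (da_kernel (x n) (x n)) + Re (da_kernel a a) - 2 * Re (da_kernel a (x n))" for n
    using x a by (simp only: DA.hnorm_sq_diff k DA.hnorm_sq DA_ip_kernel)
  ultimately have "(\<lambda>n. (hnorm DA_ip (da_kfun (x n) - da_kfun a))\<^sup>2) \<longlonglongrightarrow> 0" by simp
  from tendsto_real_sqrt[OF this]
  have "(\<lambda>n. hnorm DA_ip (da_kfun (x n) - da_kfun a)) \<longlonglongrightarrow> 0"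
    using x a by (simp add: DA.hnorm_nonneg DA.diff_mem k)
  from DA.ip_tendsto[OF _ _ _ _ _ this, of "\<lambda>_. f" f]
  have "(\<lambda>n. DA_ip f (da_kfun (x n))) \<longlonglongrightarrow> DA_ip f (da_kfun a)"
    using f x a k by (simp add: hnorm_def)
  then show "(f \<circ> x) \<longlonglongrightarrow> f a"
    using x a f by (simp add: DA.reproducing[symmetric] comp_def)
qed

section \<open>Polynomials, the unit vector and multiplier norms\<close>

lemma polynomial_continuous:
  assumes "p \<in> ball_polynomials"
  obtains P where "continuous_on UNIV P" "\<And>z. z \<in> ball 0 1 \<Longrightarrow> p z = P z"
proof -
  from assms obtain A c where "p = (\<lambda>z. if z \<in> ball 0 1 then \<Sum>\<alpha>\<in>A. c \<alpha> * (\<Prod>i\<in>UNIV. (z $ i) ^ \<alpha> i) else 0)"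
    unfolding ball_polynomials_def by blast
  then show ?thesis
    by (intro that[of "\<lambda>z. \<Sum>\<alpha>\<in>A. c \<alpha> * (\<Prod>i\<in>UNIV. (z $ i) ^ \<alpha> i)"]) (auto intro!: continuous_intros)
qed

text \<open>The kernel function at the origin plays the role of the constant 1: a multiplier is
  recovered by applying its multiplication operator to this unit vector.\<close>

lemma one_DA: "da_kfun 0 \<in> DA_space" "hnorm DA_ip (da_kfun (0::complex ^ 'd::finite)) = 1"
  "da_kfun (0::complex ^ 'd) = indicator (ball 0 1)"
proof -
  show "da_kfun 0 \<in> DA_space" by (rule DA.kernel_mem) simp
  show "hnorm DA_ip (da_kfun (0::complex ^ 'd::finite)) = 1"
    using DA_ip_kernel[of "0::complex ^ 'd" 0] by (simp add: hnorm_def da_kernel_def)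
  show "da_kfun (0::complex ^ 'd) = indicator (ball 0 1)"
    by (auto simp: kernel_fun_def da_kernel_def fun_eq_iff indicator_def)
qed

lemma multiplier_times_one:
  "\<phi> \<in> DA_multipliers \<Longrightarrow> \<phi> * da_kfun 0 = \<phi>"
  by (auto simp: DA_multipliers_def multipliers_def one_DA(3) fun_eq_iff indicator_def)

lemma multiplier_mem: "\<phi> \<in> DA_multipliers \<Longrightarrow> \<phi> \<in> DA_space"
  using multiplier_times_one[of \<phi>] one_DA(1) by (force simp: DA_multipliers_def multipliers_def)

text \<open>The operator norm is an extended real defined on the unit ball, so the usual inequality
  is stated with a real upper bound \<open>e\<close> and obtained by normalising f.\<close>

lemma mult_norm_le:
  assumes \<phi>: "\<phi> \<in> DA_multipliers" and e: "DA_mult_norm \<phi> < ereal e" and f: "f \<in> DA_space"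
  shows "hnorm DA_ip (\<phi> * f) \<le> e * hnorm DA_ip f"
proof (cases "f = 0")
  case True
  then show ?thesis by (simp add: hnorm_def)
next
  case False
  define c where "c = hnorm DA_ip f"
  have c: "0 < c" using DA.ip_pos[OF f False] by (simp add: c_def hnorm_def)
  define h where "h = (\<lambda>x. of_real (1 / c) * f x)"
  have h: "h \<in> DA_space" unfolding h_def using f by (rule DA.scale_mem)
  have "hnorm DA_ip h = 1" unfolding h_def DA.hnorm_scale[OF f] using c by (simp add: c_def norm_divide)
  then have "ereal (hnorm DA_ip (mult_op DA_space \<phi> h)) \<le> DA_mult_norm \<phi>"
    unfolding DA_mult_norm_def op_norm_def using h by (intro SUP_upper) auto
  then have "ereal (hnorm DA_ip (mult_op DA_space \<phi> h)) < ereal e" using e by (rule le_less_trans)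
  then have "hnorm DA_ip (\<phi> * h) < e" using h by (simp add: mult_op_def)
  moreover have "\<phi> * h = (\<lambda>x. of_real (1 / c) * (\<phi> * f) x)" by (auto simp: h_def fun_eq_iff)
  moreover have "\<phi> * f \<in> DA_space" using \<phi> f by (simp add: DA_multipliers_def multipliers_def)
  ultimately have "hnorm DA_ip (\<phi> * f) / c < e"
    using DA.hnorm_scale[of "\<phi> * f" "of_real (1 / c)"] c by (simp add: norm_divide)
  then show ?thesis using c by (simp add: field_simps c_def)
qed

text \<open>Test the operator on the constant 1 for the first bound and on the kernel function k at
  z for the second, using \<phi>(z) |k|^2 = \<langle>\<phi> k, k\<rangle>. Approximation in
  multiplier norm is thereby both Hilbert norm and uniform approximation.\<close>

lemma multiplier_norm_le:
  assumes \<phi>: "\<phi> \<in> DA_multipliers" and e: "DA_mult_norm \<phi> < ereal e"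
  shows "hnorm DA_ip \<phi> \<le> e" and "cmod (\<phi> z) \<le> e"
proof -
  show 1: "hnorm DA_ip \<phi> \<le> e"
    using mult_norm_le[OF \<phi> e one_DA(1)] by (simp add: multiplier_times_one[OF \<phi>] one_DA(2))
  show "cmod (\<phi> z) \<le> e"
  proof (cases "z \<in> ball 0 1")
    case True
    let ?k = "da_kfun z"
    have k: "?k \<in> DA_space" "\<phi> * ?k \<in> DA_space"
      using DA.kernel_mem[OF True] \<phi> by (auto simp: DA_multipliers_def multipliers_def)
    have "0 < 1 - (norm z)\<^sup>2" using True by (simp add: abs_square_less_1)
    then have pos: "0 < (hnorm DA_ip ?k)\<^sup>2" unfolding hnorm_da_kfun[OF True] by simp
    have "cmod (\<phi> z) * (hnorm DA_ip ?k)\<^sup>2 = cmod (\<phi> z) * cmod (DA_ip ?k ?k)"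
      using DA.ip_self_real[OF k(1)] DA.hnorm_sq[OF k(1)] by (metis norm_of_real abs_of_nonneg zero_le_power2)
    also have "\<dots> = cmod (DA_ip (\<phi> * ?k) ?k)"
      using DA.reproducing[OF k(2) True] DA.reproducing[OF k(1) True] by (metis norm_mult times_fun_apply)
    also have "\<dots> \<le> hnorm DA_ip (\<phi> * ?k) * hnorm DA_ip ?k" by (rule DA.Cauchy_Schwarz[OF k(2,1)])
    also have "\<dots> \<le> (e * hnorm DA_ip ?k) * hnorm DA_ip ?k"
      by (intro mult_right_mono mult_norm_le \<phi> e k DA.hnorm_nonneg)
    also have "\<dots> = e * (hnorm DA_ip ?k)\<^sup>2" by (simp add: power2_eq_square)
    finally show ?thesis using pos by (rule mult_right_le_imp_le)
  next
    case False
    then show ?thesis using \<phi> 1 DA.hnorm_nonneg[OF multiplier_mem[OF \<phi>]]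
      by (simp add: DA_multipliers_def multipliers_def)
  qed
qed

section \<open>Weak-star continuity of vector functionals\<close>

lemma (in fun_hilbert_space) continuous_map_weak_star:
  assumes f: "f \<in> H" and g: "g \<in> H"
  shows "continuous_map (weak_star_topology H ip) euclidean (\<lambda>T. ip (T f) g)"
  unfolding continuous_map
proof (intro conjI allI impI)
  let ?B = "{{T \<in> bounded_ops H ip. (\<Sum>n. ip (T (F n)) (G n)) \<in> U} | F G U.
      square_summable H ip F \<and> square_summable H ip G \<and> open U}"
  \<comment> \<open>The functional is the trace pairing with a rank one operator, given by sequences
    whose only nonzero term sits at index 0.\<close>
  define s where "s h = (\<lambda>n::nat. if n = 0 then h else 0)" for h :: "'a \<Rightarrow> complex"
  have s: "square_summable H ip (s h)" if "h \<in> H" for h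
    using that zero_mem unfolding square_summable_def s_def
    by (auto intro!: summable_finite[of "{0}"] simp: hnorm_def split: if_splits)
  have ips: "(\<Sum>n. ip (T (s f n)) (s g n)) = ip (T f) g" if "T \<in> bounded_ops H ip" for T
  proof -
    have "T 0 \<in> H" using that zero_mem by (auto simp: bounded_ops_def)
    then have "ip (T 0) 0 = 0" using ip_cnj[OF zero_mem, of "T 0"] by simp
    then have "(\<Sum>n. ip (T (s f n)) (s g n)) = (\<Sum>n\<in>{0}. ip (T (s f n)) (s g n))"
      by (intro suminf_finite) (auto simp: s_def)
    then show ?thesis by (simp add: s_def)
  qed
  \<comment> \<open>The trace formula \<open>ips\<close> is available for bounded operators only, so
    preimages must be compared inside \<open>bounded_ops\<close>.\<close>
  have top: "topspace (weak_star_topology H ip) \<subseteq> bounded_ops H ip"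
    unfolding weak_star_topology_def topology_generated_by_topspace by (rule Union_least) auto
  fix U :: "complex set" assume "openin euclidean U"
  then have "{T \<in> bounded_ops H ip. (\<Sum>n. ip (T (s f n)) (s g n)) \<in> U} \<in> ?B"
    using s[OF f] s[OF g] by (intro CollectI exI[of _ "s f"] exI[of _ "s g"] exI[of _ U]) simp
  then have "openin (weak_star_topology H ip) {T \<in> bounded_ops H ip. (\<Sum>n. ip (T (s f n)) (s g n)) \<in> U}"
    (is "openin _ ?S")
    unfolding weak_star_topology_def by (rule topology_generated_by_Basis)
  moreover from this have "{T \<in> bounded_ops H ip. (\<Sum>n. ip (T (s f n)) (s g n)) \<in> U}
      \<subseteq> topspace (weak_star_topology H ip)" by (rule openin_subset)
  ultimately show "openin (weak_star_topology H ip)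
      {T \<in> topspace (weak_star_topology H ip). ip (T f) g \<in> U}"
  proof -
    assume o: "openin (weak_star_topology H ip) ?S" and sub: "?S \<subseteq> topspace (weak_star_topology H ip)"
    have "?S = {T \<in> topspace (weak_star_topology H ip). ip (T f) g \<in> U}"
      using top ips sub by auto
    with o show ?thesis by simp
  qed
qed simp

text \<open>The functional is \<phi> \<mapsto> \<langle>M 1, g\<rangle> with M multiplication by
  \<phi>, hence the pullback of a weak-star continuous functional on operators.\<close>

lemma multiplier_functional_continuous:
  assumes "g \<in> (DA_space :: (complex ^ 'd::finite \<Rightarrow> complex) set)"
  shows "continuous_map (multiplier_topology (ball 0 1) DA_space DA_ip) euclidean (\<lambda>\<phi>. DA_ip \<phi> g)"
proof -
  let ?T = "multiplier_topology (ball 0 1) (DA_space :: (complex ^ 'd \<Rightarrow> complex) set) DA_ip"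
  have "continuous_map ?T euclidean ((\<lambda>T. DA_ip (T (da_kfun 0)) g) \<circ> mult_op DA_space)"
    unfolding multiplier_topology_def
    by (rule continuous_map_pullback, rule DA.continuous_map_weak_star[OF one_DA(1) assms])
  then show ?thesis
  proof (rule continuous_map_eq)
    fix \<phi> assume "\<phi> \<in> topspace ?T"
    then have "\<phi> \<in> DA_multipliers"
      by (simp add: multiplier_topology_def topspace_pullback_topology DA_multipliers_def)
    then show "((\<lambda>T. DA_ip (T (da_kfun 0)) g) \<circ> mult_op DA_space) \<phi> = DA_ip \<phi> g"
      by (simp add: mult_op_def multiplier_times_one one_DA(1))
  qed
qed

text \<open>A function of the algebra is a uniform limit of polynomials on the ball, hence uniformly
  continuous, and extends continuously to the closed ball. Here \<open>p\<close> is the cut-off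
  polynomial living in the multiplier algebra, while \<open>P\<close> continues it across the
  sphere.\<close>

lemma boundary_extension_approx:
  fixes \<phi> :: "complex ^ 'd::finite \<Rightarrow> complex"
  assumes "\<phi> \<in> DA_algebra"
  shows "continuous_on (sphere 0 1) (boundary_extension \<phi>)"
    and "0 < e \<Longrightarrow> \<exists>p P. p \<in> DA_multipliers \<and> hnorm DA_ip (\<phi> - p) \<le> e \<and>
      continuous_on UNIV P \<and> (\<forall>z\<in>ball 0 1. p z = P z) \<and>
      (\<forall>\<zeta>\<in>sphere 0 1. cmod (boundary_extension \<phi> \<zeta> - P \<zeta>) \<le> e)"
proof -
  have \<phi>: "\<phi> \<in> DA_multipliers" using assms by (simp add: DA_algebra_def)
  have approx: "\<exists>p P. p \<in> DA_multipliers \<and> hnorm DA_ip (\<phi> - p) \<le> e \<and>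
      continuous_on UNIV P \<and> (\<forall>z\<in>ball 0 1. p z = P z) \<and> (\<forall>z\<in>ball 0 1. cmod (\<phi> z - P z) \<le> e)"
    if e: "0 < e" for e
  proof -
    obtain p where p: "p \<in> ball_polynomials" "p \<in> DA_multipliers" "DA_mult_norm (\<phi> - p) < ereal e"
      using assms e unfolding DA_algebra_def by blast
    obtain P where P: "continuous_on UNIV P" "\<And>z. z \<in> ball 0 1 \<Longrightarrow> p z = P z"
      using polynomial_continuous[OF p(1)] by blast
    have "\<phi> - p \<in> DA_multipliers"
      unfolding DA_multipliers_def multipliers_def
    proof (intro CollectI conjI allI impI ballI)
      show "(\<phi> - p) x = 0" if "x \<notin> ball 0 1" for x
        using \<phi> p(2) that by (simp add: DA_multipliers_def multipliers_def)
      show "(\<phi> - p) * f \<in> DA_space" if "f \<in> DA_space" for f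
        unfolding left_diff_distrib using \<phi> p(2) that
        by (intro DA.diff_mem) (simp_all add: DA_multipliers_def multipliers_def)
    qed
    from multiplier_norm_le[OF this p(3)] have n: "hnorm DA_ip (\<phi> - p) \<le> e"
      "cmod ((\<phi> - p) z) \<le> e" for z by blast+
    have "cmod (\<phi> z - P z) \<le> e" if "z \<in> ball 0 1" for z
      using n(2)[of z] P(2)[OF that] by simp
    with n(1) p(2) P show ?thesis by blast
  qed
  have "uniformly_continuous_on (ball 0 1) \<phi>"
    unfolding uniformly_continuous_on_def
  proof (intro allI impI)
    fix e :: real assume e: "0 < e"
    then obtain P where P: "continuous_on UNIV P" "\<forall>z\<in>ball 0 1. cmod (\<phi> z - P z) \<le> e / 4"
      using approx[of "e / 4"] by auto
    have "uniformly_continuous_on (cball 0 1) P"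
      by (rule compact_uniformly_continuous) (auto intro: continuous_on_subset[OF P(1)])
    moreover have "0 < e / 4" using e by simp
    ultimately have "\<exists>d>0. \<forall>x\<in>cball 0 1. \<forall>x'\<in>cball 0 1. dist x' x < d \<longrightarrow> dist (P x') (P x) < e / 4"
      unfolding uniformly_continuous_on_def by (elim allE[of _ "e / 4"] impE)
    then obtain d where d: "0 < d"
      "\<And>x x'. x \<in> cball 0 1 \<Longrightarrow> x' \<in> cball 0 1 \<Longrightarrow> dist x' x < d \<Longrightarrow> dist (P x') (P x) < e / 4"
      by blast
    show "\<exists>d>0. \<forall>x\<in>ball 0 1. \<forall>x'\<in>ball 0 1. dist x' x < d \<longrightarrow> dist (\<phi> x') (\<phi> x) < e"
    proof (intro exI conjI ballI impI)
      fix x x' :: "complex ^ 'd" assume x: "x \<in> ball 0 1" "x' \<in> ball 0 1" "dist x' x < d"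
      have "dist (P x') (P x) < e / 4" using x by (intro d) auto
      moreover have "dist (\<phi> x) (P x) \<le> e / 4" "dist (\<phi> x') (P x') \<le> e / 4"
        using P(2) x by (auto simp: dist_norm)
      ultimately show "dist (\<phi> x') (\<phi> x) < e"
        using dist_triangle[of "\<phi> x'" "\<phi> x" "P x'"] dist_triangle[of "P x'" "\<phi> x" "P x"]
          e by (simp add: dist_commute)
    qed (rule d)
  qed
  then obtain \<Psi> where \<Psi>: "uniformly_continuous_on (closure (ball 0 1)) \<Psi>" "\<And>x. x \<in> ball 0 1 \<Longrightarrow> \<phi> x = \<Psi> x"
    by (rule uniformly_continuous_on_extension_on_closure) (rule that)
  have cont: "continuous_on (cball 0 1) \<Psi>"
    using uniformly_continuous_imp_continuous[OF \<Psi>(1)] by simp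
  \<comment> \<open>The limit from inside defining \<open>boundary_extension\<close> is the value of
    the continuous extension, as sphere points are limit points of the ball.\<close>
  have ext: "boundary_extension \<phi> \<zeta> = \<Psi> \<zeta>" if \<zeta>: "\<zeta> \<in> sphere 0 1" for \<zeta>
  proof -
    have "\<zeta> islimpt ball 0 1" using \<zeta> by (simp add: islimpt_ball)
    then have nt: "at \<zeta> within ball 0 1 \<noteq> bot" by (simp add: trivial_limit_within)
    have "(\<Psi> \<longlongrightarrow> \<Psi> \<zeta>) (at \<zeta> within cball 0 1)"
      using cont \<zeta> by (simp add: continuous_on_def)
    then have "(\<Psi> \<longlongrightarrow> \<Psi> \<zeta>) (at \<zeta> within ball 0 1)"
      by (rule tendsto_within_subset) (rule ball_subset_cball)
    then have "(\<phi> \<longlongrightarrow> \<Psi> \<zeta>) (at \<zeta> within ball 0 1)"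
      by (rule tendsto_cong[THEN iffD1, rotated])
        (use \<Psi>(2) in \<open>auto simp: eventually_at_filter\<close>)
    then show ?thesis unfolding boundary_extension_def by (rule tendsto_Lim[OF nt])
  qed
  have "continuous_on (sphere 0 1) \<Psi>" by (rule continuous_on_subset[OF cont sphere_cball])
  then show "continuous_on (sphere 0 1) (boundary_extension \<phi>)"
    by (rule continuous_on_eq) (simp add: ext)
  assume "0 < e"
  then obtain p P where p: "p \<in> DA_multipliers" "hnorm DA_ip (\<phi> - p) \<le> e"
      "continuous_on UNIV P" "\<forall>z\<in>ball 0 1. p z = P z" "\<forall>z\<in>ball 0 1. cmod (\<phi> z - P z) \<le> e"
    using approx by blast
  have "cmod (\<Psi> \<zeta> - P \<zeta>) \<le> e" if "\<zeta> \<in> cball 0 1" for \<zeta>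
  proof -
    have "continuous_on (closure (ball 0 1)) (\<lambda>z. cmod (\<Psi> z - P z))"
      using cont continuous_on_subset[OF p(3)] by (auto intro!: continuous_intros)
    moreover have "\<zeta> \<in> closure (ball 0 1)" using that by simp
    ultimately show ?thesis
      by (rule continuous_le_on_closure) (use p(5) \<Psi>(2) in simp)
  qed
  then show "\<exists>p P. p \<in> DA_multipliers \<and> hnorm DA_ip (\<phi> - p) \<le> e \<and>
      continuous_on UNIV P \<and> (\<forall>z\<in>ball 0 1. p z = P z) \<and>
      (\<forall>\<zeta>\<in>sphere 0 1. cmod (boundary_extension \<phi> \<zeta> - P \<zeta>) \<le> e)"
    using p(1-4) ext by (intro exI[of _ p] exI[of _ P] conjI ballI) auto
qed

section \<open>Measures of finite energy\<close>

lemma borel_prob_on_sphere_measurable: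
  fixes f :: "complex ^ 'd::finite \<Rightarrow> 'b::topological_space"
  assumes "borel_prob_on_sphere \<mu>" "continuous_on (sphere 0 1) f"
  shows "f \<in> borel_measurable \<mu>"
proof -
  have "f \<in> borel_measurable (restrict_space borel (sphere 0 1))"
    using assms(2) by (rule borel_measurable_continuous_on_restrict)
  moreover have "sets \<mu> = sets (restrict_space borel (sphere 0 1))"
    using assms(1) by (simp add: borel_prob_on_sphere_def)
  ultimately show ?thesis by (simp cong: measurable_cong_sets)
qed

lemma borel_prob_on_sphere_space:
  "borel_prob_on_sphere \<mu> \<Longrightarrow> space \<mu> = sphere 0 1"
  using sets_eq_imp_space_eq[of \<mu> "restrict_space borel (sphere 0 1)"]
  by (simp add: borel_prob_on_sphere_def space_restrict_space)

lemma borel_prob_on_sphere_integrable: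
  fixes f :: "complex ^ 'd::finite \<Rightarrow> complex"
  assumes \<mu>: "borel_prob_on_sphere \<mu>" and f: "continuous_on (sphere 0 1) f"
  shows "integrable \<mu> f"
proof -
  interpret prob_space \<mu> using \<mu> by (simp add: borel_prob_on_sphere_def)
  have "compact (f ` sphere 0 1)" using f by (rule compact_continuous_image) simp
  then have "\<exists>B. \<forall>z\<in>sphere 0 1. norm (f z) \<le> B"
    by (drule_tac compact_imp_bounded) (simp add: bounded_iff)
  then obtain B where "\<And>z. z \<in> sphere 0 1 \<Longrightarrow> norm (f z) \<le> B"
    by blast
  then show ?thesis
    by (intro integrable_const_bound[of _ B] AE_I2 borel_prob_on_sphere_measurable[OF \<mu> f])
      (simp add: borel_prob_on_sphere_space[OF \<mu>])
qed

lemma herm_measurable: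
  fixes \<mu> :: "(complex ^ 'd::finite) measure"
  assumes \<mu>: "borel_prob_on_sphere \<mu>"
  shows "(\<lambda>p. herm (fst p) (snd p)) \<in> borel_measurable (\<mu> \<Otimes>\<^sub>M \<mu>)"
proof -
  have [measurable]: "(\<lambda>z. z $ i) \<in> borel_measurable \<mu>" for i
    by (intro borel_prob_on_sphere_measurable[OF \<mu>] continuous_intros)
  have [measurable]: "(\<lambda>z. cnj (z $ i)) \<in> borel_measurable \<mu>" for i
    by (intro borel_prob_on_sphere_measurable[OF \<mu>] continuous_intros)
  show ?thesis by measurable
qed

lemma continuous_on_dilate:
  assumes "continuous_on (ball (0 :: complex ^ 'd::finite) 1) f" "0 \<le> r" "r < 1"
  shows "continuous_on (sphere 0 1) (\<lambda>\<zeta>. f (r *\<^sub>R \<zeta>))"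
  by (rule continuous_on_compose2[OF assms(1)]) (use assms(2,3) in \<open>auto intro!: continuous_intros\<close>)

text \<open>For r < 1 the dilated sphere stays in a compact part of the ball, where point
  evaluations are uniformly bounded; the Riesz theorem then applies to the averaged
  evaluation.\<close>

lemma dilated_integral_functional:
  fixes \<mu> :: "(complex ^ 'd::finite) measure"
  assumes \<mu>: "borel_prob_on_sphere \<mu>" and r: "0 \<le> r" "r < 1"
  shows "\<exists>g\<in>DA_space. \<forall>f\<in>DA_space. (\<integral>\<zeta>. f (r *\<^sub>R \<zeta>) \<partial>\<mu>) = DA_ip f g"
proof -
  interpret prob_space \<mu> using \<mu> by (simp add: borel_prob_on_sphere_def)
  have int: "integrable \<mu> (\<lambda>\<zeta>. f (r *\<^sub>R \<zeta>))" if "f \<in> DA_space" for f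
    by (intro borel_prob_on_sphere_integrable[OF \<mu>] continuous_on_dilate DA_continuous_on that r)
  have bound: "cmod (\<integral>\<zeta>. f (r *\<^sub>R \<zeta>) \<partial>\<mu>) \<le> sqrt (1 / (1 - r\<^sup>2)) * hnorm DA_ip f" if f: "f \<in> DA_space" for f
  proof -
    have "cmod (\<integral>\<zeta>. f (r *\<^sub>R \<zeta>) \<partial>\<mu>) \<le> (\<integral>\<zeta>. cmod (f (r *\<^sub>R \<zeta>)) \<partial>\<mu>)" by simp
    also have "\<dots> \<le> (\<integral>\<zeta>. sqrt (1 / (1 - r\<^sup>2)) * hnorm DA_ip f \<partial>\<mu>)"
      by (intro integral_mono integrable_norm int f integrable_const DA_norm_le[OF f _ r(2)])
        (use r in \<open>simp add: borel_prob_on_sphere_space[OF \<mu>]\<close>)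
    finally show ?thesis by (simp add: prob_space)
  qed
  show ?thesis
  proof (rule DA.riesz_representation[where L = "\<lambda>f. \<integral>\<zeta>. f (r *\<^sub>R \<zeta>) \<partial>\<mu>"
        and C = "sqrt (1 / (1 - r\<^sup>2))"])
    show "(\<integral>\<zeta>. (f + g) (r *\<^sub>R \<zeta>) \<partial>\<mu>) = (\<integral>\<zeta>. f (r *\<^sub>R \<zeta>) \<partial>\<mu>) + (\<integral>\<zeta>. g (r *\<^sub>R \<zeta>) \<partial>\<mu>)"
      if "f \<in> DA_space" "g \<in> DA_space" for f g
      using int that by simp
    show "\<exists>g\<in>DA_space. \<forall>f\<in>DA_space. (\<integral>\<zeta>. f (r *\<^sub>R \<zeta>) \<partial>\<mu>) = DA_ip f g"
      if "g \<in> DA_space" "\<And>f. f \<in> DA_space \<Longrightarrow> (\<integral>\<zeta>. f (r *\<^sub>R \<zeta>) \<partial>\<mu>) = DA_ip f g" for g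
      using that by blast
    show "cmod (\<integral>\<zeta>. f (r *\<^sub>R \<zeta>) \<partial>\<mu>) \<le> sqrt (1 / (1 - r\<^sup>2)) * hnorm DA_ip f" if "f \<in> DA_space" for f
      using bound[OF that] .
  qed simp
qed

text \<open>The approximate representing vectors \<open>g\<^sub>r\<close> satisfy \<open>\<langle>g\<^sub>r, g\<^sub>s\<rangle> = \<integral>\<integral> 1 / (1 - r s \<langle>z, w\<rangle>)\<close>, so finite
  energy makes them a Cauchy net as \<open>r \<rightarrow> 1\<close>.\<close>

proposition finite_energy_imp_henkin:
  fixes \<mu> :: "(complex ^ 'd::finite) measure"
  assumes \<mu>: "borel_prob_on_sphere \<mu>"
    and energy: "(\<integral>\<^sup>+z. \<integral>\<^sup>+w. inverse (ennreal (cmod (1 - herm z w))) \<partial>\<mu> \<partial>\<mu>) < \<infinity>"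
  shows "A_henkin \<mu>"
proof -
  interpret prob_space \<mu> using \<mu> by (simp add: borel_prob_on_sphere_def)
  interpret P: pair_prob_space \<mu> \<mu> ..
  note sp = borel_prob_on_sphere_space[OF \<mu>]
  define r where "r n = 1 - 1 / real (n + 2)" for n
  have r: "0 \<le> r n" "r n < 1" for n by (auto simp: r_def field_simps)
  have r_mono: "r m \<le> r n" if "m \<le> n" for m n using that by (simp add: r_def frac_le)
  have r_lim: "r \<longlonglongrightarrow> 1"
  proof -
    have "(\<lambda>n. 1 - 1 / real (n + 2)) \<longlonglongrightarrow> 1 - 0"
      by (intro tendsto_intros LIMSEQ_ignore_initial_segment[of "\<lambda>n. 1 / real n" 0 2] lim_1_over_n)
    then show ?thesis by (simp add: r_def[abs_def])
  qed
  define \<Phi> where "\<Phi> t = (\<integral>(z, w). 1 / (1 - of_real t * herm z w) \<partial>(\<mu> \<Otimes>\<^sub>M \<mu>))" for t :: real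
  note h_meas = herm_measurable[OF \<mu>]
  have e_meas: "(\<lambda>p. inverse (ennreal (cmod (1 - herm (fst p) (snd p))))) \<in> borel_measurable (\<mu> \<Otimes>\<^sub>M \<mu>)"
    using h_meas by measurable
  have e_fin: "(\<integral>\<^sup>+p. inverse (ennreal (cmod (1 - herm (fst p) (snd p)))) \<partial>(\<mu> \<Otimes>\<^sub>M \<mu>)) < \<infinity>"
    using energy nn_integral_fst[OF e_meas] by simp
  \<comment> \<open>In \<open>ennreal\<close> the inverse of 0 is infinite, so finite energy makes
    the pairs with \<open>herm z w = 1\<close> a null set. The complex kernel has the junk value 0
    exactly there.\<close>
  have "AE p in \<mu> \<Otimes>\<^sub>M \<mu>. inverse (ennreal (cmod (1 - herm (fst p) (snd p)))) \<noteq> \<infinity>"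
    using e_fin by (intro nn_integral_PInf_AE[OF e_meas]) simp
  then have off_diagonal: "AE (z, w) in \<mu> \<Otimes>\<^sub>M \<mu>. herm z w \<noteq> 1"
    by eventually_elim (auto simp: split_beta)
  have k_meas: "(\<lambda>(z, w). 1 / (1 - of_real t * herm z w)) \<in> borel_measurable (\<mu> \<Otimes>\<^sub>M \<mu>)" for t :: real
    unfolding case_prod_unfold using h_meas by measurable
  have energy_int: "integrable (\<mu> \<Otimes>\<^sub>M \<mu>) (\<lambda>(z, w). da_kernel z w)"
  proof (rule integrableI_bounded)
    show "(\<lambda>(z, w). da_kernel z w) \<in> borel_measurable (\<mu> \<Otimes>\<^sub>M \<mu>)"
      unfolding da_kernel_def using k_meas[of 1] by simp
    have "ennreal (1 / c) \<le> inverse (ennreal c)" if "0 \<le> c" for c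
      using that by (cases "c = 0") (simp_all add: inverse_ennreal inverse_eq_divide)
    then have "(\<integral>\<^sup>+p. ennreal (norm (case p of (z, w) \<Rightarrow> da_kernel z w)) \<partial>(\<mu> \<Otimes>\<^sub>M \<mu>))
        \<le> (\<integral>\<^sup>+p. inverse (ennreal (cmod (1 - herm (fst p) (snd p)))) \<partial>(\<mu> \<Otimes>\<^sub>M \<mu>))"
      by (intro nn_integral_mono) (simp add: da_kernel_def norm_divide split_beta)
    then show "(\<integral>\<^sup>+p. ennreal (norm (case p of (z, w) \<Rightarrow> da_kernel z w)) \<partial>(\<mu> \<Otimes>\<^sub>M \<mu>)) < \<infinity>"
      using e_fin by (rule le_less_trans)
  qed
  have h_le: "cmod (herm z w) \<le> 1" if "z \<in> space \<mu>" "w \<in> space \<mu>" for z w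
    using norm_herm_le[of z w] that by (simp add: sp)
  have dom: "cmod (1 / (1 - of_real t * herm z w)) \<le> 2 * cmod (da_kernel z w)"
    if "z \<in> space \<mu>" "w \<in> space \<mu>" "herm z w \<noteq> 1" "0 \<le> t" "t \<le> 1" for z w t
  proof -
    have "0 < cmod (1 - herm z w)" using that(3) by simp
    moreover have "cmod (1 - herm z w) \<le> 2 * cmod (1 - of_real t * herm z w)"
      using that by (intro norm_one_minus_le h_le)
    moreover have "1 / y \<le> 2 * (1 / x)" if "0 < x" "x \<le> 2 * y" for x y :: real
    proof -
      have "0 < y" using that by linarith
      then show ?thesis using that by (simp add: field_simps)
    qed
    ultimately have "1 / cmod (1 - of_real t * herm z w) \<le> 2 * (1 / cmod (1 - herm z w))" by blast
    then show ?thesis by (simp only: da_kernel_def norm_divide norm_one)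
  qed
  have AE_dom: "AE p in \<mu> \<Otimes>\<^sub>M \<mu>. norm (case p of (z, w) \<Rightarrow> 1 / (1 - of_real t * herm z w))
      \<le> 2 * cmod (case p of (z, w) \<Rightarrow> da_kernel z w)" if "0 \<le> t" "t \<le> 1" for t
    using off_diagonal AE_space
  proof eventually_elim
    case (elim p)
    then obtain z w where p: "p = (z, w)" "z \<in> space \<mu>" "w \<in> space \<mu>" "herm z w \<noteq> 1"
      by (cases p) (simp add: space_pair_measure)
    show ?case unfolding p(1) prod.case by (rule dom[OF p(2-4) that])
  qed
  have dom_int: "integrable (\<mu> \<Otimes>\<^sub>M \<mu>) (\<lambda>p. 2 * cmod (case p of (z, w) \<Rightarrow> da_kernel z w))"
    by (intro integrable_mult_right integrable_norm energy_int)
  have \<Phi>_int: "integrable (\<mu> \<Otimes>\<^sub>M \<mu>) (\<lambda>(z, w). 1 / (1 - of_real t * herm z w))" if "0 \<le> t" "t \<le> 1" for t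
    by (rule Bochner_Integration.integrable_bound[OF dom_int k_meas]) (use AE_dom[OF that] in auto)
  \<comment> \<open>Dominated convergence with twice the modulus of the kernel as majorant,
    integrable by finite energy.\<close>
  have \<Phi>_lim: "(\<Phi> \<longlongrightarrow> \<Phi> 1) (at 1 within {0..1})"
    unfolding tendsto_at_iff_sequentially comp_def
  proof (intro allI impI)
    fix X :: "nat \<Rightarrow> real" assume X: "\<forall>i. X i \<in> {0..1} - {1}" "X \<longlonglongrightarrow> 1"
    show "(\<lambda>i. \<Phi> (X i)) \<longlonglongrightarrow> \<Phi> 1"
      unfolding \<Phi>_def
    proof (rule integral_dominated_convergence[OF k_meas k_meas dom_int])
      show "AE p in \<mu> \<Otimes>\<^sub>M \<mu>. (\<lambda>i. case p of (z, w) \<Rightarrow> 1 / (1 - of_real (X i) * herm z w))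
          \<longlonglongrightarrow> (case p of (z, w) \<Rightarrow> 1 / (1 - of_real 1 * herm z w))"
        using off_diagonal
      proof eventually_elim
        case (elim p)
        obtain z w where p: "p = (z, w)" by (cases p)
        have "(\<lambda>i. 1 / (1 - of_real (X i) * herm z w)) \<longlonglongrightarrow> 1 / (1 - of_real 1 * herm z w)"
          by (intro tendsto_divide tendsto_diff tendsto_mult tendsto_of_real tendsto_const X(2))
            (use elim p in simp)
        then show ?case by (simp add: p)
      qed
      show "AE p in \<mu> \<Otimes>\<^sub>M \<mu>. norm (case p of (z, w) \<Rightarrow> 1 / (1 - of_real (X i) * herm z w))
          \<le> 2 * cmod (case p of (z, w) \<Rightarrow> da_kernel z w)" for i
        using X(1) by (intro AE_dom) auto
    qed
  qed
  obtain G where G: "\<And>n. G n \<in> DA_space"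
      "\<And>n f. f \<in> DA_space \<Longrightarrow> (\<integral>\<zeta>. f (r n *\<^sub>R \<zeta>) \<partial>\<mu>) = DA_ip f (G n)"
    using bchoice[of UNIV "\<lambda>n g. g \<in> DA_space \<and> (\<forall>f\<in>DA_space. (\<integral>\<zeta>. f (r n *\<^sub>R \<zeta>) \<partial>\<mu>) = DA_ip f g)"]
      dilated_integral_functional[OF \<mu> r] by blast
  \<comment> \<open>The representing vector is the potential of the measure pushed forward by
    dilation with \<open>r n\<close>.\<close>
  have G_eq: "G n z = (\<integral>\<zeta>. da_kernel z (r n *\<^sub>R \<zeta>) \<partial>\<mu>)" if z: "z \<in> ball 0 1" for n z
  proof -
    have k: "da_kfun z \<in> DA_space" using z by (rule DA.kernel_mem)
    have "G n z = cnj (DA_ip (da_kfun z) (G n))"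
      using DA.reproducing[OF G(1) z] DA.ip_cnj[OF k G(1)] by simp
    also have "\<dots> = (\<integral>\<zeta>. cnj (da_kfun z (r n *\<^sub>R \<zeta>)) \<partial>\<mu>)"
      unfolding G(2)[OF k, symmetric] by simp
    also have "\<dots> = (\<integral>\<zeta>. da_kernel z (r n *\<^sub>R \<zeta>) \<partial>\<mu>)"
    proof (rule Bochner_Integration.integral_cong[OF refl])
      fix \<zeta> assume "\<zeta> \<in> space \<mu>"
      then have "r n *\<^sub>R \<zeta> \<in> ball 0 1" using r[of n] by (simp add: sp)
      then show "cnj (da_kfun z (r n *\<^sub>R \<zeta>)) = da_kernel z (r n *\<^sub>R \<zeta>)"
        by (simp add: kernel_fun_def da_kernel_def mult.commute)
    qed
    finally show ?thesis .
  qed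
  have G_ip: "DA_ip (G m) (G n) = \<Phi> (r n * r m)" for m n
  proof -
    have "DA_ip (G m) (G n) = (\<integral>z. G m (r n *\<^sub>R z) \<partial>\<mu>)" by (rule G(2)[OF G(1), symmetric])
    also have "\<dots> = (\<integral>z. \<integral>w. 1 / (1 - of_real (r n * r m) * herm z w) \<partial>\<mu> \<partial>\<mu>)"
    proof (rule Bochner_Integration.integral_cong[OF refl])
      fix z assume "z \<in> space \<mu>"
      then have "r n *\<^sub>R z \<in> ball 0 1" using r[of n] by (simp add: sp)
      then show "G m (r n *\<^sub>R z) = (\<integral>w. 1 / (1 - of_real (r n * r m) * herm z w) \<partial>\<mu>)"
        by (simp only: G_eq da_kernel_def herm_scaleR)
    qed
    also have "\<dots> = \<Phi> (r n * r m)"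
      unfolding \<Phi>_def
      by (rule P.integral_fst) (use \<Phi>_int[of "r n * r m"] r in \<open>simp add: mult_le_one less_imp_le\<close>)
    finally show ?thesis .
  qed
  have G_diff: "(hnorm DA_ip (G m - G n))\<^sup>2 = Re (\<Phi> (r m * r m)) + Re (\<Phi> (r n * r n)) - 2 * Re (\<Phi> (r n * r m))" for m n
    using G(1) by (simp add: DA.hnorm_sq_diff DA.hnorm_sq G_ip)
  have "\<exists>N. \<forall>m\<ge>N. \<forall>n\<ge>N. hnorm DA_ip (G m - G n) < e" if e: "0 < e" for e
  proof -
    \<comment> \<open>The squared distance in \<open>G_diff\<close> combines values of \<Phi> near 1
      with weights 1, 1 and -2; an error below e^2 / 4 in each therefore gives less than
      e^2.\<close>
    obtain d where d: "0 < d" "\<And>t. t \<in> {0..1} \<Longrightarrow> t \<noteq> 1 \<Longrightarrow> dist t 1 < d \<Longrightarrow> dist (\<Phi> t) (\<Phi> 1) < e\<^sup>2 / 4"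
      using \<Phi>_lim[unfolded Lim_within, rule_format, of "e\<^sup>2 / 4"] e by auto
    have "(\<lambda>n. r n * r n) \<longlonglongrightarrow> 1 * 1" by (intro tendsto_mult r_lim)
    then have "\<forall>\<^sub>F n in sequentially. 1 - d < r n * r n" using d by (intro order_tendstoD) auto
    then obtain N where N: "1 - d < r N * r N" by (auto simp: eventually_sequentially)
    have *: "\<bar>Re (\<Phi> (r m * r n)) - Re (\<Phi> 1)\<bar> < e\<^sup>2 / 4" if "m \<ge> N" "n \<ge> N" for m n
    proof -
      have "r N * r N \<le> r m * r n" using that r by (intro mult_mono r_mono) auto
      moreover have "r m * r n < 1" using mult_strict_mono[of "r m" 1 "r n" 1] r by simp
      ultimately have "dist (\<Phi> (r m * r n)) (\<Phi> 1) < e\<^sup>2 / 4"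
        using r N by (intro d) (auto simp: dist_real_def)
      then show ?thesis using abs_Re_le_cmod[of "\<Phi> (r m * r n) - \<Phi> 1"] by (simp add: dist_norm)
    qed
    have "hnorm DA_ip (G m - G n) < e" if "m \<ge> N" "n \<ge> N" for m n
    proof (rule power2_less_imp_less)
      show "(hnorm DA_ip (G m - G n))\<^sup>2 < e\<^sup>2"
        unfolding G_diff using *[OF that(1,1)] *[OF that(2,2)] *[OF that(2,1)]
        by (simp only: abs_less_iff) argo
    qed (use e in simp)
    then show ?thesis by blast
  qed
  then obtain g where g: "g \<in> DA_space" "(\<lambda>n. hnorm DA_ip (G n - g)) \<longlonglongrightarrow> 0"
    using DA.complete[of G, OF G(1)] by blast
  \<comment> \<open>Compute the limit of \<open>DA_ip p (G n)\<close> in two ways: by norm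
    convergence of \<open>G n\<close>, and as integrals of the dilates of \<open>P\<close>, which
    converge boundedly on the sphere.\<close>
  have poly: "DA_ip p g = (\<integral>\<zeta>. P \<zeta> \<partial>\<mu>)"
    if p: "p \<in> DA_space" and P: "continuous_on UNIV P" "\<forall>z\<in>ball 0 1. p z = P z" for p P
  proof (rule LIMSEQ_unique)
    show "(\<lambda>n. DA_ip p (G n)) \<longlonglongrightarrow> DA_ip p g"
      by (rule DA.ip_tendsto) (use p G(1) g in \<open>auto simp: hnorm_def\<close>)
    have "compact (P ` cball 0 1)"
      using P(1) by (intro compact_continuous_image continuous_on_subset[OF P(1)]) auto
    then have "\<exists>B. \<forall>z\<in>cball 0 1. norm (P z) \<le> B"
      by (drule_tac compact_imp_bounded) (simp add: bounded_iff)
    then obtain B where B: "\<And>z. z \<in> cball 0 1 \<Longrightarrow> norm (P z) \<le> B"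
      by blast
    have in_ball: "r n *\<^sub>R \<zeta> \<in> ball 0 1" if "\<zeta> \<in> space \<mu>" for n \<zeta>
      using that r[of n] by (simp add: sp)
    have "(\<lambda>n. \<integral>\<zeta>. P (r n *\<^sub>R \<zeta>) \<partial>\<mu>) \<longlonglongrightarrow> (\<integral>\<zeta>. P \<zeta> \<partial>\<mu>)"
    proof (rule integral_dominated_convergence[where w = "\<lambda>_. B"])
      show "P \<in> borel_measurable \<mu>" "(\<lambda>\<zeta>. P (r n *\<^sub>R \<zeta>)) \<in> borel_measurable \<mu>" for n
        by (intro borel_prob_on_sphere_measurable[OF \<mu>] continuous_on_compose2[OF P(1)] continuous_intros; simp)+
      show "AE \<zeta> in \<mu>. (\<lambda>n. P (r n *\<^sub>R \<zeta>)) \<longlonglongrightarrow> P \<zeta>"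
      proof (rule AE_I2)
        fix \<zeta> :: "complex ^ 'd"
        have "(\<lambda>n. r n *\<^sub>R \<zeta>) \<longlonglongrightarrow> 1 *\<^sub>R \<zeta>" by (intro tendsto_scaleR r_lim tendsto_const)
        then show "(\<lambda>n. P (r n *\<^sub>R \<zeta>)) \<longlonglongrightarrow> P \<zeta>"
          by (intro continuous_on_tendsto_compose[OF P(1)]) auto
      qed
      show "AE \<zeta> in \<mu>. norm (P (r n *\<^sub>R \<zeta>)) \<le> B" for n
        using in_ball B ball_subset_cball by (intro AE_I2) blast
    qed simp
    moreover have "(\<integral>\<zeta>. P (r n *\<^sub>R \<zeta>) \<partial>\<mu>) = DA_ip p (G n)" for n
      unfolding G(2)[OF p, symmetric]
      by (rule Bochner_Integration.integral_cong[OF refl]) (use P(2) in_ball in simp)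
    ultimately show "(\<lambda>n. DA_ip p (G n)) \<longlonglongrightarrow> (\<integral>\<zeta>. P \<zeta> \<partial>\<mu>)" by simp
  qed
  have "DA_ip \<phi> g = (\<integral>\<zeta>. boundary_extension \<phi> \<zeta> \<partial>\<mu>)" if \<phi>: "\<phi> \<in> DA_algebra" for \<phi>
  proof -
    have \<phi>H: "\<phi> \<in> DA_space" using \<phi> by (simp add: DA_algebra_def multiplier_mem)
    let ?D = "cmod (DA_ip \<phi> g - (\<integral>\<zeta>. boundary_extension \<phi> \<zeta> \<partial>\<mu>))"
    \<comment> \<open>Replacing \<phi> by a polynomial costs e times the norm of g in the inner
      product, and e times total mass 1 in the integral.\<close>
    have "?D \<le> e * (hnorm DA_ip g + 1)" if e: "0 < e" for e
    proof -
      obtain p P where p: "p \<in> DA_multipliers" "hnorm DA_ip (\<phi> - p) \<le> e"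
        and P: "continuous_on UNIV P" "\<forall>z\<in>ball 0 1. p z = P z"
        and b: "\<forall>\<zeta>\<in>sphere 0 1. cmod (boundary_extension \<phi> \<zeta> - P \<zeta>) \<le> e"
        using boundary_extension_approx(2)[OF \<phi> e] by blast
      have pH: "p \<in> DA_space" using p(1) by (rule multiplier_mem)
      have i: "integrable \<mu> (boundary_extension \<phi>)" "integrable \<mu> P"
        by (intro borel_prob_on_sphere_integrable[OF \<mu>] boundary_extension_approx(1) \<phi>
            continuous_on_subset[OF P(1)] subset_UNIV)+
      have "cmod (DA_ip (\<phi> - p) g) \<le> hnorm DA_ip (\<phi> - p) * hnorm DA_ip g"
        by (intro DA.Cauchy_Schwarz DA.diff_mem \<phi>H pH g)
      also have "\<dots> \<le> e * hnorm DA_ip g"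
        by (intro mult_right_mono p DA.hnorm_nonneg g)
      finally have 1: "cmod (DA_ip \<phi> g - DA_ip p g) \<le> e * hnorm DA_ip g"
        using \<phi>H pH g by (simp add: DA.ip_diff)
      have "cmod ((\<integral>\<zeta>. boundary_extension \<phi> \<zeta> \<partial>\<mu>) - (\<integral>\<zeta>. P \<zeta> \<partial>\<mu>))
          = cmod (\<integral>\<zeta>. boundary_extension \<phi> \<zeta> - P \<zeta> \<partial>\<mu>)" using i by simp
      also have "\<dots> \<le> (\<integral>\<zeta>. cmod (boundary_extension \<phi> \<zeta> - P \<zeta>) \<partial>\<mu>)" by simp
      also have "\<dots> \<le> (\<integral>\<zeta>. e \<partial>\<mu>)"
        using b i by (intro integral_mono integrable_norm Bochner_Integration.integrable_diff) (auto simp: sp)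
      also have "\<dots> = e" by (simp add: prob_space)
      finally have 2: "cmod ((\<integral>\<zeta>. boundary_extension \<phi> \<zeta> \<partial>\<mu>) - (\<integral>\<zeta>. P \<zeta> \<partial>\<mu>)) \<le> e" .
      have "?D \<le> cmod (DA_ip \<phi> g - DA_ip p g) + cmod ((\<integral>\<zeta>. boundary_extension \<phi> \<zeta> \<partial>\<mu>) - (\<integral>\<zeta>. P \<zeta> \<partial>\<mu>))"
        unfolding poly[OF pH P]
        using dist_triangle2[of "DA_ip \<phi> g" "\<integral>\<zeta>. boundary_extension \<phi> \<zeta> \<partial>\<mu>" "\<integral>\<zeta>. P \<zeta> \<partial>\<mu>"]
        by (simp add: dist_norm)
      then show ?thesis using 1 2 by (simp add: algebra_simps)
    qed
    then have small: "?D \<le> e * (hnorm DA_ip g + 1)" if "0 < e" for e using that by blast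
    have "0 < hnorm DA_ip g + 1" using DA.hnorm_nonneg[OF g(1)] by simp
    then have "?D \<le> 0 + e" if "0 < e" for e
      using small[of "e / (hnorm DA_ip g + 1)"] that by simp
    then have "?D \<le> 0" by (rule field_le_epsilon)
    then show ?thesis by simp
  qed
  then show ?thesis
    unfolding A_henkin_def
    by (intro exI[of _ "\<lambda>\<phi>. DA_ip \<phi> g"] conjI ballI allI multiplier_functional_continuous g)
      (simp_all add: DA.ip_add DA.ip_scale multiplier_mem g)
qed

section \<open>A map of the unit interval onto a Cantor set\<close>

text \<open>The integer \<open>\<lfloor>64 ^ Suc k * x\<rfloor> mod 64\<close> is digit number k + 1
  after the point in base 64. Allowing every real x makes the map 1-periodic, so a digit shift is
  plain multiplication by 64.\<close>

definition cantor_inv :: "real \<Rightarrow> real"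
  where "cantor_inv x = (\<Sum>k. real_of_int (\<lfloor>64 ^ Suc k * x\<rfloor> mod 64) / 512 ^ Suc k)"

text \<open>All digits are at most 63; the geometric series with this numerator has sum 63 / 511,
  just below 1 / 8.\<close>

lemma cantor_inv_sums:
  "(\<lambda>k. real_of_int (\<lfloor>64 ^ Suc k * x\<rfloor> mod 64) / 512 ^ Suc k) sums cantor_inv x"
  and cantor_inv_bounds: "0 \<le> cantor_inv x" "cantor_inv x \<le> 1 / 8"
proof -
  have "(\<lambda>k. (1 / 512 :: real) ^ k) sums (1 / (1 - 1 / 512))" by (rule geometric_sums) simp
  from sums_mult[OF this, of "63 / 512"]
  have g: "(\<lambda>k. 63 / 512 ^ Suc k :: real) sums (63 / 511)" by (simp add: power_divide)
  have le: "real_of_int (\<lfloor>64 ^ Suc k * x\<rfloor> mod 64) / 512 ^ Suc k \<le> 63 / 512 ^ Suc k" for k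
  proof -
    have "\<lfloor>64 ^ Suc k * x\<rfloor> mod 64 \<le> 63" using pos_mod_bound[of 64 "\<lfloor>64 ^ Suc k * x\<rfloor>"] by linarith
    then show ?thesis by (intro divide_right_mono) simp_all
  qed
  have nn: "0 \<le> real_of_int (\<lfloor>64 ^ Suc k * x\<rfloor> mod 64) / 512 ^ Suc k" for k by simp
  have "summable (\<lambda>k. real_of_int (\<lfloor>64 ^ Suc k * x\<rfloor> mod 64) / 512 ^ Suc k)"
    by (rule summable_comparison_test'[OF sums_summable[OF g], of 0]) (use le nn in \<open>simp only: real_norm_def abs_of_nonneg\<close>)
  then show s: "(\<lambda>k. real_of_int (\<lfloor>64 ^ Suc k * x\<rfloor> mod 64) / 512 ^ Suc k) sums cantor_inv x"
    unfolding cantor_inv_def by (rule summable_sums)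
  show "0 \<le> cantor_inv x" using nn sums_zero s by (rule sums_le)
  have "cantor_inv x \<le> 63 / 511" using le s g by (rule sums_le)
  then show "cantor_inv x \<le> 1 / 8" by simp
qed

text \<open>Self-similarity: multiplication by 512 moves the leading digit in front of the point,
  and the remaining digits are those of 64 x.\<close>

lemma cantor_inv_rec: "512 * cantor_inv x = real_of_int (\<lfloor>64 * x\<rfloor> mod 64) + cantor_inv (64 * x)"
proof -
  let ?f = "\<lambda>k. real_of_int (\<lfloor>64 ^ Suc k * x\<rfloor> mod 64) / 512 ^ Suc k"
  have "(\<lambda>k. ?f (Suc k)) sums (cantor_inv x - ?f 0)"
    using cantor_inv_sums[of x] by (subst sums_Suc_iff) simp
  from sums_mult[OF this, of 512]
  have "(\<lambda>k. real_of_int (\<lfloor>64 ^ Suc k * (64 * x)\<rfloor> mod 64) / 512 ^ Suc k) sums (512 * (cantor_inv x - ?f 0))"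
    by (simp add: mult_ac)
  from sums_unique2[OF cantor_inv_sums this] show ?thesis by (simp add: algebra_simps)
qed

lemma cantor_inv_diff_int: "cantor_inv (x - of_int n) = cantor_inv x"
proof -
  have "\<lfloor>64 ^ Suc k * (x - of_int n)\<rfloor> mod 64 = \<lfloor>64 ^ Suc k * x\<rfloor> mod 64" for k
  proof -
    have "64 ^ Suc k * (x - of_int n) = 64 ^ Suc k * x - of_int (64 * (64 ^ k * n))"
      by (simp add: algebra_simps)
    then have "\<lfloor>64 ^ Suc k * (x - of_int n)\<rfloor> = \<lfloor>64 ^ Suc k * x\<rfloor> - 64 * (64 ^ k * n)"
      by (simp only: floor_diff_of_int)
    then show ?thesis
      using mod_mult_self2[of "\<lfloor>64 ^ Suc k * x\<rfloor>" 64 "- (64 ^ k * n)"] by simp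
  qed
  then show ?thesis by (simp only: cantor_inv_def)
qed

lemma cantor_inv_shift: "\<exists>m::int. 512 ^ k * cantor_inv x = of_int m + cantor_inv (64 ^ k * x)"
proof (induction k)
  case 0
  show ?case by (rule exI[of _ 0]) simp
next
  case (Suc k)
  then obtain m :: int where "512 ^ k * cantor_inv x = of_int m + cantor_inv (64 ^ k * x)" by blast
  then have "512 ^ Suc k * cantor_inv x = 512 * (of_int m + cantor_inv (64 ^ k * x))" by simp
  also have "\<dots> = of_int (512 * m + \<lfloor>64 * (64 ^ k * x)\<rfloor> mod 64) + cantor_inv (64 ^ Suc k * x)"
    using cantor_inv_rec[of "64 ^ k * x"] by (simp add: mult.assoc)
  finally show ?case by blast
qed

text \<open>Compare leading digits. If they agree, pass to the fractional parts of 64 x and 64 y. If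
  they differ, the integer parts in the recursion are at least 1 apart while the remainders differ
  by at most 1 / 8, which leaves a gap. The case n = 0 is vacuous.\<close>

lemma cantor_inv_separation:
  assumes "0 \<le> x" "x < 1" "0 \<le> y" "y < 1" "1 / 64 ^ n < \<bar>x - y\<bar>"
  shows "1 / (2 * 512 ^ n) \<le> \<bar>cantor_inv x - cantor_inv y\<bar>"
  using assms
proof (induction n arbitrary: x y)
  case 0
  then show ?case by (auto simp: abs_if split: if_splits)
next
  case (Suc n)
  define a b where "a = \<lfloor>64 * x\<rfloor>" and "b = \<lfloor>64 * y\<rfloor>"
  have ab: "0 \<le> a" "a < 64" "0 \<le> b" "b < 64"
    using Suc.prems unfolding a_def b_def by (auto simp: floor_less_iff)
  have "512 * (cantor_inv x - cantor_inv y) = of_int (a - b) + (cantor_inv (64 * x) - cantor_inv (64 * y))"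
    using cantor_inv_rec[of x] cantor_inv_rec[of y] ab by (simp add: a_def[symmetric] b_def[symmetric])
  moreover have "cantor_inv (64 * x) = cantor_inv (64 * x - of_int a)"
    "cantor_inv (64 * y) = cantor_inv (64 * y - of_int b)" by (simp_all add: cantor_inv_diff_int)
  ultimately have rec: "512 * (cantor_inv x - cantor_inv y)
      = of_int (a - b) + (cantor_inv (64 * x - of_int a) - cantor_inv (64 * y - of_int b))" by simp
  show ?case
  proof (cases "a = b")
    case True
    have "1 / 64 ^ n < 64 * \<bar>x - y\<bar>" using Suc.prems(5) by (simp add: field_simps)
    also have "64 * \<bar>x - y\<bar> = \<bar>(64 * x - of_int a) - (64 * y - of_int b)\<bar>"
      using True by (simp add: abs_if)
    finally have "1 / (2 * 512 ^ n) \<le> \<bar>cantor_inv (64 * x - of_int a) - cantor_inv (64 * y - of_int b)\<bar>"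
      by (intro Suc.IH) (simp_all add: a_def b_def frac_lt_1 flip: frac_def)
    also have "\<dots> = 512 * \<bar>cantor_inv x - cantor_inv y\<bar>"
      using rec True abs_mult[of 512 "cantor_inv x - cantor_inv y"] by simp
    finally show ?thesis by (simp add: field_simps)
  next
    case False
    then have "1 \<le> \<bar>a - b\<bar>" by simp
    then have "1 \<le> \<bar>real_of_int (a - b)\<bar>" by linarith
    moreover have "\<bar>cantor_inv (64 * x - of_int a) - cantor_inv (64 * y - of_int b)\<bar> \<le> 1 / 8"
      using cantor_inv_bounds[of "64 * x - of_int a"] cantor_inv_bounds[of "64 * y - of_int b"]
      by linarith
    moreover have "7 / 8 \<le> 512 * \<bar>v\<bar>" if "1 \<le> \<bar>u\<bar>" "\<bar>w\<bar> \<le> 1 / 8" "512 * v = u + w" for u v w :: real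
      using that by linarith
    ultimately have "7 / 8 \<le> 512 * \<bar>cantor_inv x - cantor_inv y\<bar>" using rec by blast
    then have "1 / (2 * 512) \<le> \<bar>cantor_inv x - cantor_inv y\<bar>" by simp
    moreover have "1 / (2 * 512 ^ Suc n) \<le> (1 / (2 * 512) :: real)"
      by (intro divide_left_mono) simp_all
    ultimately show ?thesis by (rule order_trans[rotated])
  qed
qed

text \<open>The exponent \<open>3/2 = log 512 / log 64\<close> is below \<open>2\<close>, which is what makes the energy finite.\<close>

lemma cantor_inv_expanding:
  assumes "0 \<le> x" "x < 1" "0 \<le> y" "y < 1"
  shows "\<bar>x - y\<bar> ^ 3 \<le> 2 ^ 20 * (cantor_inv x - cantor_inv y)\<^sup>2"
proof (cases "x = y")
  case False
  define d where "d = \<bar>x - y\<bar>"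
  have d: "0 < d" "d < 1" using assms False by (auto simp: d_def)
  have "\<exists>n. (1 / 64) ^ n < d" using d(1) real_arch_pow_inv[of d "1 / 64"] by simp
  \<comment> \<open>The first scale finer than d; it is positive as d < 1, so d is at most 64^(-m)
    for n = m + 1. Then 64^3 = 512^2 converts the scales, and 2^20 = (2 * 512)^2 pays for the factor
    2 and for passing from m to n.\<close>
  define n where "n = (LEAST n. (1 / 64) ^ n < d)"
  have n: "(1 / 64) ^ n < d" unfolding n_def using \<open>\<exists>n. _\<close> by (rule LeastI_ex)
  with d obtain m where m: "n = Suc m" by (cases n) auto
  have "\<not> (1 / 64) ^ m < d" using not_less_Least[of m "\<lambda>n. (1 / 64) ^ n < d"] by (simp add: n_def[symmetric] m)
  then have "d ^ 3 \<le> ((1 / 64) ^ m) ^ 3" using d by (intro power_mono) auto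
  also have "((1 / 64 :: real) ^ m) ^ 3 = ((1 / 64) ^ 3) ^ m"
    by (simp only: power_mult[symmetric] mult.commute)
  also have "\<dots> = ((1 / 512) ^ 2) ^ m" by (simp add: power_divide)
  also have "\<dots> = ((1 / 512) ^ m)\<^sup>2" by (simp only: power_mult[symmetric] mult.commute)
  also have "\<dots> = 2 ^ 20 * (1 / (2 * 512 ^ n))\<^sup>2" by (simp add: m power_divide power_mult_distrib)
  also have "\<dots> \<le> 2 ^ 20 * \<bar>cantor_inv x - cantor_inv y\<bar>\<^sup>2"
    using n assms by (intro mult_left_mono power_mono cantor_inv_separation) (auto simp: d_def power_divide)
  finally show ?thesis by (simp add: d_def)
qed simp

lemma cantor_inv_measurable [measurable]: "cantor_inv \<in> borel_measurable borel"
  unfolding cantor_inv_def[abs_def]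
proof (rule borel_measurable_suminf)
  fix k
  have "(\<lambda>x :: real. \<lfloor>64 ^ Suc k * x\<rfloor>) \<in> measurable borel (count_space UNIV)" by measurable
  then have "(\<lambda>x :: real. real_of_int (\<lfloor>64 ^ Suc k * x\<rfloor> mod 64)) \<in> borel_measurable borel"
    by (rule measurable_compose) simp
  then show "(\<lambda>x :: real. real_of_int (\<lfloor>64 ^ Suc k * x\<rfloor> mod 64) / 512 ^ Suc k) \<in> borel_measurable borel"
    by (rule borel_measurable_divide) simp
qed

text \<open>Modulo full turns, multiplying the angle by 512^k only shifts digits, and what remains
  is at most an eighth of a turn, hence below pi / 3.\<close>

lemma cos_cantor_inv: "1 / 2 \<le> cos (512 ^ k * (2 * pi * cantor_inv x))"
proof -
  obtain m :: int where m: "512 ^ k * cantor_inv x = of_int m + cantor_inv (64 ^ k * x)"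
    using cantor_inv_shift by blast
  have "512 ^ k * (2 * pi * cantor_inv x) = 2 * pi * (512 ^ k * cantor_inv x)" by simp
  also have "\<dots> = 2 * pi * of_int m + 2 * pi * cantor_inv (64 ^ k * x)"
    unfolding m by (rule distrib_left)
  finally have "cos (512 ^ k * (2 * pi * cantor_inv x)) = cos (2 * pi * cantor_inv (64 ^ k * x))"
    by (simp only: cos_add cos_int_2pin sin_int_2pin)
  moreover have "cos (pi / 3) \<le> cos (2 * pi * cantor_inv (64 ^ k * x))"
    using cantor_inv_bounds[of "64 ^ k * x"] by (subst cos_mono_le_eq) (auto simp: field_simps)
  ultimately show ?thesis by (simp add: cos_60)
qed

section \<open>A totally null set\<close>

text \<open>The holomorphic completion of the squared modulus of the lacunary sum: on the circle the
  cross terms (k, j) and (j, k) are conjugate, and only the one with positive exponent is kept,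
  doubled. There is no division by N, so the mean is N.\<close>

definition gap_polynomial :: "nat \<Rightarrow> complex \<Rightarrow> complex"
  where "gap_polynomial N w = of_nat N + 2 * (\<Sum>k<N. \<Sum>j<k. w ^ (512 ^ k - 512 ^ j))"

lemma Re_gap_polynomial:
  assumes w: "cmod w = 1"
  shows "Re (gap_polynomial N w) = (cmod (\<Sum>k<N. w ^ (512 ^ k)))\<^sup>2"
proof (induction N)
  case 0
  show ?case by (simp add: gap_polynomial_def)
next
  case (Suc N)
  let ?S = "\<Sum>k<N. w ^ (512 ^ k)" and ?a = "w ^ (512 ^ N)"
  have a: "cmod ?a = 1" using w by (simp add: norm_power)
  have pw: "?a * cnj (w ^ (512 ^ j)) = w ^ (512 ^ N - 512 ^ j)" if "j < N" for j
  proof -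
    have "(512::nat) ^ j \<le> 512 ^ N" using that by (intro power_increasing) auto
    then have "?a = w ^ (512 ^ N - 512 ^ j) * w ^ (512 ^ j)" by (simp flip: power_add)
    moreover have "w ^ (512 ^ j) * cnj (w ^ (512 ^ j)) = 1"
      using complex_norm_square[of "w ^ (512 ^ j)"] w by (simp add: norm_power)
    ultimately show ?thesis by (simp only: mult.assoc mult_1_right)
  qed
  \<comment> \<open>Adding the term \<open>?a\<close> creates the cross terms with all earlier ones;
    by \<open>pw\<close> these are the powers with exponent 512^N - 512^j, as conjugation inverts on
    the circle.\<close>
  have "(cmod (s + a))\<^sup>2 = (cmod s)\<^sup>2 + (cmod a)\<^sup>2 + 2 * Re (a * cnj s)" for s a
    by (simp add: cmod_power2) (simp add: algebra_simps power2_eq_square)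
  then have "(cmod (?S + ?a))\<^sup>2 = (cmod ?S)\<^sup>2 + (cmod ?a)\<^sup>2 + 2 * Re (?a * cnj ?S)" .
  also have "?a * cnj ?S = (\<Sum>j<N. w ^ (512 ^ N - 512 ^ j))"
    using pw by (simp only: cnj_sum sum_distrib_left) simp
  finally show ?case using Suc a by (simp add: gap_polynomial_def)
qed

lemma gap_polynomial_holomorphic: "gap_polynomial N holomorphic_on S"
  unfolding gap_polynomial_def[abs_def] by (intro holomorphic_intros)

lemma gap_polynomial_0: "gap_polynomial N 0 = of_nat N"
proof -
  \<comment> \<open>Strict growth keeps the exponent positive; a zero exponent would contribute
    1.\<close>
  have "(0::complex) ^ (512 ^ k - 512 ^ j) = 0" if "j < k" for k j :: nat
    using power_strict_increasing[OF that, of "512::nat"] by simp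
  then have "(\<Sum>k<N. \<Sum>j<k. (0::complex) ^ (512 ^ k - 512 ^ j)) = 0"
    by (intro sum.neutral ballI) (simp only: lessThan_iff)
  then show ?thesis by (simp add: gap_polynomial_def)
qed

text \<open>The maximum modulus principle for \<open>exp (- p)\<close> serves as the minimum principle for \<open>Re p\<close>.\<close>

lemma Re_gap_polynomial_nonneg:
  assumes "cmod w \<le> 1"
  shows "0 \<le> Re (gap_polynomial N w)"
proof -
  have "cmod (exp (- gap_polynomial N w)) \<le> 1"
  proof (rule maximum_modulus_frontier[where S = "cball 0 1" and f = "\<lambda>w. exp (- gap_polynomial N w)"])
    show "(\<lambda>w. exp (- gap_polynomial N w)) holomorphic_on interior (cball 0 1)"
      by (intro holomorphic_intros gap_polynomial_holomorphic)
    show "continuous_on (closure (cball 0 1)) (\<lambda>w. exp (- gap_polynomial N w))"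
      by (intro holomorphic_on_imp_continuous_on holomorphic_intros gap_polynomial_holomorphic)
    show "cmod (exp (- gap_polynomial N z)) \<le> 1" if "z \<in> frontier (cball 0 1)" for z
      using that Re_gap_polynomial[of z N] by simp
  qed (use assms in auto)
  then show ?thesis by simp
qed

text \<open>Encoded by closed conditions instead of as an image under \<open>cantor_inv\<close>,
  which has jumps. For distinct i and j, the modulus condition on the sphere forces both coordinates
  to have modulus 1 / sqrt 2.\<close>

definition cantor_torus :: "'d \<Rightarrow> 'd \<Rightarrow> (complex ^ 'd::finite) set"
  where "cantor_torus i j = {z \<in> sphere 0 1. cmod (2 * z $ i * z $ j) = 1 \<and>
    (\<forall>k. 1 / 2 \<le> Re ((2 * z $ i * z $ j) ^ (512 ^ k)))}"

lemma closed_cantor_torus: "closed (cantor_torus i j :: (complex ^ 'd::finite) set)"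
proof -
  have "cantor_torus i j = sphere 0 1 \<inter> {z. cmod (2 * z $ i * z $ j) = 1} \<inter>
      (\<Inter>k. {z :: complex ^ 'd. 1 / 2 \<le> Re ((2 * z $ i * z $ j) ^ (512 ^ k))})"
    by (auto simp: cantor_torus_def)
  moreover have "closed {z :: complex ^ 'd. 1 / 2 \<le> Re ((2 * z $ i * z $ j) ^ (512 ^ k))}" for k
    by (intro closed_Collect_le continuous_intros)
  moreover have "closed {z :: complex ^ 'd. cmod (2 * z $ i * z $ j) = 1}"
    by (intro closed_Collect_eq continuous_intros)
  ultimately show ?thesis
    by (metis (no_types, lifting) closed_Int closed_INT closed_sphere)
qed

text \<open>The inequality of arithmetic and geometric means. It makes 2 z_i z_j a map from the
  closed ball to the closed disc, where the gap polynomials have nonnegative real part.\<close>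

lemma norm_two_coordinates_le:
  assumes "i \<noteq> j" shows "cmod (2 * z $ i * z $ j) \<le> (norm (z :: complex ^ 'd::finite))\<^sup>2"
proof -
  have "cmod (2 * z $ i * z $ j) \<le> (cmod (z $ i))\<^sup>2 + (cmod (z $ j))\<^sup>2"
    using sum_squares_bound[of "cmod (z $ i)" "cmod (z $ j)"] by (simp add: norm_mult)
  also have "\<dots> = (\<Sum>k\<in>{i, j}. (cmod (z $ k))\<^sup>2)" using assms by simp
  also have "\<dots> \<le> (\<Sum>k\<in>UNIV. (cmod (z $ k))\<^sup>2)" by (intro sum_mono2) auto
  finally show ?thesis by (simp add: norm_vec_def L2_set_def sum_nonneg)
qed

lemma gap_polynomial_ball_algebra:
  "(\<lambda>z :: complex ^ 'd::finite. gap_polynomial N (2 * z $ i * z $ j)) \<in> ball_algebra"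
  unfolding ball_algebra_def
proof (intro CollectI conjI ballI)
  show "continuous_on (cball 0 1) (\<lambda>z :: complex ^ 'd. gap_polynomial N (2 * z $ i * z $ j))"
    unfolding gap_polynomial_def[abs_def] by (intro continuous_intros)
  fix z :: "complex ^ 'd"
  obtain p' where p': "(gap_polynomial N has_field_derivative p') (at (2 * z $ i * z $ j))"
    using gap_polynomial_holomorphic[of N UNIV] by (auto simp: holomorphic_on_def field_differentiable_def)
  have c: "((\<lambda>z :: complex ^ 'd. z $ k) has_derivative (\<lambda>v. v $ k)) (at z)" for k
    by (intro bounded_linear.has_derivative[OF bounded_linear_vec_nth] has_derivative_ident)
  have "((\<lambda>z :: complex ^ 'd. 2 * z $ i * z $ j) has_derivative (\<lambda>v. 2 * z $ i * v $ j + 2 * v $ i * z $ j)) (at z)"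
    by (intro has_derivative_mult has_derivative_mult_right c)
  from has_derivative_compose[OF this p'[unfolded has_field_derivative_def]]
  show "complex_differentiable_at (\<lambda>z :: complex ^ 'd. gap_polynomial N (2 * z $ i * z $ j)) z"
    unfolding complex_differentiable_at_def
    by (intro exI conjI) (assumption, simp add: algebra_simps)
qed

text \<open>A Chebyshev argument: the real part of the pulled-back gap polynomial is nonnegative on
  the sphere, at least N^2 / 4 on the set, and has integral N, its value at the origin. So the set
  has measure at most 4 / N for every positive N.\<close>

lemma cantor_torus_null:
  fixes \<tau> :: "(complex ^ 'd::finite) measure"
  assumes ij: "i \<noteq> j" and \<tau>: "representing_measure \<tau>"
  shows "cantor_torus i j \<in> sets \<tau>" "emeasure \<tau> (cantor_torus i j) = 0"
proof -
  have b: "borel_prob_on_sphere \<tau>" using \<tau> by (simp add: representing_measure_def)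
  interpret prob_space \<tau> using b by (simp add: borel_prob_on_sphere_def)
  note sp = borel_prob_on_sphere_space[OF b]
  let ?C = "cantor_torus i j"
  have "?C \<subseteq> sphere 0 1" by (auto simp: cantor_torus_def)
  then show C: "?C \<in> sets \<tau>"
    using b closed_cantor_torus[of i j] by (auto simp: borel_prob_on_sphere_def sets_restrict_space_iff)
  have "measure \<tau> ?C \<le> 4 / real N" if N: "0 < N" for N
  proof -
    let ?f = "\<lambda>z :: complex ^ 'd. gap_polynomial N (2 * z $ i * z $ j)"
    have cont: "continuous_on (sphere 0 1) ?f"
      using gap_polynomial_ball_algebra[of N i j] unfolding ball_algebra_def
      by (auto intro: continuous_on_subset[OF _ sphere_cball])
    have int: "integrable \<tau> ?f" by (rule borel_prob_on_sphere_integrable[OF b cont])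
    have "(\<integral>z. ?f z \<partial>\<tau>) = of_nat N"
      using \<tau> gap_polynomial_ball_algebra[of N i j]
      by (simp add: representing_measure_def gap_polynomial_0)
    then have E: "(\<integral>z. Re (?f z) \<partial>\<tau>) = real N" using int by simp
    have lower: "(real N)\<^sup>2 / 4 * indicator ?C z \<le> Re (?f z)" if z: "z \<in> sphere 0 1" for z
    proof (cases "z \<in> ?C")
      case True
      let ?w = "2 * z $ i * z $ j"
      have w: "cmod ?w = 1" "\<And>k. 1 / 2 \<le> Re (?w ^ (512 ^ k))"
        using True unfolding cantor_torus_def by blast+
      have "real N / 2 = (\<Sum>k<N. 1 / 2)" by simp
      also have "\<dots> \<le> Re (\<Sum>k<N. ?w ^ (512 ^ k))" unfolding Re_sum by (intro sum_mono w)
      also have "\<dots> \<le> cmod (\<Sum>k<N. ?w ^ (512 ^ k))" by (rule complex_Re_le_cmod)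
      finally have "(real N / 2)\<^sup>2 \<le> (cmod (\<Sum>k<N. ?w ^ (512 ^ k)))\<^sup>2" by (intro power_mono) simp_all
      then show ?thesis using True by (simp only: Re_gap_polynomial[OF w(1)]) (simp add: power_divide)
    next
      case False
      then show ?thesis
        using Re_gap_polynomial_nonneg[of "2 * z $ i * z $ j" N] norm_two_coordinates_le[OF ij, of z] z by simp
    qed
    have "(real N)\<^sup>2 / 4 * measure \<tau> ?C = (\<integral>z. (real N)\<^sup>2 / 4 * indicator ?C z \<partial>\<tau>)"
      using C by simp
    also have "\<dots> \<le> (\<integral>z. Re (?f z) \<partial>\<tau>)"
    proof (rule integral_mono)
      show "integrable \<tau> (\<lambda>z. (real N)\<^sup>2 / 4 * indicator ?C z)"
        using C by (intro integrable_mult_right integrable_real_indicator) (simp_all add: emeasure_finite less_top[symmetric])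
      show "integrable \<tau> (\<lambda>z. Re (?f z))" using int by simp
    qed (use lower in \<open>simp only: sp\<close>)
    finally have "(real N)\<^sup>2 / 4 * measure \<tau> ?C \<le> real N" by (simp add: E)
    then show ?thesis using N by (simp add: field_simps power2_eq_square)
  qed
  moreover have "(\<lambda>N. 4 / real N) \<longlonglongrightarrow> 0"
    using lim_const_over_n[of "4 :: real"] by simp
  ultimately have "measure \<tau> ?C \<le> 0"
    by (intro LIMSEQ_le_const) (auto intro: exI[of _ 1])
  then show "emeasure \<tau> ?C = 0" by (simp add: emeasure_eq_measure measure_le_0_iff)
qed

section \<open>The measure and its energy\<close>

lemma nn_integral_inverse_powr:
  assumes p: "0 < p" "p < 1" and x: "0 \<le> x" "x \<le> 1"
  shows "(\<integral>\<^sup>+y. inverse (ennreal (\<bar>x - y\<bar> powr p)) \<partial>restrict_space lborel {0..<1}) \<le> ennreal (2 / (1 - p))"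
proof -
  define g :: "real \<Rightarrow> ennreal" where "g t = inverse (ennreal (t powr p)) * indicator {0..1} t" for t
  have [measurable]: "g \<in> borel_measurable borel" unfolding g_def by measurable
  have "((\<lambda>t. t powr (- p)) has_integral (1 / (1 - p))) {0..1}"
    using has_integral_powr_from_0[of "- p" 1] p by simp
  then have "((\<lambda>t. if t \<in> {0..1} then t powr (- p) else 0) has_integral (1 / (1 - p))) UNIV"
    by (simp only: has_integral_restrict_UNIV)
  then have "(\<integral>\<^sup>+t. ennreal (if t \<in> {0..1} then t powr (- p) else 0) \<partial>lborel) = ennreal (1 / (1 - p))"
    by (intro nn_integral_has_integral_lborel) auto
  \<comment> \<open>The two integrands differ at t = 0 only: \<open>g\<close> is infinite there,
    while \<open>powr\<close> gives 0.\<close>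
  moreover have "(\<integral>\<^sup>+t. g t \<partial>lborel) = (\<integral>\<^sup>+t. ennreal (if t \<in> {0..1} then t powr (- p) else 0) \<partial>lborel)"
  proof (rule nn_integral_cong_AE)
    have "AE t in lborel. t \<noteq> (0::real)" by (rule AE_lborel_singleton)
    then show "AE t in lborel. g t = ennreal (if t \<in> {0..1} then t powr (- p) else 0)"
      by eventually_elim (auto simp: g_def inverse_ennreal powr_minus)
  qed
  ultimately have g_int: "(\<integral>\<^sup>+t. g t \<partial>lborel) = ennreal (1 / (1 - p))" by simp
  have g_refl: "(\<integral>\<^sup>+t. g (- t) \<partial>lborel) = (\<integral>\<^sup>+t. g t \<partial>lborel)"
    using nn_integral_real_affine[of g "- 1" 0] by simp
  have "(\<integral>\<^sup>+y. inverse (ennreal (\<bar>x - y\<bar> powr p)) \<partial>restrict_space lborel {0..<1})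
      = (\<integral>\<^sup>+y. inverse (ennreal (\<bar>x - y\<bar> powr p)) * indicator {0..<1} y \<partial>lborel)"
    by (rule nn_integral_restrict_space) simp
  also have "\<dots> = (\<integral>\<^sup>+t. inverse (ennreal (\<bar>t\<bar> powr p)) * indicator {0..<1} (x + t) \<partial>lborel)"
    using nn_integral_real_affine[of "\<lambda>y. inverse (ennreal (\<bar>x - y\<bar> powr p)) * indicator {0..<1} y" 1 x] by simp
  \<comment> \<open>After translation t lies in [-1, 1]; \<open>g\<close> and its reflection cover
    the two sides of the singularity, each with integral 1 / (1 - p).\<close>
  also have "\<dots> \<le> (\<integral>\<^sup>+t. g t + g (- t) \<partial>lborel)"
    using x by (intro nn_integral_mono) (auto simp: g_def indicator_def abs_if)
  also have "\<dots> = (\<integral>\<^sup>+t. g t \<partial>lborel) + (\<integral>\<^sup>+t. g (- t) \<partial>lborel)"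
    by (rule nn_integral_add) measurable
  also have "\<dots> = ennreal (2 / (1 - p))"
    using p unfolding g_refl g_int by (simp flip: ennreal_plus)
  finally show ?thesis .
qed

text \<open>Taylor expansion of orders 2 and 4; for the second bound, t^4 \<le> t^2 leaves at least
  t^2 / 2 - t^2 / 24.\<close>

lemma cos_quadratic_bounds:
  fixes t :: real
  shows "1 - t\<^sup>2 / 2 \<le> cos t" and "\<bar>t\<bar> \<le> 1 \<Longrightarrow> t\<^sup>2 / 4 \<le> 1 - cos t"
proof -
  obtain u where "cos t = (\<Sum>m<2. cos_coeff m * t ^ m) + cos (u + 1 / 2 * real 2 * pi) / fact 2 * t ^ 2"
    using Maclaurin_cos_expansion[of t 2] by blast
  then have "cos t = 1 + cos (u + pi) / 2 * t\<^sup>2"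
    by (simp add: numeral_2_eq_2 cos_coeff_def)
  moreover have "- 1 * t\<^sup>2 \<le> cos (u + pi) * t\<^sup>2" by (intro mult_right_mono) simp_all
  ultimately show "1 - t\<^sup>2 / 2 \<le> cos t" by simp
  assume t: "\<bar>t\<bar> \<le> 1"
  obtain u where "cos t = (\<Sum>m<4. cos_coeff m * t ^ m) + cos (u + 1 / 2 * real 4 * pi) / fact 4 * t ^ 4"
    using Maclaurin_cos_expansion[of t 4] by blast
  moreover have "(\<Sum>m<4. cos_coeff m * t ^ m) = 1 - t\<^sup>2 / 2"
    by (simp add: eval_nat_numeral cos_coeff_Suc sin_coeff_Suc)
  ultimately have "cos t = 1 - t\<^sup>2 / 2 + cos (u + 2 * pi) / 24 * t ^ 4"
    by (simp add: fact_numeral)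
  moreover have "cos (u + 2 * pi) * t ^ 4 \<le> 1 * t ^ 4" by (intro mult_right_mono) simp_all
  moreover have "t ^ 4 \<le> t\<^sup>2" using t power_decreasing[of 2 4 "\<bar>t\<bar>"] by simp
  moreover have "0 \<le> t\<^sup>2" by simp
  ultimately show "t\<^sup>2 / 4 \<le> 1 - cos t" by linarith
qed

text \<open>The squared modulus equals (1 - cos s)^2 + 2 cos s (1 - cos a), a sum of nonnegative
  terms since cos s is at least 1 / 2. The modulus is thus of first order in a but only of second
  order in s.\<close>

lemma norm_one_minus_cis_cos:
  assumes "\<bar>a\<bar> \<le> 1" "\<bar>s\<bar> \<le> 1"
  shows "a\<^sup>2 / 4 \<le> (cmod (1 - cis a * of_real (cos s)))\<^sup>2"
    and "s ^ 4 / 16 \<le> (cmod (1 - cis a * of_real (cos s)))\<^sup>2"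
proof -
  have "(cmod (1 - cis a * of_real (cos s)))\<^sup>2 = (1 - cos a * cos s)\<^sup>2 + (sin a * cos s)\<^sup>2"
    by (simp add: cmod_power2)
  also have "\<dots> = 1 - 2 * cos a * cos s + ((cos a)\<^sup>2 + (sin a)\<^sup>2) * (cos s)\<^sup>2"
    by algebra
  also have "\<dots> = (1 - cos s)\<^sup>2 + 2 * cos s * (1 - cos a)"
    by (simp only: sin_cos_squared_add2) (simp add: power2_eq_square algebra_simps)
  finally have eq: "(cmod (1 - cis a * of_real (cos s)))\<^sup>2 = (1 - cos s)\<^sup>2 + 2 * cos s * (1 - cos a)" .
  have "s\<^sup>2 \<le> 1" using assms(2) by (simp add: abs_square_le_1)
  then have c: "1 / 2 \<le> cos s" using cos_quadratic_bounds(1)[of s] by simp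
  have "1 * (1 - cos a) \<le> (2 * cos s) * (1 - cos a)" using c by (intro mult_right_mono) simp_all
  moreover have "a\<^sup>2 / 4 \<le> 1 - cos a" using assms(1) by (rule cos_quadratic_bounds)
  ultimately have 1: "a\<^sup>2 / 4 \<le> 2 * cos s * (1 - cos a)" by simp
  then show "a\<^sup>2 / 4 \<le> (cmod (1 - cis a * of_real (cos s)))\<^sup>2"
    unfolding eq using zero_le_power2[of "1 - cos s"] by linarith
  have "(s\<^sup>2 / 4)\<^sup>2 \<le> (1 - cos s)\<^sup>2" using cos_quadratic_bounds(2)[OF assms(2)] by (intro power_mono) simp_all
  moreover have "(s\<^sup>2 / 4)\<^sup>2 = s ^ 4 / 16" by (simp add: power_divide flip: power_mult)
  moreover have "0 \<le> 2 * cos s * (1 - cos a)" using c by simp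
  ultimately show "s ^ 4 / 16 \<le> (cmod (1 - cis a * of_real (cos s)))\<^sup>2"
    unfolding eq by linarith
qed

section \<open>Parametrisation of the torus and the kernel on it\<close>

text \<open>Each coordinate carries half of the Cantor angle, so 2 z_i z_j has the full angle; the
  second parameter moves along the fibre with opposite signs and cancels in the product.\<close>

definition torus_point :: "'d \<Rightarrow> 'd \<Rightarrow> real \<times> real \<Rightarrow> complex ^ 'd::finite"
  where "torus_point i j p = (\<chi> k. if k = i then cis (pi * cantor_inv (fst p) + snd p) / of_real (sqrt 2)
    else if k = j then cis (pi * cantor_inv (fst p) - snd p) / of_real (sqrt 2) else 0)"

lemma torus_point_sphere:
  assumes "i \<noteq> j" shows "norm (torus_point i j p) = 1"
proof -
  have "(norm (torus_point i j p))\<^sup>2 = (\<Sum>k\<in>UNIV. (cmod (torus_point i j p $ k))\<^sup>2)"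
    by (simp add: norm_vec_def L2_set_def sum_nonneg)
  also have "\<dots> = (\<Sum>k\<in>{i, j}. (cmod (torus_point i j p $ k))\<^sup>2)"
    by (rule sum.mono_neutral_right) (auto simp: torus_point_def)
  also have "\<dots> = 1" using assms by (simp add: torus_point_def norm_divide power_divide)
  finally show ?thesis using norm_ge_zero[of "torus_point i j p"] unfolding power2_eq_1_iff by linarith
qed

text \<open>With a and s the differences of the two angles, the coordinates contribute cis(a + s) /
  2 and cis(a - s) / 2.\<close>

lemma herm_torus_point:
  assumes "i \<noteq> j"
  shows "herm (torus_point i j p) (torus_point i j q)
    = cis (pi * (cantor_inv (fst p) - cantor_inv (fst q))) * of_real (cos (snd p - snd q))"
proof -
  let ?a = "pi * (cantor_inv (fst p) - cantor_inv (fst q))" and ?s = "snd p - snd q"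
  have sq: "complex_of_real (sqrt 2) * complex_of_real (sqrt 2) = 2" by (simp flip: of_real_mult)
  have "herm (torus_point i j p) (torus_point i j q)
      = (\<Sum>k\<in>{i, j}. torus_point i j p $ k * cnj (torus_point i j q $ k))"
    by (rule sum.mono_neutral_right) (auto simp: torus_point_def)
  also have "\<dots> = (cis (?a + ?s) + cis (?a - ?s)) / 2"
    using assms by (simp add: torus_point_def cis_cnj cis_mult sq add_divide_distrib algebra_simps)
  also have "\<dots> = cis ?a * of_real (cos ?s)"
    by (simp add: complex_eq_iff cos_add cos_diff sin_add sin_diff)
  finally show ?thesis .
qed

text \<open>With x and s the parameter distances and c the modulus on the right, both x^3 and s^4
  are at most 2^22 c^2. Raising these to the powers 3/10 and 1/5, which add up to 1/2, bounds the
  product by 2048 c. The weights are chosen so that 9/10 and 4/5 are both below 1, making each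
  singularity integrable.\<close>

lemma norm_one_minus_herm_torus_point:
  assumes ij: "i \<noteq> j" and p: "0 \<le> fst p" "fst p < 1" "0 \<le> snd p" "snd p < 1"
    and q: "0 \<le> fst q" "fst q < 1" "0 \<le> snd q" "snd q < 1"
  shows "\<bar>fst p - fst q\<bar> powr (9 / 10) * \<bar>snd p - snd q\<bar> powr (4 / 5)
    \<le> 2048 * cmod (1 - herm (torus_point i j p) (torus_point i j q))"
proof -
  define x s c where "x = \<bar>fst p - fst q\<bar>" and "s = \<bar>snd p - snd q\<bar>"
    and "c = cmod (1 - herm (torus_point i j p) (torus_point i j q))"
  let ?f = "cantor_inv (fst p) - cantor_inv (fst q)"
  have nn: "0 \<le> x" "0 \<le> s" "0 \<le> c" by (simp_all add: x_def s_def c_def)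
  have f: "\<bar>?f\<bar> \<le> 1 / 8" using cantor_inv_bounds[of "fst p"] cantor_inv_bounds[of "fst q"] by linarith
  have a: "\<bar>pi * ?f\<bar> \<le> 1"
    using mult_mono[of pi 4 "\<bar>?f\<bar>" "1 / 8"] f pi_less_4 by (simp add: abs_mult)
  have a': "\<bar>?f\<bar> \<le> \<bar>pi * ?f\<bar>"
    using mult_right_mono[of 1 pi "\<bar>?f\<bar>"] pi_gt3 by (simp add: abs_mult)
  have s1: "\<bar>snd p - snd q\<bar> \<le> 1" using p q by (simp add: abs_le_iff)
  note b = norm_one_minus_cis_cos[OF a s1, folded herm_torus_point[OF ij], folded c_def]
  \<comment> \<open>The factor 2^20 comes from the expansion estimate and another 4 from the bound
    a^2 / 4; together they give 2^22 = 2048^2.\<close>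
  have "x ^ 3 \<le> 2 ^ 20 * ?f\<^sup>2" unfolding x_def by (rule cantor_inv_expanding) (use p q in auto)
  also have "?f\<^sup>2 \<le> (pi * ?f)\<^sup>2" using a' by (simp only: abs_le_square_iff)
  also have "(pi * ?f)\<^sup>2 \<le> 4 * c\<^sup>2" using b(1) by simp
  finally have 1: "x ^ 3 \<le> 2 ^ 22 * c\<^sup>2" by simp
  have "s ^ 4 \<le> 16 * c\<^sup>2" using b(2) by (simp add: s_def)
  also have "\<dots> \<le> 2 ^ 22 * c\<^sup>2" by (intro mult_right_mono) simp_all
  finally have 2: "s ^ 4 \<le> 2 ^ 22 * c\<^sup>2" .
  have "(x ^ 3) powr (3 / 10) = x powr (9 / 10)" if "0 < x"
    using that powr_powr[of x 3 "3 / 10"] by simp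
  moreover have "(s ^ 4) powr (1 / 5) = s powr (4 / 5)" if "0 < s"
    using that powr_powr[of s 4 "1 / 5"] by simp
  moreover have "(x ^ 3) powr (3 / 10) * (s ^ 4) powr (1 / 5) \<le> (2 ^ 22 * c\<^sup>2) powr (3 / 10) * (2 ^ 22 * c\<^sup>2) powr (1 / 5)"
    using nn 1 2 by (intro mult_mono powr_mono2) simp_all
  ultimately have "x powr (9 / 10) * s powr (4 / 5) \<le> (2 ^ 22 * c\<^sup>2) powr (3 / 10) * (2 ^ 22 * c\<^sup>2) powr (1 / 5)"
    using nn by (cases "x = 0 \<or> s = 0") auto
  also have "\<dots> = sqrt (2 ^ 22 * c\<^sup>2)"
    by (simp add: powr_half_sqrt flip: powr_add)
  also have "\<dots> = 2048 * c"
    using nn by (simp add: real_sqrt_mult real_sqrt_unique[of 2048])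
  finally show ?thesis by (simp add: x_def s_def c_def)
qed

section \<open>The image measure and its energy\<close>

abbreviation unit_interval :: "real measure"
  where "unit_interval \<equiv> restrict_space lborel {0..<1}"

lemma prob_space_unit_square: "prob_space (unit_interval \<Otimes>\<^sub>M unit_interval)"
proof -
  have "prob_space unit_interval"
    by (rule prob_spaceI) (simp add: emeasure_restrict_space space_restrict_space)
  then interpret pair_prob_space unit_interval unit_interval
    by (simp add: pair_prob_space_def pair_sigma_finite_def prob_space_imp_sigma_finite)
  show ?thesis by unfold_locales
qed

text \<open>Factor the map as a continuous function of the Cantor angle and the fibre angle,
  preceded by the merely Borel map \<open>cantor_inv\<close> in the first variable.\<close>

lemma torus_point_measurable:
  assumes "i \<noteq> j"
  shows "torus_point i j \<in> measurable (unit_interval \<Otimes>\<^sub>M unit_interval) (restrict_space borel (sphere 0 1))"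
proof (rule measurable_restrict_space2)
  show "torus_point i j \<in> space (unit_interval \<Otimes>\<^sub>M unit_interval) \<rightarrow> sphere 0 1"
    by (simp add: torus_point_sphere[OF assms])
  let ?G = "\<lambda>q :: real \<times> real. \<chi> k. if k = i then cis (pi * fst q + snd q) / of_real (sqrt 2)
    else if k = j then cis (pi * fst q - snd q) / of_real (sqrt 2) else 0"
  have "continuous_on UNIV (\<lambda>q :: real \<times> real. if k = i then cis (pi * fst q + snd q) / of_real (sqrt 2)
    else if k = j then cis (pi * fst q - snd q) / of_real (sqrt 2) else 0)" for k
    by (cases "k = i"; cases "k = j") (auto intro!: continuous_intros)
  then have "?G \<in> borel_measurable borel"
    by (intro borel_measurable_continuous_onI continuous_on_vec_lambda)
  moreover have "(\<lambda>p. (cantor_inv (fst p), snd p)) \<in> borel_measurable (unit_interval \<Otimes>\<^sub>M unit_interval)"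
  proof (rule borel_measurable_Pair)
    have "cantor_inv \<in> borel_measurable unit_interval"
      by (intro measurable_restrict_space1) simp
    then show "(\<lambda>p. cantor_inv (fst p)) \<in> borel_measurable (unit_interval \<Otimes>\<^sub>M unit_interval)"
      by (rule measurable_compose[OF measurable_fst])
    have "(\<lambda>x. x) \<in> borel_measurable unit_interval" by (intro measurable_restrict_space1) simp
    then show "snd \<in> borel_measurable (unit_interval \<Otimes>\<^sub>M unit_interval)"
      by (rule measurable_compose[OF measurable_snd])
  qed
  ultimately have "(\<lambda>p. ?G (cantor_inv (fst p), snd p)) \<in> borel_measurable (unit_interval \<Otimes>\<^sub>M unit_interval)"
    by (rule measurable_compose[rotated])
  then show "torus_point i j \<in> borel_measurable (unit_interval \<Otimes>\<^sub>M unit_interval)"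
    unfolding torus_point_def[abs_def] by (simp cong: if_cong)
qed

definition cantor_torus_measure :: "'d \<Rightarrow> 'd \<Rightarrow> (complex ^ 'd::finite) measure"
  where "cantor_torus_measure i j =
    distr (unit_interval \<Otimes>\<^sub>M unit_interval) (restrict_space borel (sphere 0 1)) (torus_point i j)"

lemma borel_prob_cantor_torus_measure:
  "i \<noteq> j \<Longrightarrow> borel_prob_on_sphere (cantor_torus_measure i j)"
  unfolding borel_prob_on_sphere_def cantor_torus_measure_def
  using prob_space.prob_space_distr[OF prob_space_unit_square torus_point_measurable] by simp

text \<open>The kernel is dominated by a product of functions of one variable each, so the integral
  splits; the two factors are at most 20 and 10, independently of p.\<close>

lemma cantor_torus_measure_potential:
  assumes ij: "i \<noteq> j" and p: "p \<in> space (unit_interval \<Otimes>\<^sub>M unit_interval)"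
  shows "(\<integral>\<^sup>+q. inverse (ennreal (cmod (1 - herm (torus_point i j p) (torus_point i j q))))
    \<partial>(unit_interval \<Otimes>\<^sub>M unit_interval)) \<le> ennreal (2048 * 200)"
proof -
  interpret prob_space unit_interval
    by (rule prob_spaceI) (simp add: emeasure_restrict_space space_restrict_space)
  let ?\<phi> = "\<lambda>t. inverse (ennreal (\<bar>fst p - t\<bar> powr (9 / 10)))"
  let ?\<psi> = "\<lambda>t. inverse (ennreal (\<bar>snd p - t\<bar> powr (4 / 5)))"
  have [measurable]: "?\<phi> \<in> borel_measurable unit_interval" "?\<psi> \<in> borel_measurable unit_interval"
    by (intro measurable_restrict_space1; measurable)+
  have pb: "0 \<le> fst p" "fst p < 1" "0 \<le> snd p" "snd p < 1"
    using p by (auto simp: space_pair_measure space_restrict_space)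
  have "inverse (ennreal (cmod (1 - herm (torus_point i j p) (torus_point i j q))))
      \<le> ennreal 2048 * (?\<phi> (fst q) * ?\<psi> (snd q))"
    if "q \<in> space (unit_interval \<Otimes>\<^sub>M unit_interval)" for q
  proof -
    define a b c where "a = \<bar>fst p - fst q\<bar> powr (9 / 10)" and "b = \<bar>snd p - snd q\<bar> powr (4 / 5)"
      and "c = cmod (1 - herm (torus_point i j p) (torus_point i j q))"
    have nn: "0 \<le> a" "0 \<le> b" "0 \<le> c" by (simp_all add: a_def b_def c_def)
    have "0 \<le> fst q" "fst q < 1" "0 \<le> snd q" "snd q < 1"
      using that by (auto simp: space_pair_measure space_restrict_space)
    then have le: "a * b \<le> 2048 * c"
      unfolding a_def b_def c_def by (rule norm_one_minus_herm_torus_point[OF ij pb])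
    have "inverse (ennreal c) \<le> ennreal 2048 * (inverse (ennreal a) * inverse (ennreal b))"
    proof (cases "a * b = 0")
      case True
      \<comment> \<open>On the singular lines the majorant is infinite, so nothing has to be known
        about c.\<close>
      then have "ennreal a * ennreal b = 0" by (auto simp: ennreal_mult)
      then have "inverse (ennreal a) * inverse (ennreal b) = top"
        using ennreal_inverse_mult[of "ennreal a" "ennreal b"]
        by (simp only: ennreal_less_top ennreal_inverse_zero)
      then show ?thesis by (simp add: ennreal_mult_top)
    next
      case False
      then have "0 < a" "0 < b" using nn by auto
      moreover from this have "0 < c" using le mult_pos_pos[of a b] by linarith
      ultimately have pos: "0 < a" "0 < b" "0 < c" .
      then have "inverse c \<le> 2048 * (inverse a * inverse b)" using le by (simp add: field_simps)
      then have "ennreal (inverse c) \<le> ennreal (2048 * (inverse a * inverse b))" by (rule ennreal_leI)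
      then show ?thesis using pos by (simp add: inverse_ennreal ennreal_mult)
    qed
    then show ?thesis by (simp only: a_def b_def c_def)
  qed
  then have "(\<integral>\<^sup>+q. inverse (ennreal (cmod (1 - herm (torus_point i j p) (torus_point i j q))))
    \<partial>(unit_interval \<Otimes>\<^sub>M unit_interval)) \<le> (\<integral>\<^sup>+q. ennreal 2048 * (?\<phi> (fst q) * ?\<psi> (snd q)) \<partial>(unit_interval \<Otimes>\<^sub>M unit_interval))"
    by (rule nn_integral_mono)
  also have "\<dots> = (\<integral>\<^sup>+x. \<integral>\<^sup>+s. ennreal 2048 * (?\<phi> x * ?\<psi> s) \<partial>unit_interval \<partial>unit_interval)"
    by (subst nn_integral_fst[symmetric]) simp_all
  also have "\<dots> = ennreal 2048 * ((\<integral>\<^sup>+x. ?\<phi> x \<partial>unit_interval) * (\<integral>\<^sup>+s. ?\<psi> s \<partial>unit_interval))"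
    by (simp add: nn_integral_cmult nn_integral_multc)
  also have "\<dots> \<le> ennreal 2048 * (ennreal (2 / (1 - 9 / 10)) * ennreal (2 / (1 - 4 / 5)))"
    by (intro mult_left_mono mult_mono nn_integral_inverse_powr) (use pb in simp_all)
  also have "\<dots> = ennreal (2048 * 200)"
    by (simp flip: ennreal_mult)
  finally show ?thesis .
qed

text \<open>Changing variables in both integrals moves the energy to the parameter square, where the
  inner integral is uniformly bounded and the outer measure has mass 1.\<close>

lemma henkin_cantor_torus_measure:
  fixes i j :: "'d::finite"
  assumes ij: "i \<noteq> j"
  shows "A_henkin (cantor_torus_measure i j)"
proof (rule finite_energy_imp_henkin)
  let ?U = "unit_interval \<Otimes>\<^sub>M unit_interval" and ?T = "torus_point i j"
  let ?\<mu> = "cantor_torus_measure i j"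
  let ?k = "\<lambda>z w :: complex ^ 'd. inverse (ennreal (cmod (1 - herm z w)))"
  show b: "borel_prob_on_sphere ?\<mu>" using ij by (rule borel_prob_cantor_torus_measure)
  interpret U: prob_space ?U by (rule prob_space_unit_square)
  interpret prob_space ?\<mu> using b by (simp add: borel_prob_on_sphere_def)
  note T = torus_point_measurable[OF ij]
  have "(\<lambda>p. inverse (ennreal (cmod (1 - herm (fst p) (snd p))))) \<in> borel_measurable (?\<mu> \<Otimes>\<^sub>M ?\<mu>)"
    using herm_measurable[OF b] by measurable
  then have k: "(\<lambda>(z, w). ?k z w) \<in> borel_measurable (?\<mu> \<Otimes>\<^sub>M ?\<mu>)" by (simp add: split_beta)
  have "(\<lambda>z. \<integral>\<^sup>+w. ?k z w \<partial>?\<mu>) \<in> borel_measurable ?\<mu>"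
    using k by (rule borel_measurable_nn_integral)
  then have "(\<integral>\<^sup>+z. \<integral>\<^sup>+w. ?k z w \<partial>?\<mu> \<partial>?\<mu>) = (\<integral>\<^sup>+p. \<integral>\<^sup>+w. ?k (?T p) w \<partial>?\<mu> \<partial>?U)"
    unfolding cantor_torus_measure_def by (intro nn_integral_distr T) simp
  also have "\<dots> \<le> (\<integral>\<^sup>+p. ennreal (2048 * 200) \<partial>?U)"
  proof (rule nn_integral_mono)
    fix p assume p: "p \<in> space ?U"
    then have "?T p \<in> space ?\<mu>" using measurable_space[OF T] by (simp add: cantor_torus_measure_def)
    then have "?k (?T p) \<in> borel_measurable ?\<mu>"
      using measurable_Pair2[OF k] by simp
    then have "(\<integral>\<^sup>+w. ?k (?T p) w \<partial>?\<mu>) = (\<integral>\<^sup>+q. ?k (?T p) (?T q) \<partial>?U)"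
      unfolding cantor_torus_measure_def by (intro nn_integral_distr T) simp
    also have "\<dots> \<le> ennreal (2048 * 200)" by (rule cantor_torus_measure_potential[OF ij p])
    finally show "(\<integral>\<^sup>+w. ?k (?T p) w \<partial>?\<mu>) \<le> ennreal (2048 * 200)" .
  qed
  also have "\<dots> < \<infinity>" by (simp add: U.emeasure_space_1)
  finally show "(\<integral>\<^sup>+z. \<integral>\<^sup>+w. ?k z w \<partial>?\<mu> \<partial>?\<mu>) < \<infinity>" .
qed

section \<open>The support of the measure\<close>

lemma torus_point_in_cantor_torus:
  assumes "i \<noteq> j"
  shows "torus_point i j p \<in> cantor_torus i j"
proof -
  have sq: "complex_of_real (sqrt 2) * complex_of_real (sqrt 2) = 2" by (simp flip: of_real_mult)
  have "2 * torus_point i j p $ i * torus_point i j p $ j = cis (2 * pi * cantor_inv (fst p))"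
    using assms by (simp add: torus_point_def cis_mult sq mult.assoc)
  moreover have "1 / 2 \<le> Re (cis (2 * pi * cantor_inv (fst p)) ^ (512 ^ k))" for k
    unfolding Complex.DeMoivre cis.sel of_nat_power of_nat_numeral by (rule cos_cantor_inv)
  ultimately show ?thesis
    using torus_point_sphere[OF assms, of p] by (simp only: cantor_torus_def) simp
qed

text \<open>The complement of the closed set is open and is missed by every
  \<open>torus_point\<close>, so it carries no mass.\<close>

lemma measure_support_cantor_torus:
  assumes "i \<noteq> j"
  shows "measure_support (cantor_torus_measure i j) \<subseteq> cantor_torus i j"
proof
  let ?\<mu> = "cantor_torus_measure i j"
  have sp: "space ?\<mu> = sphere 0 1" by (simp add: cantor_torus_measure_def space_restrict_space)
  fix z assume z: "z \<in> measure_support ?\<mu>"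
  show "z \<in> cantor_torus i j"
  proof (rule ccontr)
    assume "z \<notin> cantor_torus i j"
    then have "0 < emeasure ?\<mu> (- cantor_torus i j \<inter> sphere 0 1)"
      using z closed_cantor_torus[of i j] by (auto simp: measure_support_def sp)
    moreover have "torus_point i j -` (- cantor_torus i j \<inter> sphere 0 1) = {}"
      using torus_point_in_cantor_torus[OF assms] by auto
    moreover have "- cantor_torus i j \<inter> sphere 0 1 \<in> sets (restrict_space borel (sphere 0 1))"
      using closed_cantor_torus[of i j] by (auto simp: sets_restrict_space_iff intro: borel_closed)
    ultimately show False
      using emeasure_distr[OF torus_point_measurable[OF assms]] by (simp add: cantor_torus_measure_def)
  qed
qed

text \<open>The support arises from the compact sphere by removing all open sets of measure
  zero.\<close>

lemma compact_measure_support: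
  assumes "borel_prob_on_sphere \<mu>"
  shows "compact (measure_support \<mu>)"
proof -
  have "measure_support \<mu> = sphere 0 1 - \<Union>{U. open U \<and> emeasure \<mu> (U \<inter> space \<mu>) = 0}"
    by (auto simp: measure_support_def borel_prob_on_sphere_space[OF assms] zero_less_iff_neq_zero)
  then show ?thesis by (simp only:) (intro compact_diff compact_sphere open_Union; simp)
qed

theorem theorem1p3:
  assumes "CARD('d::finite) \<ge> 2"
  shows "\<exists>\<mu> :: (complex ^ 'd) measure.
    borel_prob_on_sphere \<mu> \<and> A_henkin \<mu> \<and> totally_null (measure_support \<mu>)"
proof -
  \<comment> \<open>Dimension at least 2 provides the two distinct coordinates spanning the
    torus.\<close>
  obtain i j :: 'd where ij: "i \<noteq> j"
    using assms by (metis (full_types) UNIV_I card_2_iff' card_le_Suc0_iff_eq finite_code not_less_eq_eq numeral_2_eq_2)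
  let ?\<mu> = "cantor_torus_measure i j"
  have b: "borel_prob_on_sphere ?\<mu>" using ij by (rule borel_prob_cantor_torus_measure)
  have "emeasure \<tau> (measure_support ?\<mu>) = 0" if "representing_measure \<tau>" for \<tau>
    using emeasure_mono[OF measure_support_cantor_torus[OF ij] cantor_torus_null(1)[OF ij that]]
      cantor_torus_null(2)[OF ij that] by simp
  then have "totally_null (measure_support ?\<mu>)"
    unfolding totally_null_def using compact_measure_support[OF b]
    by (auto simp: measure_support_def borel_prob_on_sphere_space[OF b])
  with b henkin_cantor_torus_measure[OF ij] show ?thesis by blast
qed

end
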